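(* Let $\mu$ be a non-atomic self-similar measure supported on an interval $J\subseteq\mathbb{R}$, and let $g\in C^\omega(J)$ be a non-affine real analytic function. Then there exist $\tau>0$ and $C>0$ such that $$\left|\int_J e^{2\pi i g(x)\lambda}\,d\mu(x)\right|\le C|\lambda|^{-\tau}\quad\text{as }|\lambda|\to\infty,$$ that is, for all real $\lambda$ with $|\lambda|$ sufficiently large.
   Context: A self-similar IFS is a finite set $\Phi=\{f_1,\dots,f_n\}$ of maps $f_i(x)=r_i x+t_i$ with $r_i\in(-1,1)\setminus\{0\}$, $t_i\in\mathbb{R}$, each mapping some fixed compact interval into itself. Standing assumption: there exist $i\ne j$ such that the fixed points of $f_i$ and $f_j$ differ. Given a probability vector $(p_1,\dots,p_n)$ with all $p_i>0$, the self-similar measure is the unique Borel probability measure $\mu$ on $\mathbb{R}$ with $\mu=\sum_{i=1}^n p_i\, f_i\mu$, where $f_i\mu$ is the push-forward of $\mu$ under $f_i$. $C^\omega(J)$ denotes the real-valued real analytic functions on $J$. *)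

theory Defs
  imports "HOL-Probability.Probability"
begin

definition sim_map :: "(nat \<Rightarrow> real) \<Rightarrow> (nat \<Rightarrow> real) \<Rightarrow> nat \<Rightarrow> real \<Rightarrow> real" where
  "sim_map r t i = (\<lambda>x. r i * x + t i)"

text \<open>The IFS \<open>f\<^sub>1, \<dots>, f\<^sub>n\<close>; the interval is common to all the maps.\<close>

definition self_similar_ifs :: "nat \<Rightarrow> (nat \<Rightarrow> real) \<Rightarrow> (nat \<Rightarrow> real) \<Rightarrow> bool" where
  "self_similar_ifs n r t \<longleftrightarrow>
     (\<forall>i\<in>{1..n}. r i \<in> {-1<..<1} - {0}) \<and>
     (\<exists>a b. a \<le> b \<and> (\<forall>i\<in>{1..n}. sim_map r t i ` {a..b} \<subseteq> {a..b}))"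

text \<open>Each map of a self-similar IFS has exactly one fixed point.\<close>

definition distinct_fixed_points :: "nat \<Rightarrow> (nat \<Rightarrow> real) \<Rightarrow> (nat \<Rightarrow> real) \<Rightarrow> bool" where
  "distinct_fixed_points n r t \<longleftrightarrow>
     (\<exists>i\<in>{1..n}. \<exists>j\<in>{1..n}. i \<noteq> j \<and>
        (\<exists>x y. sim_map r t i x = x \<and> sim_map r t j y = y \<and> x \<noteq> y))"

definition positive_prob_vector :: "nat \<Rightarrow> (nat \<Rightarrow> real) \<Rightarrow> bool" where
  "positive_prob_vector n p \<longleftrightarrow> (\<forall>i\<in>{1..n}. 0 < p i) \<and> (\<Sum>i=1..n. p i) = 1"

definition self_similar_measure ::
    "nat \<Rightarrow> (nat \<Rightarrow> real) \<Rightarrow> (nat \<Rightarrow> real) \<Rightarrow> (nat \<Rightarrow> real) \<Rightarrow> real measure \<Rightarrow> bool" where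
  "self_similar_measure n r t p \<mu> \<longleftrightarrow>
     prob_space \<mu> \<and> sets \<mu> = sets borel \<and>
     (\<forall>A\<in>sets borel.
        emeasure \<mu> A = (\<Sum>i=1..n. ennreal (p i) * emeasure (distr \<mu> borel (sim_map r t i)) A))"

definition non_atomic :: "real measure \<Rightarrow> bool" where
  "non_atomic \<mu> \<longleftrightarrow> (\<forall>x. emeasure \<mu> {x} = 0)"

definition measure_support :: "real measure \<Rightarrow> real set" where
  "measure_support \<mu> = {x. \<forall>U. open U \<longrightarrow> x \<in> U \<longrightarrow> emeasure \<mu> U > 0}"

text \<open>At an endpoint belonging to \<open>J\<close> the power series is only compared with \<open>g\<close> on the side
  inside \<open>J\<close>; it converges on both sides, so on an interval this means that \<open>g\<close> extends
  analytically to an open neighbourhood of \<open>J\<close>. Values of \<open>g\<close> outside \<open>J\<close> are irrelevant.\<close>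

definition real_analytic_on :: "(real \<Rightarrow> real) \<Rightarrow> real set \<Rightarrow> bool" where
  "real_analytic_on g J \<longleftrightarrow>
     (\<forall>x\<in>J. \<exists>a :: nat \<Rightarrow> real. \<exists>\<epsilon>>0. \<forall>y\<in>J. \<bar>y - x\<bar> < \<epsilon> \<longrightarrow>
        (\<lambda>k. a k * (y - x) ^ k) sums g y)"

definition affine_on :: "(real \<Rightarrow> real) \<Rightarrow> real set \<Rightarrow> bool" where
  "affine_on g J \<longleftrightarrow> (\<exists>a b. \<forall>x\<in>J. g x = a * x + b)"

end

theory Submission
  imports Defs
begin

text \<open>
  Stop a random composition of maps of the IFS as soon as its ratio \<open>c\<close> drops below \<open>|l| powr (-2/3)\<close>. On the
  image of such a composition \<open>l g\<close> is affine up to \<open>O(|l| powr (-1/3))\<close>, so the integral is bounded by the mean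
  of \<open>|char \<mu>|\<close> at the random frequencies \<open>l c g'(y)\<close>, where \<open>y\<close> lies in that image. Two facts
  control this mean. Firstly, a high power of \<open>|char \<mu>|\<close>, maximised over unit intervals, has a sum over
  \<open>[-T, T]\<close> of size \<open>O(T powr \<epsilon>)\<close> only. Secondly, no unit interval is hit with probability exceeding a fixed
  negative power of \<open>|l|\<close>: only polylogarithmically many ratios \<open>c\<close> occur, and for each of them \<open>y\<close> is
  confined to a set on which \<open>g'\<close> is almost constant, which has small measure since \<open>g''\<close> has only
  finitely many zeros, all of finite order, and \<open>\<mu>\<close> satisfies a Frostman condition.
\<close>

section \<open>Functions on the line dominated by averages of rescalings\<close>

text \<open>The obstacle is that \<open>char \<mu>\<close> need not tend to 0 at infinity; for the
  middle-third Cantor measure it does not. Decay can come only from averaging over frequencies,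
  which the curvature of \<open>g\<close> has to spread out. The exponent 2/3 balances two demands:
  with X = |l|^(1/3) and ratios of order X^-2, the linearization error has order |l| X^-4 = 1/X,
  while the frequencies have order |l| X^-2 = X, so that a unit interval of frequencies fixes
  \<open>g'\<close> up to O(1/X). Any exponent strictly between 1/2 and 1 would give some power.
  Jensen's inequality joins the two facts: the \<open>m\<close>-th power of the mean is at most the
  sum of the maxima times the largest probability of a unit interval. The order of choice matters:
  the exponent of that probability comes from \<mu> and \<open>g\<close>, then \<epsilon> is taken
  small against it, and only then is the power \<open>m\<close> fixed. Commutativity of the ratios
  serves twice: the two orders of composing two maps give terms at the same frequency, which can
  cancel, and few ratios occur among very many words.\<close>

lemma contracting_recursion_growth:
  fixes V :: "real \<Rightarrow> real"
  assumes \<rho>: "0 \<le> \<rho>" "\<rho> < 1" and "0 < \<epsilon>"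
    and mono: "mono V" and nonneg: "\<And>N. 0 \<le> V N"
    and rec: "\<And>N. 0 \<le> N \<Longrightarrow> V N \<le> ((1 + \<rho>) / 2) powr (- \<epsilon>) * V (\<rho> * N + 1)"
  shows "\<exists>C>0. \<forall>N\<ge>1. V N \<le> C * N powr \<epsilon>"
proof -
  \<comment> \<open>Beyond \<open>N0\<close> the summand 1 is absorbed by passing from
    \<open>\<rho>\<close> to the midpoint \<open>\<rho>'\<close> of \<open>\<rho>\<close> and 1; the
    factor \<open>\<rho>' powr (- \<epsilon>)\<close> of the recursion is cancelled exactly by the
    decrease of \<open>N powr \<epsilon>\<close> when \<open>N\<close> becomes
    \<open>\<rho>' * N\<close>.\<close>
  define \<rho>' where "\<rho>' = (1 + \<rho>) / 2"
  define N0 where "N0 = 2 / (1 - \<rho>)"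
  have \<rho>': "1/2 \<le> \<rho>'" "\<rho>' < 1" "0 < \<rho>'" using \<rho> by (auto simp: \<rho>'_def)
  have N0: "2 \<le> N0" using \<rho> by (simp add: N0_def field_simps)
  define C where "C = V N0 + 1"
  have C: "C > 0" using nonneg[of N0] by (simp add: C_def)
  have main: "V N \<le> C * N powr \<epsilon>" if "1 \<le> N" "N \<le> N0 * (1 / \<rho>') ^ m" for m N
    using that
  proof (induction m arbitrary: N)
    case 0
    then have "V N \<le> V N0" using mono by (simp add: mono_def)
    also have "\<dots> \<le> C * 1" by (simp add: C_def)
    also have "\<dots> \<le> C * N powr \<epsilon>"
      using C 0 \<open>0 < \<epsilon>\<close> by (intro mult_left_mono ge_one_powr_ge_zero) auto
    finally show ?case .
  next
    case (Suc m)
    show ?case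
    proof (cases "N \<le> N0")
      case True
      then have "V N \<le> V N0" using mono by (simp add: mono_def)
      also have "\<dots> \<le> C * 1" by (simp add: C_def)
      also have "\<dots> \<le> C * N powr \<epsilon>"
        using C Suc.prems \<open>0 < \<epsilon>\<close> by (intro mult_left_mono ge_one_powr_ge_zero) auto
      finally show ?thesis .
    next
      case False
      have "\<rho> * N + 1 \<le> \<rho>' * N"
        using False \<rho> by (simp add: \<rho>'_def N0_def field_simps)
      then have "V (\<rho> * N + 1) \<le> V (\<rho>' * N)" using mono by (simp add: mono_def)
      also have "\<dots> \<le> C * (\<rho>' * N) powr \<epsilon>"
      proof (rule Suc.IH)
        have "1 / 2 * 2 \<le> \<rho>' * N" using \<rho>' False N0 by (intro mult_mono) auto
        then show "1 \<le> \<rho>' * N" by simp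
        show "\<rho>' * N \<le> N0 * (1 / \<rho>') ^ m"
          using Suc.prems \<rho>' by (simp add: field_simps)
      qed
      also have "\<dots> = C * \<rho>' powr \<epsilon> * N powr \<epsilon>"
        using \<rho>' Suc.prems by (simp add: powr_mult)
      finally have 1: "V (\<rho> * N + 1) \<le> C * \<rho>' powr \<epsilon> * N powr \<epsilon>" .
      have "V N \<le> \<rho>' powr (- \<epsilon>) * V (\<rho> * N + 1)"
        using rec[of N] Suc.prems by (simp add: \<rho>'_def)
      also have "\<dots> \<le> \<rho>' powr (- \<epsilon>) * (C * \<rho>' powr \<epsilon> * N powr \<epsilon>)"
        by (intro mult_left_mono 1) auto
      also have "\<dots> = (\<rho>' powr (- \<epsilon>) * \<rho>' powr \<epsilon>) * (C * N powr \<epsilon>)" by (simp add: mult_ac)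
      also have "\<rho>' powr (- \<epsilon>) * \<rho>' powr \<epsilon> = 1"
        using \<rho>' by (simp flip: powr_add)
      finally show ?thesis by simp
    qed
  qed
  have "V N \<le> C * N powr \<epsilon>" if "1 \<le> N" for N
  proof -
    obtain m where "N / N0 < (1 / \<rho>') ^ m"
      using \<rho>' real_arch_pow[of "1 / \<rho>'" "N / N0"] by auto
    then show ?thesis using main[OF that, of m] N0 by (simp add: field_simps)
  qed
  then show ?thesis using C by blast
qed

lemma finite_int_dist_le: "finite {j::int. \<bar>c * j - (y::real)\<bar> \<le> d}" if "c \<noteq> 0"
proof (rule finite_subset)
  show "{j::int. \<bar>c * j - y\<bar> \<le> d} \<subseteq> {\<lfloor>(y / c) - d / \<bar>c\<bar>\<rfloor>..\<lceil>(y / c) + d / \<bar>c\<bar>\<rceil>}"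
  proof safe
    fix j :: int assume "\<bar>c * j - y\<bar> \<le> d"
    then have "\<bar>c * j - y\<bar> / \<bar>c\<bar> \<le> d / \<bar>c\<bar>" by (simp add: divide_right_mono)
    also have "\<bar>c * j - y\<bar> / \<bar>c\<bar> = \<bar>j - y / c\<bar>" using that by (simp flip: abs_divide add: diff_divide_distrib)
    finally have "j - y / c \<le> d / \<bar>c\<bar>" "- (j - y / c) \<le> d / \<bar>c\<bar>" by linarith+
    then show "j \<in> {\<lfloor>(y / c) - d / \<bar>c\<bar>\<rfloor>..\<lceil>(y / c) + d / \<bar>c\<bar>\<rceil>}"
      by (simp; linarith)
  qed
qed simp

lemma card_int_dist_le:
  fixes c y d :: real
  assumes "c \<noteq> 0" "0 \<le> d"
  shows "card {j::int. \<bar>c * j - y\<bar> \<le> d} \<le> 2 * d / \<bar>c\<bar> + 1"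
proof -
  let ?S = "{j::int. \<bar>c * j - y\<bar> \<le> d}"
  define e where "e = d / \<bar>c\<bar>"
  have e: "0 \<le> e" using assms by (simp add: e_def)
  have "?S \<subseteq> {\<lceil>(y / c) - e\<rceil>..\<lfloor>(y / c) + e\<rfloor>}"
  proof safe
    fix j :: int assume "\<bar>c * j - y\<bar> \<le> d"
    then have "\<bar>c * j - y\<bar> / \<bar>c\<bar> \<le> e" by (simp add: divide_right_mono e_def)
    also have "\<bar>c * j - y\<bar> / \<bar>c\<bar> = \<bar>j - y / c\<bar>" using assms by (simp flip: abs_divide add: diff_divide_distrib)
    finally have "j - y / c \<le> e" "- (j - y / c) \<le> e" by linarith+
    then show "j \<in> {\<lceil>(y / c) - e\<rceil>..\<lfloor>(y / c) + e\<rfloor>}"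
      by (simp add: ceiling_le_iff le_floor_iff; linarith)
  qed
  then have "card ?S \<le> card {\<lceil>(y / c) - e\<rceil>..\<lfloor>(y / c) + e\<rfloor>}" by (intro card_mono) auto
  also have "real \<dots> \<le> 2 * e + 1"
    using e by (simp; linarith)
  finally show ?thesis by (simp add: e_def)
qed

text \<open>Double counting: after exchanging the sums, each \<open>i\<close> is counted once for
  every \<open>j\<close> with \<open>c * j\<close> within \<open>d\<close> of it, hence at most
  \<open>L\<close> times, and \<open>\<bar>c\<bar> \<le> \<rho>\<close> confines it to the rescaled
  range. A bound at \<open>j\<close> by values near \<open>c * j\<close> thus becomes a recursion
  for partial sums.\<close>

lemma sum_near_multiples_le:
  fixes h :: "int \<Rightarrow> real" and c N \<rho> d L :: real
  assumes c: "c \<noteq> 0" "\<bar>c\<bar> \<le> \<rho>" and N: "0 \<le> N" and d: "0 \<le> d" "d \<le> 1" and h: "\<And>i. 0 \<le> h i"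
    and L: "\<And>i. card {j::int. \<bar>c * j - real_of_int i\<bar> \<le> d} \<le> L"
  shows "(\<Sum>j | \<bar>real_of_int j\<bar> \<le> N. \<Sum>i | \<bar>real_of_int i - c * j\<bar> \<le> d. h i)
    \<le> L * (\<Sum>i | \<bar>real_of_int i\<bar> \<le> \<rho> * N + 1. h i)"
proof -
  have fin: "finite {j::int. \<bar>real_of_int j - y\<bar> \<le> e}" for y e
    using finite_int_dist_le[of 1 y e] by simp
  have fin': "finite {j::int. \<bar>real_of_int j\<bar> \<le> e}" for e using fin[of 0 e] by simp
  let ?I = "{i::int. \<bar>real_of_int i\<bar> \<le> \<rho> * N + 1}"
  have eq: "{i::int. \<bar>real_of_int i - c * j\<bar> \<le> d} = {i\<in>?I. \<bar>real_of_int i - c * j\<bar> \<le> d}"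
    if "\<bar>real_of_int j\<bar> \<le> N" for j
  proof safe
    fix i :: int assume i: "\<bar>real_of_int i - c * j\<bar> \<le> d"
    have "\<bar>c * j\<bar> \<le> \<rho> * N" unfolding abs_mult using that c by (intro mult_mono) auto
    then show "\<bar>real_of_int i\<bar> \<le> \<rho> * N + 1" using i d by linarith
  qed
  have "(\<Sum>j | \<bar>real_of_int j\<bar> \<le> N. \<Sum>i | \<bar>real_of_int i - c * j\<bar> \<le> d. h i)
      = (\<Sum>j | \<bar>real_of_int j\<bar> \<le> N. \<Sum>i | i \<in> ?I \<and> \<bar>real_of_int i - c * j\<bar> \<le> d. h i)"
    by (intro sum.cong) (auto simp: eq)
  also have "\<dots> = (\<Sum>i\<in>?I. \<Sum>j | j \<in> {j. \<bar>real_of_int j\<bar> \<le> N} \<and> \<bar>real_of_int i - c * j\<bar> \<le> d. h i)"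
    by (rule sum.swap_restrict) (auto intro: fin')
  also have "\<dots> \<le> (\<Sum>i\<in>?I. L * h i)"
  proof (rule sum_mono)
    fix i assume "i \<in> ?I"
    have "card {j. j \<in> {j. \<bar>real_of_int j\<bar> \<le> N} \<and> \<bar>real_of_int i - c * j\<bar> \<le> d}
        \<le> card {j::int. \<bar>c * j - real_of_int i\<bar> \<le> d}"
      using c by (intro card_mono finite_int_dist_le) (auto simp: abs_minus_commute)
    also have "real \<dots> \<le> L" by (rule L)
    finally have "card {j. j \<in> {j. \<bar>real_of_int j\<bar> \<le> N} \<and> \<bar>real_of_int i - c * j\<bar> \<le> d} \<le> L" by simp
    then show "(\<Sum>j | j \<in> {j. \<bar>real_of_int j\<bar> \<le> N} \<and> \<bar>real_of_int i - c * j\<bar> \<le> d. h i) \<le> L * h i"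
      using h by (simp add: mult_right_mono)
  qed
  finally show ?thesis by (simp add: sum_distrib_left)
qed

lemma convex_on_power: "convex_on {0..} (\<lambda>x::real. x ^ m)"
  by (cases "even m") (auto intro: convex_power_odd convex_on_subset[OF convex_power_even])

text \<open>Split the unit interval around each integer \<open>j\<close> into points within and beyond distance \<open>\<theta>\<close> of
  \<open>j\<close>. As \<open>\<theta>\<close> is small compared to the ratios, multiplication by \<open>s k\<close> brings at most one integer
  within \<open>2 \<theta>\<close> of a given one, so the near points do not multiply under the recursion; the others do,
  but they gain a factor \<open>\<beta> ^ m\<close>, which outweighs this once \<open>m\<close> is large.\<close>

lemma multiplicative_recursion_power_sum:
  fixes F :: "real \<Rightarrow> real" and q s :: "'k \<Rightarrow> real"
  assumes K: "finite K" and q: "\<And>k. k \<in> K \<Longrightarrow> 0 \<le> q k" "(\<Sum>k\<in>K. q k) = 1"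
    and s: "\<And>k. k \<in> K \<Longrightarrow> s k \<noteq> 0" "\<And>k. k \<in> K \<Longrightarrow> \<bar>s k\<bar> < 1"
    and F: "\<And>x. 0 \<le> F x" "\<And>x. F x \<le> 1"
    and rec: "\<And>x. F x \<le> (\<Sum>k\<in>K. q k * F (s k * x))"
    and gain: "\<And>\<theta>. 0 < \<theta> \<Longrightarrow>
      \<exists>\<beta>\<ge>0. \<beta> < 1 \<and> (\<forall>x. (\<forall>j::int. \<theta> \<le> \<bar>x - real_of_int j\<bar>) \<longrightarrow> (\<exists>k\<in>K. F x \<le> \<beta> * F (s k * x)))"
    and "0 < \<epsilon>"
  shows "\<exists>(m::nat)>0. \<exists>C>0. \<exists>V::int \<Rightarrow> real. (\<forall>j. 0 \<le> V j) \<and> (\<forall>x. F x ^ m \<le> V (round x)) \<and>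
    (\<forall>T\<ge>1. (\<Sum>j | \<bar>real_of_int j\<bar> \<le> T. V j) \<le> C * T powr \<epsilon>)"
proof -
  have "K \<noteq> {}" using q(2) by auto
  define \<rho> where "\<rho> = Max ((\<lambda>k. \<bar>s k\<bar>) ` K)"
  define \<sigma> where "\<sigma> = Min ((\<lambda>k. \<bar>s k\<bar>) ` K)"
  have \<rho>: "\<bar>s k\<bar> \<le> \<rho>" and \<sigma>: "\<sigma> \<le> \<bar>s k\<bar>" if "k \<in> K" for k
    using that K by (auto simp: \<rho>_def \<sigma>_def)
  have "\<rho> \<in> (\<lambda>k. \<bar>s k\<bar>) ` K" unfolding \<rho>_def using K \<open>K \<noteq> {}\<close> by (intro Max_in) auto
  then have \<rho>1: "0 \<le> \<rho>" "\<rho> < 1" using s by auto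
  have "\<sigma> \<in> (\<lambda>k. \<bar>s k\<bar>) ` K" unfolding \<sigma>_def using K \<open>K \<noteq> {}\<close> by (intro Min_in) auto
  then have \<sigma>1: "0 < \<sigma>" "\<sigma> < 1" using s by auto
  \<comment> \<open>Since \<open>4 * \<theta> < \<sigma>\<close>, the count
    \<open>2 * (2 * \<theta>) / \<bar>s k\<bar> + 1\<close> in \<open>card2\<close> is below 2, so
    it allows a single integer.\<close>
  define \<theta> where "\<theta> = \<sigma> / 5"
  have \<theta>: "0 < \<theta>" "\<theta> < 1/4" "4 * \<theta> < \<sigma>" using \<sigma>1 by (auto simp: \<theta>_def)
  obtain \<beta> where \<beta>: "0 \<le> \<beta>" "\<beta> < 1"
    "\<And>x. (\<forall>j::int. \<theta> \<le> \<bar>x - real_of_int j\<bar>) \<Longrightarrow> \<exists>k\<in>K. F x \<le> \<beta> * F (s k * x)"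
    using gain[OF \<theta>(1)] by blast
  define L where "L = 2 / \<sigma> + 1"
  have L: "1 \<le> L" using \<sigma>1 by (simp add: L_def)
  \<comment> \<open>\<open>1 + \<epsilon>'\<close> is a growth per step that
    \<open>contracting_recursion_growth\<close> tolerates; the cap at 1 ensures
    \<open>L + \<epsilon>' \<le> 2 * L = A\<close>.\<close>
  define \<epsilon>' where "\<epsilon>' = min 1 (((1 + \<rho>) / 2) powr (- \<epsilon>) - 1)"
  have "((1 + \<rho>) / 2) powr \<epsilon> < 1"
    using \<rho>1 \<open>0 < \<epsilon>\<close> powr_less_mono2[of \<epsilon> "(1 + \<rho>) / 2" 1] by simp
  moreover have "((1 + \<rho>) / 2) powr \<epsilon> > 0" using \<rho>1 by simp
  ultimately have "1 < ((1 + \<rho>) / 2) powr (- \<epsilon>)"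
    by (simp add: powr_minus one_less_inverse)
  then have \<epsilon>': "0 < \<epsilon>'" "\<epsilon>' \<le> 1" by (auto simp: \<epsilon>'_def)
  define A where "A = 2 * L"
  define B0 where "B0 = A * card K * L"
  have "card K > 0" using K \<open>K \<noteq> {}\<close> by (simp add: card_gt_0_iff)
  then have B0: "0 < B0" using L by (simp add: B0_def A_def)
  \<comment> \<open>The gain has to beat every factor that multiplies the far terms, collected in
    \<open>B0\<close>: the weight \<open>A\<close>, the number of maps and the multiplicity
    \<open>L\<close>.\<close>
  obtain m0 where m0: "\<beta> ^ m0 < \<epsilon>' / B0"
    using real_arch_pow_inv[of "\<epsilon>' / B0" \<beta>] \<epsilon>' B0 \<beta> by auto
  define m where "m = Suc m0"
  have "\<beta> ^ m \<le> \<beta> ^ m0" using \<beta> by (simp add: m_def mult_left_le_one_le)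
  then have "\<beta> ^ m * B0 \<le> \<beta> ^ m0 * B0" using B0 by (intro mult_right_mono) auto
  also have "\<dots> \<le> \<epsilon>'" using m0 B0 by (simp add: field_simps)
  finally have m: "m > 0" "\<beta> ^ m * B0 \<le> \<epsilon>'" by (auto simp: m_def)
  define \<gamma> where "\<gamma> = \<beta> ^ m"
  have \<gamma>: "0 \<le> \<gamma>" using \<beta> by (simp add: \<gamma>_def)
  define near where "near j = {x. \<bar>x - real_of_int j\<bar> \<le> \<theta>}" for j
  define far where "far j = {x. \<bar>x - real_of_int j\<bar> \<le> 1/2 \<and> \<theta> \<le> \<bar>x - real_of_int j\<bar>}" for j
  define b where "b j = (SUP x\<in>near j. F x ^ m)" for j
  define g where "g j = (SUP x\<in>far j. F x ^ m)" for j
  have F01: "0 \<le> F x ^ m" "F x ^ m \<le> 1" for x using F by (auto simp: power_le_one)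
  have bdd: "bdd_above ((\<lambda>x. F x ^ m) ` X)" for X
    using F01 by (intro bdd_aboveI2[of _ _ 1]) auto
  have b_ge: "F x ^ m \<le> b j" if "x \<in> near j" for x j
    unfolding b_def using that bdd by (rule cSUP_upper)
  have g_ge: "F x ^ m \<le> g j" if "x \<in> far j" for x j
    unfolding g_def using that bdd by (rule cSUP_upper)
  have near_ne: "real_of_int j \<in> near j" for j using \<theta> by (simp add: near_def)
  have far_ne: "real_of_int j + 1/2 \<in> far j" for j using \<theta> by (simp add: far_def)
  have b0: "0 \<le> b j" for j using b_ge[OF near_ne] F01 order_trans by blast
  have g0: "0 \<le> g j" for j using g_ge[OF far_ne] F01 order_trans by blast
  have fin: "finite {j::int. \<bar>real_of_int j - y\<bar> \<le> e}" for y e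
    using finite_int_dist_le[of 1 y e] by simp
  have fin': "finite {j::int. \<bar>real_of_int j\<bar> \<le> e}" for e using fin[of 0 e] by simp
  define bs where "bs c j = (\<Sum>i | \<bar>real_of_int i - c * j\<bar> \<le> 2 * \<theta>. b i)" for c :: real and j :: int
  define b1 where "b1 c j = (\<Sum>i | \<bar>real_of_int i - c * j\<bar> \<le> 1. b i)" for c :: real and j :: int
  define g1 where "g1 c j = (\<Sum>i | \<bar>real_of_int i - c * j\<bar> \<le> 1. g i)" for c :: real and j :: int
  have bs0: "0 \<le> bs c j" and b10: "0 \<le> b1 c j" and g10: "0 \<le> g1 c j" for c j
    unfolding bs_def b1_def g1_def by (auto intro!: sum_nonneg b0 g0)
  have rnd: "\<bar>x - real_of_int (round x)\<bar> \<le> 1/2" for x :: real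
    using of_int_round_abs_le[of x] by (simp add: abs_minus_commute)
  have scaled: "\<bar>real_of_int i - c * j\<bar> \<le> \<bar>c * x - i\<bar> + \<bar>x - j\<bar>" if "\<bar>c\<bar> < 1" for i j c x
  proof -
    have "\<bar>real_of_int i - c * j\<bar> \<le> \<bar>c * x - i\<bar> + \<bar>c * x - c * j\<bar>" by linarith
    also have "\<bar>c * x - c * j\<bar> = \<bar>c\<bar> * \<bar>x - j\<bar>" by (simp add: abs_mult flip: right_diff_distrib)
    also have "\<dots> \<le> 1 * \<bar>x - j\<bar>" using that by (intro mult_right_mono) auto
    finally show ?thesis by simp
  qed
  \<comment> \<open>The integer nearest to \<open>c * x\<close> is always within 1 of
    \<open>c * j\<close>; if \<open>x\<close> is near \<open>j\<close> and \<open>c * x\<close> near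
    that integer, it is even within \<open>2 * \<theta>\<close>, which is the case that must not
    lose a factor.\<close>
  have point: "F (c * x) ^ m \<le> (if \<bar>x - j\<bar> \<le> \<theta> then bs c j else b1 c j) + g1 c j"
    if c: "\<bar>c\<bar> < 1" and x: "\<bar>x - real_of_int j\<bar> \<le> 1/2" for c x j
  proof -
    define i where "i = round (c * x)"
    have i1: "\<bar>real_of_int i - c * j\<bar> \<le> 1"
      using scaled[OF c, of i j x] rnd[of "c * x"] x by (simp add: i_def)
    show ?thesis
    proof (cases "c * x \<in> near i")
      case True
      then have "F (c * x) ^ m \<le> b i" by (rule b_ge)
      also have "b i \<le> (if \<bar>x - j\<bar> \<le> \<theta> then bs c j else b1 c j)"
      proof (cases "\<bar>x - j\<bar> \<le> \<theta>")
        case t: True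
        have "\<bar>real_of_int i - c * j\<bar> \<le> 2 * \<theta>"
          using scaled[OF c, of i j x] t True by (simp add: near_def)
        then have "b i \<le> bs c j" unfolding bs_def
          by (intro member_le_sum b0 fin) auto
        then show ?thesis using t by simp
      next
        case False
        have "b i \<le> b1 c j" unfolding b1_def using i1 by (intro member_le_sum b0 fin) auto
        then show ?thesis using False by simp
      qed
      finally show ?thesis using g10[of c j] by linarith
    next
      case False
      then have "c * x \<in> far i" using rnd[of "c * x"] by (auto simp: near_def far_def i_def)
      then have "F (c * x) ^ m \<le> g i" by (rule g_ge)
      also have "g i \<le> g1 c j" unfolding g1_def using i1 by (intro member_le_sum g0 fin) auto
      finally show ?thesis using bs0[of c j] b10[of c j] by auto
    qed
  qed
  \<comment> \<open>Convexity of the \<open>m\<close>-th power keeps the weights \<open>q\<close>,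
    of total mass 1. A cruder bound would multiply the near terms at every step and spoil the
    exponent \<epsilon>.\<close>
  have b_rec: "b j \<le> (\<Sum>k\<in>K. q k * (bs (s k) j + g1 (s k) j))" for j
    unfolding b_def
  proof (rule cSUP_least)
    fix x assume x: "x \<in> near j"
    have "F x ^ m \<le> (\<Sum>k\<in>K. q k *\<^sub>R F (s k * x)) ^ m"
      using F rec[of x] by (intro power_mono) auto
    also have "\<dots> \<le> (\<Sum>k\<in>K. q k * F (s k * x) ^ m)"
    proof (rule convex_on_sum[OF K \<open>K \<noteq> {}\<close>, where C = "{0..}"])
      show "convex_on {0..} (\<lambda>x::real. x ^ m)" by (rule convex_on_power)
    qed (use q F in auto)
    also have "\<dots> \<le> (\<Sum>k\<in>K. q k * (bs (s k) j + g1 (s k) j))"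
      using x point[of _ x j] s q \<theta> by (intro sum_mono mult_left_mono) (auto simp: near_def)
    finally show "F x ^ m \<le> (\<Sum>k\<in>K. q k * (bs (s k) j + g1 (s k) j))" .
  qed (use near_ne in auto)
  \<comment> \<open>The index supplied by \<open>gain\<close> varies with the point; summing over
    all of \<open>K\<close> removes this dependence, and the loss of \<open>card K\<close> is paid
    for by \<gamma>.\<close>
  have g_rec: "g j \<le> \<gamma> * (\<Sum>k\<in>K. b1 (s k) j + g1 (s k) j)" for j
    unfolding g_def
  proof (rule cSUP_least)
    fix x assume x: "x \<in> far j"
    have "\<theta> \<le> \<bar>x - real_of_int i\<bar>" for i :: int
    proof (cases "i = j")
      case False
      then have "1 \<le> \<bar>real_of_int i - real_of_int j\<bar>" by linarith
      moreover have "\<bar>x - real_of_int j\<bar> \<le> 1/2" using x by (simp add: far_def)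
      ultimately show ?thesis using \<theta> by linarith
    qed (use x in \<open>auto simp: far_def\<close>)
    then obtain k where k: "k \<in> K" "F x \<le> \<beta> * F (s k * x)" using \<beta>(3) by blast
    have "F x ^ m \<le> (\<beta> * F (s k * x)) ^ m" using F k by (intro power_mono) auto
    also have "\<dots> = \<gamma> * F (s k * x) ^ m" by (simp add: \<gamma>_def power_mult_distrib)
    also have "\<dots> \<le> \<gamma> * (b1 (s k) j + g1 (s k) j)"
    proof (rule mult_left_mono[OF _ \<gamma>])
      have "bs (s k) j \<le> b1 (s k) j"
        unfolding bs_def b1_def using \<theta> by (intro sum_mono2 fin b0) auto
      then show "F (s k * x) ^ m \<le> b1 (s k) j + g1 (s k) j"
        using point[of "s k" x j] x s k by (auto simp: far_def split: if_splits)
    qed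
    also have "\<dots> \<le> \<gamma> * (\<Sum>k\<in>K. b1 (s k) j + g1 (s k) j)"
      using k K b10 g10 by (intro mult_left_mono[OF _ \<gamma>] member_le_sum) auto
    finally show "F x ^ m \<le> \<gamma> * (\<Sum>k\<in>K. b1 (s k) j + g1 (s k) j)" .
  qed (use far_ne in auto)
  define B where "B N = (\<Sum>j | \<bar>real_of_int j\<bar> \<le> N. b j)" for N
  define G where "G N = (\<Sum>j | \<bar>real_of_int j\<bar> \<le> N. g j)" for N
  have B0': "0 \<le> B N" and G0': "0 \<le> G N" for N
    unfolding B_def G_def by (auto intro!: sum_nonneg b0 g0)
  have card1: "card {j::int. \<bar>s k * j - real_of_int i\<bar> \<le> 1} \<le> L" if "k \<in> K" for i k
  proof -
    have "card {j::int. \<bar>s k * j - real_of_int i\<bar> \<le> 1} \<le> 2 * 1 / \<bar>s k\<bar> + 1"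
      using that s by (intro card_int_dist_le) auto
    also have "\<dots> \<le> L" unfolding L_def using \<sigma>[OF that] \<sigma>1 by (auto intro!: divide_left_mono)
    finally show ?thesis .
  qed
  have card2: "card {j::int. \<bar>s k * j - real_of_int i\<bar> \<le> 2 * \<theta>} \<le> (1::real)" if "k \<in> K" for i k
  proof -
    have "card {j::int. \<bar>s k * j - real_of_int i\<bar> \<le> 2 * \<theta>} \<le> 2 * (2 * \<theta>) / \<bar>s k\<bar> + 1"
      using that s \<theta> by (intro card_int_dist_le) auto
    also have "2 * (2 * \<theta>) / \<bar>s k\<bar> < 1" using \<sigma>[OF that] \<sigma>1 \<theta> by (simp add: field_simps)
    finally show ?thesis by simp
  qed
  have sbs: "(\<Sum>j | \<bar>real_of_int j\<bar> \<le> N. bs (s k) j) \<le> B (\<rho> * N + 1)" if "k \<in> K" "0 \<le> N" for k N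
    using sum_near_multiples_le[of "s k" \<rho> N "2 * \<theta>" b 1] that s \<rho> \<theta> b0 card2
    by (simp add: bs_def B_def)
  have sb1: "(\<Sum>j | \<bar>real_of_int j\<bar> \<le> N. b1 (s k) j) \<le> L * B (\<rho> * N + 1)" if "k \<in> K" "0 \<le> N" for k N
    using sum_near_multiples_le[of "s k" \<rho> N 1 b L] that s \<rho> b0 card1
    by (simp add: b1_def B_def)
  have sg1: "(\<Sum>j | \<bar>real_of_int j\<bar> \<le> N. g1 (s k) j) \<le> L * G (\<rho> * N + 1)" if "k \<in> K" "0 \<le> N" for k N
    using sum_near_multiples_le[of "s k" \<rho> N 1 g L] that s \<rho> g0 card1
    by (simp add: g1_def G_def)
  have B_rec: "B N \<le> B (\<rho> * N + 1) + L * G (\<rho> * N + 1)" if "0 \<le> N" for N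
  proof -
    have "B N \<le> (\<Sum>j | \<bar>real_of_int j\<bar> \<le> N. \<Sum>k\<in>K. q k * (bs (s k) j + g1 (s k) j))"
      unfolding B_def by (intro sum_mono b_rec)
    also have "\<dots> = (\<Sum>k\<in>K. q k * (\<Sum>j | \<bar>real_of_int j\<bar> \<le> N. bs (s k) j + g1 (s k) j))"
      unfolding sum_distrib_left by (rule sum.swap)
    also have "\<dots> \<le> (\<Sum>k\<in>K. q k * (B (\<rho> * N + 1) + L * G (\<rho> * N + 1)))"
      using q sbs[OF _ that] sg1[OF _ that] unfolding sum.distrib
      by (intro sum_mono mult_left_mono add_mono) auto
    also have "\<dots> = B (\<rho> * N + 1) + L * G (\<rho> * N + 1)"
      using q by (simp flip: sum_distrib_right)
    finally show ?thesis .
  qed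
  have G_rec: "G N \<le> \<gamma> * (card K * L * (B (\<rho> * N + 1) + G (\<rho> * N + 1)))" if "0 \<le> N" for N
  proof -
    have "G N \<le> (\<Sum>j | \<bar>real_of_int j\<bar> \<le> N. \<gamma> * (\<Sum>k\<in>K. b1 (s k) j + g1 (s k) j))"
      unfolding G_def by (intro sum_mono g_rec)
    also have "\<dots> = \<gamma> * (\<Sum>k\<in>K. \<Sum>j | \<bar>real_of_int j\<bar> \<le> N. b1 (s k) j + g1 (s k) j)"
      unfolding sum_distrib_left[symmetric] by (subst sum.swap) simp
    also have "\<dots> \<le> \<gamma> * (\<Sum>k\<in>K. L * B (\<rho> * N + 1) + L * G (\<rho> * N + 1))"
      using sb1[OF _ that] sg1[OF _ that] unfolding sum.distrib
      by (intro sum_mono mult_left_mono[OF _ \<gamma>] add_mono) auto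
    also have "\<dots> = \<gamma> * (card K * L * (B (\<rho> * N + 1) + G (\<rho> * N + 1)))"
      by (simp add: algebra_simps)
    finally show ?thesis .
  qed
  \<comment> \<open>The weight \<open>A\<close> dominates the passage \<open>L * G\<close> from far
    to near, while the passage from near to far costs at most \<open>\<epsilon>'\<close> even after
    multiplication by \<open>A\<close>.\<close>
  define W where "W N = B N + A * G N" for N
  have A0: "0 \<le> A" using L by (simp add: A_def)
  have "\<exists>C>0. \<forall>N\<ge>1. W N \<le> C * N powr \<epsilon>"
  proof (rule contracting_recursion_growth[OF \<rho>1 \<open>0 < \<epsilon>\<close>])
    have "mono B" "mono G" unfolding mono_def B_def G_def
      by (auto intro!: sum_mono2 fin' b0 g0)
    then show "mono W" unfolding W_def mono_def
      using A0 by (auto intro!: add_mono mult_left_mono)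
    show "0 \<le> W N" for N using A0 B0' G0' by (simp add: W_def)
    show "W N \<le> ((1 + \<rho>) / 2) powr (- \<epsilon>) * W (\<rho> * N + 1)" if "0 \<le> N" for N
    proof -
      let ?B = "B (\<rho> * N + 1)" and ?G = "G (\<rho> * N + 1)"
      have "A * G N \<le> A * (\<gamma> * (card K * L * (?B + ?G)))"
        using A0 G_rec[OF that] by (intro mult_left_mono)
      also have "\<dots> = (\<gamma> * B0) * (?B + ?G)" by (simp add: B0_def mult_ac)
      also have "\<dots> \<le> \<epsilon>' * (?B + ?G)"
        using m B0' G0' by (intro mult_right_mono) (auto simp: \<gamma>_def)
      finally have "W N \<le> (1 + \<epsilon>') * ?B + (L + \<epsilon>') * ?G"
        using B_rec[OF that] by (simp add: W_def algebra_simps)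
      also have "L + \<epsilon>' \<le> A" using \<epsilon>' L by (simp add: A_def)
      then have "(L + \<epsilon>') * ?G \<le> (1 + \<epsilon>') * (A * ?G)"
      proof -
        assume a: "L + \<epsilon>' \<le> A"
        have "(L + \<epsilon>') * ?G \<le> 1 * (A * ?G)" using a G0' by (simp add: mult_right_mono)
        also have "\<dots> \<le> (1 + \<epsilon>') * (A * ?G)" using A0 G0' \<epsilon>' by (intro mult_right_mono) auto
        finally show ?thesis .
      qed
      also have "(1 + \<epsilon>') * ?B + (1 + \<epsilon>') * (A * ?G) = (1 + \<epsilon>') * W (\<rho> * N + 1)"
        by (simp add: W_def algebra_simps)
      also have "\<dots> \<le> ((1 + \<rho>) / 2) powr (- \<epsilon>) * W (\<rho> * N + 1)"
        using A0 B0' G0' by (intro mult_right_mono) (auto simp: \<epsilon>'_def W_def)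
      finally show ?thesis by simp
    qed
  qed
  then obtain C where C: "C > 0" "\<And>N. 1 \<le> N \<Longrightarrow> W N \<le> C * N powr \<epsilon>" by blast
  show ?thesis
  proof (intro exI[of _ m] exI[of _ C] conjI exI[of _ "\<lambda>j. b j + g j"] allI impI)
    show "0 \<le> b j + g j" for j using b0 g0 by simp
    show "F x ^ m \<le> b (round x) + g (round x)" for x
    proof (cases "x \<in> near (round x)")
      case True then show ?thesis using b_ge g0[of "round x"] by fastforce
    next
      case False
      then have "x \<in> far (round x)" using rnd[of x] by (auto simp: near_def far_def)
      then show ?thesis using g_ge b0[of "round x"] by fastforce
    qed
    show "(\<Sum>j | \<bar>real_of_int j\<bar> \<le> T. b j + g j) \<le> C * T powr \<epsilon>" if "1 \<le> T" for T
    proof -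
      have "(\<Sum>j | \<bar>real_of_int j\<bar> \<le> T. b j + g j) = B T + 1 * G T"
        by (simp add: B_def G_def sum.distrib)
      also have "\<dots> \<le> W T" unfolding W_def using L G0' by (intro add_left_mono mult_right_mono) (auto simp: A_def)
      also have "\<dots> \<le> C * T powr \<epsilon>" by (rule C(2)[OF that])
      finally show ?thesis .
    qed
  qed (use m C in auto)
qed

section \<open>Real analytic functions\<close>

lemma real_analytic_on_subset: "real_analytic_on g J \<Longrightarrow> S \<subseteq> J \<Longrightarrow> real_analytic_on g S"
  unfolding real_analytic_on_def by (meson subsetD)

text \<open>The series also converges on the side of \<open>x\<close> where \<open>S\<close> may be missing.\<close>

lemma power_series_two_sided:
  fixes g :: "real \<Rightarrow> real"
  assumes S: "is_interval S" "x \<in> S" "x' \<in> S" "x \<noteq> x'"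
    and "0 < \<epsilon>" and sums: "\<And>y. y \<in> S \<Longrightarrow> \<bar>y - x\<bar> < \<epsilon> \<Longrightarrow> (\<lambda>k. c k * (y - x) ^ k) sums g y"
  shows "\<exists>\<delta>>0. \<delta> \<le> \<epsilon> \<and> (\<forall>z. \<bar>z\<bar> < \<delta> \<longrightarrow> summable (\<lambda>k. c k * z ^ k))"
proof -
  define \<delta> where "\<delta> = min (\<epsilon> / 2) \<bar>x' - x\<bar>"
  have \<delta>: "0 < \<delta>" "\<delta> < \<epsilon>" using assms by (auto simp: \<delta>_def)
  define y where "y = (if x < x' then x + \<delta> else x - \<delta>)"
  have yS: "y \<in> S"
  proof (cases "x < x'")
    case True
    then have "x \<le> y" "y \<le> x'" using \<delta> by (auto simp: y_def \<delta>_def)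
    then show ?thesis using S by (meson mem_is_interval_1_I)
  next
    case False
    then have "x' \<le> y" "y \<le> x" using \<delta> by (auto simp: y_def \<delta>_def)
    then show ?thesis using S by (meson mem_is_interval_1_I)
  qed
  have "\<bar>y - x\<bar> = \<delta>" using \<delta> by (auto simp: y_def)
  then have "summable (\<lambda>k. c k * (y - x) ^ k)"
    using sums[OF yS] \<delta> by (auto dest: sums_summable)
  then have "summable (\<lambda>k. c k * z ^ k)" if "\<bar>z\<bar> < \<delta>" for z
    using that \<open>\<bar>y - x\<bar> = \<delta>\<close> by (intro powser_inside[of c "y - x" z]) auto
  then show ?thesis using \<delta> by (intro exI[of _ \<delta>]) auto
qed

lemma real_analytic_on_power_series:
  assumes "real_analytic_on g S" "is_interval S" "x \<in> S" "x' \<in> S" "x \<noteq> x'"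
  shows "\<exists>c. \<exists>\<epsilon>>0. (\<forall>z. \<bar>z\<bar> < \<epsilon> \<longrightarrow> summable (\<lambda>k. c k * z ^ k)) \<and>
    (\<forall>y\<in>S. \<bar>y - x\<bar> < \<epsilon> \<longrightarrow> g y = (\<Sum>k. c k * (y - x) ^ k))"
proof -
  obtain c \<epsilon> where c: "\<epsilon> > 0" "\<And>y. y \<in> S \<Longrightarrow> \<bar>y - x\<bar> < \<epsilon> \<Longrightarrow> (\<lambda>k. c k * (y - x) ^ k) sums g y"
    using assms unfolding real_analytic_on_def by blast
  obtain \<delta> where "0 < \<delta>" "\<delta> \<le> \<epsilon>" "\<And>z. \<bar>z\<bar> < \<delta> \<Longrightarrow> summable (\<lambda>k. c k * z ^ k)"
    using power_series_two_sided[of S x x' \<epsilon> c g] assms c by blast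
  then show ?thesis using c
    by (intro exI[of _ c] exI[of _ \<delta>]) (auto simp: sums_iff)
qed

lemma at_within_interval_nontrivial:
  fixes x :: real
  assumes "a < b" "x \<in> {a..b}"
  shows "at x within {a..b} \<noteq> bot"
  using assms by (auto simp: trivial_limit_within intro!: islimpt_closure_open[where s="{a <..< b}"])

text \<open>Differentiating the series centred at \<open>x\<close> gives a derivative
  \<open>D x y\<close> at all nearby \<open>y\<close>. Derivatives within a nondegenerate interval
  are unique, also at its endpoints, so \<open>D x y\<close> does not depend on \<open>x\<close>,
  and the diagonal \<open>D y y\<close> has the series \<open>diffs (c x)\<close> around every
  \<open>x\<close>.\<close>

lemma real_analytic_on_derivative:
  fixes g :: "real \<Rightarrow> real"
  assumes g: "real_analytic_on g {a..b}" and "a < b"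
  shows "\<exists>g'. real_analytic_on g' {a..b} \<and>
    (\<forall>x\<in>{a..b}. (g has_real_derivative g' x) (at x within {a..b}))"
proof -
  define Q where "Q x c e \<longleftrightarrow> 0 < e \<and> (\<forall>z. \<bar>z\<bar> < e \<longrightarrow> summable (\<lambda>k. c k * z ^ k)) \<and>
    (\<forall>y\<in>{a..b}. \<bar>y - x\<bar> < e \<longrightarrow> g y = (\<Sum>k. c k * (y - x) ^ k))"
    for x and c :: "nat \<Rightarrow> real" and e :: real
  have "\<forall>x\<in>{a..b}. \<exists>c e. Q x c e"
  proof
    fix x assume x: "x \<in> {a..b}"
    obtain x' where "x' \<in> {a..b}" "x \<noteq> x'"
    proof (cases "x = a")
      case True then show ?thesis using that[of b] \<open>a < b\<close> by auto
    next
      case False then show ?thesis using that[of a] \<open>a < b\<close> by auto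
    qed
    from real_analytic_on_power_series[OF g is_interval_cc x this]
    show "\<exists>c e. Q x c e" unfolding Q_def by blast
  qed
  then obtain c e where Q: "\<And>x. x \<in> {a..b} \<Longrightarrow> Q x (c x) (e x)" by metis
  have e: "e x > 0" if "x \<in> {a..b}" for x using Q[OF that] by (simp add: Q_def)
  have sm: "summable (\<lambda>k. c x k * z ^ k)" if "x \<in> {a..b}" "\<bar>z\<bar> < e x" for x z
    using Q[OF that(1)] that(2) by (simp add: Q_def)
  have gy: "g y = (\<Sum>k. c x k * (y - x) ^ k)" if "x \<in> {a..b}" "y \<in> {a..b}" "\<bar>y - x\<bar> < e x" for x y
    using Q[OF that(1)] that(2,3) unfolding Q_def by blast
  define D where "D x y = (\<Sum>k. diffs (c x) k * (y - x) ^ k)" for x y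
  have der: "(g has_real_derivative D x y) (at y within {a..b})"
    if xy: "x \<in> {a..b}" "y \<in> {a..b}" "\<bar>y - x\<bar> < e x" for x y
  proof -
    have "((\<lambda>z. \<Sum>k. c x k * z ^ k) has_real_derivative D x y) (at (y - x))"
      unfolding D_def using sm[OF xy(1)] xy(3) by (intro termdiffs_strong'[of "e x"]) auto
    then have "((\<lambda>u. \<Sum>k. c x k * (u - x) ^ k) has_real_derivative D x y * 1) (at y)"
      by (intro DERIV_chain2[where f = "\<lambda>z. \<Sum>k. c x k * z ^ k" and g = "\<lambda>u. u - x"])
         (auto intro!: derivative_eq_intros)
    then have "((\<lambda>u. \<Sum>k. c x k * (u - x) ^ k) has_real_derivative D x y) (at y within {a..b})"
      by (simp add: has_field_derivative_at_within)
    then show ?thesis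
    proof (rule has_field_derivative_transform_within[where d = "e x - \<bar>y - x\<bar>"])
      fix u assume "u \<in> {a..b}" "dist u y < e x - \<bar>y - x\<bar>"
      then show "(\<Sum>k. c x k * (u - x) ^ k) = g u"
        using xy by (intro gy[symmetric]) (auto simp: dist_real_def)
    qed (use xy in auto)
  qed
  have "real_analytic_on (\<lambda>x. D x x) {a..b}"
    unfolding real_analytic_on_def
  proof
    fix x assume x: "x \<in> {a..b}"
    have "(\<lambda>k. diffs (c x) k * (y - x) ^ k) sums D y y" if y: "y \<in> {a..b}" "\<bar>y - x\<bar> < e x" for y
    proof -
      have "D y y = D x y"
        by (rule has_field_derivative_unique[OF der der at_within_interval_nontrivial])
           (use x y e \<open>a < b\<close> in auto)
      moreover have "summable (\<lambda>k. diffs (c x) k * (y - x) ^ k)"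
        using sm[OF x] y by (intro termdiff_converges[of "y - x" "e x"]) auto
      ultimately show ?thesis by (simp add: D_def summable_sums)
    qed
    then show "\<exists>c. \<exists>\<epsilon>>0. \<forall>y\<in>{a..b}. \<bar>y - x\<bar> < \<epsilon> \<longrightarrow> (\<lambda>k. c k * (y - x) ^ k) sums D y y"
      using e[OF x] by blast
  qed
  moreover have "\<forall>x\<in>{a..b}. (g has_real_derivative D x x) (at x within {a..b})"
    using der e by simp
  ultimately show ?thesis by blast
qed

text \<open>Splitting off the first nonzero power leaves a power series continuous at 0, hence close
  to its value \<open>u\<close> there. This yields the order of vanishing with explicit two-sided
  bounds, the form in which the level set estimates need it.\<close>

lemma power_series_leading_term:
  fixes c :: "nat \<Rightarrow> real"
  assumes "0 < \<epsilon>" and sm: "\<And>z. \<bar>z\<bar> < \<epsilon> \<Longrightarrow> summable (\<lambda>k. c k * z ^ k)" and ne: "c j \<noteq> 0"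
  shows "\<exists>k u \<eta>. u \<noteq> 0 \<and> 0 < \<eta> \<and> \<eta> \<le> \<epsilon> \<and>
    (\<forall>z. \<bar>z\<bar> < \<eta> \<longrightarrow> (\<exists>v. (\<Sum>k. c k * z ^ k) = z ^ k * v \<and> \<bar>v - u\<bar> \<le> \<bar>u\<bar> / 2))"
proof -
  define k where "k = (LEAST k. c k \<noteq> 0)"
  have k: "c k \<noteq> 0" unfolding k_def using ne by (rule LeastI)
  have k0: "c i = 0" if "i < k" for i using that not_less_Least unfolding k_def by blast
  define v where "v z = (\<Sum>i. c (i + k) * z ^ i)" for z
  have sv: "summable (\<lambda>i. c (i + k) * z ^ i)" if "\<bar>z\<bar> < \<epsilon>" for z
    using sm[OF that] by (simp add: summable_powser_ignore_initial_segment)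
  have eq: "(\<Sum>i. c i * z ^ i) = z ^ k * v z" if "\<bar>z\<bar> < \<epsilon>" for z
  proof -
    have "(\<Sum>i. c i * z ^ i) = (\<Sum>i. c (i + k) * z ^ (i + k)) + (\<Sum>i<k. c i * z ^ i)"
      by (rule suminf_split_initial_segment[OF sm[OF that]])
    also have "(\<Sum>i<k. c i * z ^ i) = 0" using k0 by simp
    also have "(\<Sum>i. c (i + k) * z ^ (i + k)) = (\<Sum>i. z ^ k * (c (i + k) * z ^ i))"
      by (simp add: power_add mult_ac)
    also have "\<dots> = z ^ k * v z" unfolding v_def using sv[OF that] by (rule suminf_mult)
    finally show ?thesis by simp
  qed
  have "isCont v 0"
    unfolding v_def using sv[of "\<epsilon> / 2"] \<open>0 < \<epsilon>\<close> by (intro isCont_powser[of _ "\<epsilon> / 2"]) auto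
  moreover have "v 0 = c k" by (simp add: v_def)
  moreover have "\<bar>c k\<bar> / 2 > 0" using k by simp
  ultimately obtain d where d: "d > 0" "\<And>z. \<bar>z\<bar> < d \<Longrightarrow> \<bar>v z - c k\<bar> < \<bar>c k\<bar> / 2"
    unfolding continuous_at_eps_delta by (metis dist_real_def diff_zero)
  show ?thesis
  proof (rule exI[of _ k], rule exI[of _ "c k"], rule exI[of _ "min d \<epsilon>"], intro conjI allI impI)
    fix z :: real assume z: "\<bar>z\<bar> < min d \<epsilon>"
    then show "\<exists>v. (\<Sum>k. c k * z ^ k) = z ^ k * v \<and> \<bar>v - c k\<bar> \<le> \<bar>c k\<bar> / 2"
      using d(2)[of z] eq[of z] by (intro exI[of _ "v z"]) simp
  qed (use k d \<open>0 < \<epsilon>\<close> in auto)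
qed

lemma real_analytic_on_leading_term:
  fixes h :: "real \<Rightarrow> real"
  assumes "real_analytic_on h S" "is_interval S" "x \<in> S" "x' \<in> S" "x \<noteq> x'"
  shows "\<exists>\<eta>>0. (\<forall>y\<in>S. \<bar>y - x\<bar> < \<eta> \<longrightarrow> h y = 0) \<or>
    (\<exists>k u. u \<noteq> 0 \<and> (\<forall>y\<in>S. \<bar>y - x\<bar> < \<eta> \<longrightarrow> (\<exists>v. h y = (y - x) ^ k * v \<and> \<bar>v - u\<bar> \<le> \<bar>u\<bar> / 2)))"
proof -
  obtain c \<epsilon> where c: "0 < \<epsilon>" "\<And>z. \<bar>z\<bar> < \<epsilon> \<Longrightarrow> summable (\<lambda>k. c k * z ^ k)"
    "\<And>y. y \<in> S \<Longrightarrow> \<bar>y - x\<bar> < \<epsilon> \<Longrightarrow> h y = (\<Sum>k. c k * (y - x) ^ k)"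
    using real_analytic_on_power_series[OF assms] by blast
  show ?thesis
  proof (cases "\<forall>j. c j = 0")
    case True
    then show ?thesis using c by (intro exI[of _ \<epsilon>]) auto
  next
    case False
    then obtain j where "c j \<noteq> 0" by blast
    from power_series_leading_term[OF c(1,2) this]
    obtain k u \<eta> where *: "u \<noteq> 0" "0 < \<eta>" "\<eta> \<le> \<epsilon>"
      "\<And>z. \<bar>z\<bar> < \<eta> \<Longrightarrow> (\<exists>v. (\<Sum>k. c k * z ^ k) = z ^ k * v \<and> \<bar>v - u\<bar> \<le> \<bar>u\<bar> / 2)"
      by blast
    have "\<exists>v. h y = (y - x) ^ k * v \<and> \<bar>v - u\<bar> \<le> \<bar>u\<bar> / 2" if "y \<in> S" "\<bar>y - x\<bar> < \<eta>" for y
      using *(4)[OF that(2)] c(3)[OF that(1)] *(3) that(2) by simp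
    then show ?thesis using *(1,2) by blast
  qed
qed

lemma leading_term_nonzero:
  fixes v u :: real
  assumes "u \<noteq> 0" "\<bar>v - u\<bar> \<le> \<bar>u\<bar> / 2"
  shows "\<bar>u\<bar> / 2 \<le> sgn u * v" "v \<noteq> 0"
  using assms by (auto simp: sgn_if abs_if split: if_splits)

text \<open>A connectedness argument on the set \<open>Z\<close> of points near which
  \<open>h\<close> vanishes on \<open>S\<close>. It is relatively open by definition; a point of
  \<open>S\<close> outside it has a nonzero leading term, so there is no other zero close to it, and
  \<open>S - Z\<close> is relatively open too.\<close>

lemma real_analytic_on_identity:
  fixes h :: "real \<Rightarrow> real"
  assumes h: "real_analytic_on h S" and S: "is_interval S"
    and "a < b" "{a..b} \<subseteq> S" and zero: "\<And>x. x \<in> {a..b} \<Longrightarrow> h x = 0"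
  shows "\<forall>x\<in>S. h x = 0"
proof -
  define Z where "Z = {x\<in>S. \<exists>\<eta>>0. \<forall>y\<in>S. \<bar>y - x\<bar> < \<eta> \<longrightarrow> h y = 0}"
  have nontriv: "\<exists>x'\<in>S. x \<noteq> x' \<and> \<bar>x' - x\<bar> < \<eta>" if "x \<in> S" "0 < \<eta>" for x \<eta>
  proof -
    have "a \<in> S" "b \<in> S" using assms by auto
    then obtain w where w: "w \<in> S" "w \<noteq> x" using \<open>a < b\<close> by (metis less_irrefl)
    define \<delta> where "\<delta> = min (\<eta> / 2) \<bar>w - x\<bar>"
    have \<delta>: "0 < \<delta>" "\<delta> < \<eta>" using w that by (auto simp: \<delta>_def)
    show ?thesis
    proof (cases "x < w")
      case True
      then have "x \<le> x + \<delta>" "x + \<delta> \<le> w" using \<delta> by (auto simp: \<delta>_def)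
      then have "x + \<delta> \<in> S" using S w that by (meson mem_is_interval_1_I)
      then show ?thesis using \<delta> by (intro bexI[of _ "x + \<delta>"]) auto
    next
      case False
      then have "w \<le> x - \<delta>" "x - \<delta> \<le> x" using \<delta> w by (auto simp: \<delta>_def)
      then have "x - \<delta> \<in> S" using S w that by (meson mem_is_interval_1_I)
      then show ?thesis using \<delta> by (intro bexI[of _ "x - \<delta>"]) auto
    qed
  qed
  have open': "\<exists>\<eta>>0. \<forall>y\<in>S. \<bar>y - x\<bar> < \<eta> \<longrightarrow> y \<in> Z" if "x \<in> Z" for x
  proof -
    obtain \<eta> where \<eta>: "\<eta> > 0" "\<And>y. y \<in> S \<Longrightarrow> \<bar>y - x\<bar> < \<eta> \<Longrightarrow> h y = 0"
      using \<open>x \<in> Z\<close> unfolding Z_def by blast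
    have "y \<in> Z" if "y \<in> S" "\<bar>y - x\<bar> < \<eta>" for y
      unfolding Z_def using that \<eta>(2)
      by (auto intro!: exI[of _ "\<eta> - \<bar>y - x\<bar>"])
    then show ?thesis using \<eta>(1) by blast
  qed
  have closed': "\<exists>\<eta>>0. \<forall>y\<in>S. \<bar>y - x\<bar> < \<eta> \<longrightarrow> y \<notin> Z" if x: "x \<in> S" "x \<notin> Z" for x
  proof -
    obtain x' where "x' \<in> S" "x \<noteq> x'" using nontriv[OF x(1), of 1] by auto
    then obtain \<eta> where \<eta>: "\<eta> > 0" "(\<forall>y\<in>S. \<bar>y - x\<bar> < \<eta> \<longrightarrow> h y = 0) \<or>
      (\<exists>k u. u \<noteq> 0 \<and> (\<forall>y\<in>S. \<bar>y - x\<bar> < \<eta> \<longrightarrow> (\<exists>v. h y = (y - x) ^ k * v \<and> \<bar>v - u\<bar> \<le> \<bar>u\<bar> / 2)))"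
      using real_analytic_on_leading_term[OF h S x(1)] by blast
    then obtain k u where ku: "u \<noteq> 0"
      "\<And>y. y \<in> S \<Longrightarrow> \<bar>y - x\<bar> < \<eta> \<Longrightarrow> \<exists>v. h y = (y - x) ^ k * v \<and> \<bar>v - u\<bar> \<le> \<bar>u\<bar> / 2"
      using x unfolding Z_def by blast
    have nz: "h y \<noteq> 0" if "y \<in> S" "\<bar>y - x\<bar> < \<eta>" "y \<noteq> x" for y
      using ku(2)[OF that(1,2)] leading_term_nonzero(2)[OF ku(1)] that(3) by auto
    have "y \<notin> Z" if y: "y \<in> S" "\<bar>y - x\<bar> < \<eta>" for y
    proof
      assume "y \<in> Z"
      then have "y \<noteq> x" using x by auto
      moreover have "h y = 0" using \<open>y \<in> Z\<close> y unfolding Z_def by auto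
      ultimately show False using nz y by blast
    qed
    then show ?thesis using \<eta>(1) by blast
  qed
  have "connected S" using S by (simp add: is_interval_connected_1)
  define U where "U = \<Union>{ball x \<eta> | x \<eta>. x \<in> S \<and> (\<forall>y\<in>S. \<bar>y - x\<bar> < \<eta> \<longrightarrow> y \<in> Z)}"
  define V where "V = \<Union>{ball x \<eta> | x \<eta>. x \<in> S \<and> (\<forall>y\<in>S. \<bar>y - x\<bar> < \<eta> \<longrightarrow> y \<notin> Z)}"
  have "open U" "open V" unfolding U_def V_def by auto
  moreover have "Z \<subseteq> U"
  proof
    fix x assume "x \<in> Z"
    then obtain \<eta> where "\<eta> > 0" "\<forall>y\<in>S. \<bar>y - x\<bar> < \<eta> \<longrightarrow> y \<in> Z" using open' by blast
    moreover have "x \<in> S" using \<open>x \<in> Z\<close> by (simp add: Z_def)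
    ultimately have "ball x \<eta> \<in> {ball x \<eta> | x \<eta>. x \<in> S \<and> (\<forall>y\<in>S. \<bar>y - x\<bar> < \<eta> \<longrightarrow> y \<in> Z)}" by blast
    moreover have "x \<in> ball x \<eta>" using \<open>\<eta> > 0\<close> by simp
    ultimately show "x \<in> U" unfolding U_def by (rule UnionI)
  qed
  moreover have "S - Z \<subseteq> V"
  proof
    fix x assume "x \<in> S - Z"
    then obtain \<eta> where "\<eta> > 0" "\<forall>y\<in>S. \<bar>y - x\<bar> < \<eta> \<longrightarrow> y \<notin> Z" using closed' by blast
    then have "ball x \<eta> \<in> {ball x \<eta> | x \<eta>. x \<in> S \<and> (\<forall>y\<in>S. \<bar>y - x\<bar> < \<eta> \<longrightarrow> y \<notin> Z)}"
      using \<open>x \<in> S - Z\<close> by blast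
    moreover have "x \<in> ball x \<eta>" using \<open>\<eta> > 0\<close> by simp
    ultimately show "x \<in> V" unfolding V_def by (rule UnionI)
  qed
  moreover have "U \<inter> S \<subseteq> Z" "V \<inter> S \<inter> Z = {}"
    unfolding U_def V_def by (auto simp: dist_real_def abs_minus_commute)
  ultimately have "U \<inter> S = {} \<or> V \<inter> S = {}"
    using connectedD[OF \<open>connected S\<close>, of U V] by blast
  moreover have "(a + b) / 2 \<in> Z"
    unfolding Z_def using assms
    by (auto intro!: exI[of _ "(b - a) / 2"] zero simp: field_simps abs_if split: if_splits)
  then have "(a + b) / 2 \<in> U \<inter> S" using \<open>Z \<subseteq> U\<close> by (auto simp: Z_def)
  ultimately have "V \<inter> S = {}" by blast
  then have "S \<subseteq> Z" using \<open>S - Z \<subseteq> V\<close> by blast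
  then show ?thesis unfolding Z_def by force
qed

section \<open>Self-similar measures\<close>

lemma affine_preimage_borel:
  assumes "A \<in> sets borel"
  shows "{x::real. c * x + d \<in> A} \<in> sets borel"
proof -
  have "(\<lambda>x::real. c * x + d) -` A \<inter> space borel \<in> sets borel"
    by (rule measurable_sets[OF _ assms]) simp
  then show ?thesis by (simp add: vimage_def)
qed

lemma interval_preimage:
  fixes c d x h :: real
  assumes "c \<noteq> 0"
  shows "\<exists>y. {z. c * z + d \<in> {x..x+h}} = {y..y + h / \<bar>c\<bar>}"
proof (cases "c > 0")
  case True
  then show ?thesis by (intro exI[of _ "(x - d) / c"]) (auto simp: field_simps)
next
  case False
  then have "c < 0" using assms by simp
  then have 1: "(x + h - d) / c + h / \<bar>c\<bar> = (x - d) / c" by (simp add: field_simps)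
  have "{z. c * z + d \<in> {x..x+h}} = {(x + h - d) / c..(x - d) / c}"
    using \<open>c < 0\<close> by (auto simp: neg_divide_le_eq neg_le_divide_eq mult.commute)
  then show ?thesis unfolding 1[symmetric] by blast
qed

text \<open>The weights form a \<open>pmf\<close> so that random compositions can be built by
  binding. The condition \<open>distinct\<close> is the inequality of the fixed points
  \<open>t i / (1 - r i)\<close> cleared of denominators; the difference of its two sides is also
  that of the translations of the two compositions, so it says that the two maps do not
  commute.\<close>

locale self_similar =
  fixes P :: "'i pmf" and r t :: "'i \<Rightarrow> real" and \<mu> :: "real measure" and a b :: real
  assumes finite_index: "finite (set_pmf P)"
    and ratio_nonzero: "i \<in> set_pmf P \<Longrightarrow> r i \<noteq> 0"
    and ratio_less_1: "i \<in> set_pmf P \<Longrightarrow> \<bar>r i\<bar> < 1"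
    and prob: "prob_space \<mu>" and sets_eq: "sets \<mu> = sets borel"
    and self_sim: "A \<in> sets borel \<Longrightarrow>
      measure \<mu> A = (\<Sum>i\<in>set_pmf P. pmf P i * measure \<mu> {x. r i * x + t i \<in> A})"
    and full: "measure \<mu> {a..b} = 1"
    and invariant: "i \<in> set_pmf P \<Longrightarrow> x \<in> {a..b} \<Longrightarrow> r i * x + t i \<in> {a..b}"
    and a_less_b: "a < b"
    and distinct: "\<exists>i\<in>set_pmf P. \<exists>j\<in>set_pmf P. t i * (1 - r j) \<noteq> t j * (1 - r i)"
begin

sublocale prob_space \<mu> by (rule prob)

lemma borel_measurable_mu: "f \<in> borel_measurable borel \<Longrightarrow> f \<in> borel_measurable \<mu>"
  by (simp add: measurable_cong_sets[OF sets_eq refl])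

lemma space_eq [simp]: "space \<mu> = UNIV"
  using sets_eq_imp_space_eq[OF sets_eq] by simp

lemma AE_in_interval: "AE x in \<mu>. x \<in> {a..b}"
  using full by (subst prob_eq_1[symmetric]) (simp_all add: sets_eq)

lemma affine_distr_subprob: "distr \<mu> borel (\<lambda>x. c * x + d) \<in> space (subprob_algebra borel)"
  unfolding space_subprob_algebra
  by (auto intro!: prob_space_imp_subprob_space prob_space_distr borel_measurable_mu)

text \<open>The identity on Borel sets is upgraded to an identity of measures, a mixture of
  push-forwards, so that the change of variables for integrals reduces to
  \<open>integral_bind\<close>.\<close>

lemma mu_eq_bind: "\<mu> = measure_pmf P \<bind> (\<lambda>i. distr \<mu> borel (\<lambda>x. r i * x + t i))" (is "_ = ?B")
proof (rule measure_eqI)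
  have N: "(\<lambda>i. distr \<mu> borel (\<lambda>x. r i * x + t i)) \<in> measurable (measure_pmf P) (subprob_algebra borel)"
    using affine_distr_subprob by simp
  show sets: "sets \<mu> = sets ?B" by (subst sets_bind[OF sets_kernel[OF N]]) (auto simp: sets_eq)
  fix A assume "A \<in> sets \<mu>"
  then have A: "A \<in> sets borel" by (simp add: sets_eq)
  have "emeasure ?B A = (\<integral>\<^sup>+i. emeasure (distr \<mu> borel (\<lambda>x. r i * x + t i)) A \<partial>measure_pmf P)"
    using N A by (intro emeasure_bind) auto
  also have "\<dots> = (\<integral>\<^sup>+i. ennreal (measure \<mu> {x. r i * x + t i \<in> A}) \<partial>measure_pmf P)"
    using A by (intro nn_integral_cong)
      (simp add: emeasure_distr borel_measurable_mu vimage_def emeasure_eq_measure)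
  also have "\<dots> = (\<Sum>i\<in>set_pmf P. ennreal (measure \<mu> {x. r i * x + t i \<in> A}) * ennreal (pmf P i))"
    using finite_index by (rule nn_integral_measure_pmf_finite) simp
  also have "\<dots> = ennreal (\<Sum>i\<in>set_pmf P. pmf P i * measure \<mu> {x. r i * x + t i \<in> A})"
  proof -
    have "ennreal (measure \<mu> {x. r i * x + t i \<in> A}) * ennreal (pmf P i)
        = ennreal (pmf P i * measure \<mu> {x. r i * x + t i \<in> A})" for i
      by (subst ennreal_mult[symmetric]) (auto simp: mult.commute)
    then show ?thesis by (simp add: sum_ennreal)
  qed
  also have "\<dots> = emeasure \<mu> A" by (simp add: emeasure_eq_measure self_sim[OF A])
  finally show "emeasure \<mu> A = emeasure ?B A" by simp
qed

lemma integral_self_similar_real: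
  fixes \<phi> :: "real \<Rightarrow> real"
  assumes [measurable]: "\<phi> \<in> borel_measurable borel" and bd: "\<And>x. \<bar>\<phi> x\<bar> \<le> B"
  shows "(\<integral>x. \<phi> x \<partial>\<mu>) = (\<Sum>i\<in>set_pmf P. pmf P i * (\<integral>x. \<phi> (r i * x + t i) \<partial>\<mu>))"
proof -
  have "(\<integral>x. \<phi> x \<partial>\<mu>) = (\<integral>x. \<phi> x \<partial>(measure_pmf P \<bind> (\<lambda>i. distr \<mu> borel (\<lambda>x. r i * x + t i))))"
    by (subst mu_eq_bind) (rule refl)
  also have "\<dots> = (\<integral>i. (\<integral>x. \<phi> x \<partial>distr \<mu> borel (\<lambda>x. r i * x + t i)) \<partial>measure_pmf P)"
  proof (rule integral_bind[where K = borel and B = B and B' = 1])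
    show "AE i in measure_pmf P. emeasure (distr \<mu> borel (\<lambda>x. r i * x + t i))
        (space (distr \<mu> borel (\<lambda>x. r i * x + t i))) \<le> ennreal 1"
      using emeasure_space_1
      by (intro AE_I2) (simp add: emeasure_distr borel_measurable_mu del: emeasure_space_1)
  qed (use affine_distr_subprob bd in \<open>auto intro: measure_pmf.finite_measure_axioms\<close>)
  also have "\<dots> = (\<integral>i. (\<integral>x. \<phi> (r i * x + t i) \<partial>\<mu>) \<partial>measure_pmf P)"
    by (intro Bochner_Integration.integral_cong refl integral_distr borel_measurable_mu) auto
  also have "\<dots> = (\<Sum>i\<in>set_pmf P. pmf P i * (\<integral>x. \<phi> (r i * x + t i) \<partial>\<mu>))"
    using finite_index by (subst integral_measure_pmf[of "set_pmf P"]) auto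
  finally show ?thesis .
qed

lemma integrable_bounded_borel:
  fixes \<phi> :: "real \<Rightarrow> complex"
  assumes "\<phi> \<in> borel_measurable borel" and "\<And>x. cmod (\<phi> x) \<le> B"
  shows "integrable \<mu> (\<lambda>x. \<phi> (c * x + d))"
  using assms by (intro integrable_const_bound[of _ B] borel_measurable_mu) auto

lemma integral_self_similar:
  fixes \<phi> :: "real \<Rightarrow> complex"
  assumes [measurable]: "\<phi> \<in> borel_measurable borel" and bd: "\<And>x. cmod (\<phi> x) \<le> B"
  shows "(\<integral>x. \<phi> x \<partial>\<mu>) = (\<Sum>i\<in>set_pmf P. pmf P i *\<^sub>R (\<integral>x. \<phi> (r i * x + t i) \<partial>\<mu>))"
proof (rule complex_eqI)
  note int = integrable_bounded_borel[OF assms]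
  have int1: "integrable \<mu> \<phi>" using int[of 1 0] by simp
  have "\<bar>Re (\<phi> x)\<bar> \<le> B" "\<bar>Im (\<phi> x)\<bar> \<le> B" for x
    using bd[of x] abs_Re_le_cmod[of "\<phi> x"] abs_Im_le_cmod[of "\<phi> x"] by linarith+
  then show "Re (\<integral>x. \<phi> x \<partial>\<mu>) = Re (\<Sum>i\<in>set_pmf P. pmf P i *\<^sub>R (\<integral>x. \<phi> (r i * x + t i) \<partial>\<mu>))"
    "Im (\<integral>x. \<phi> x \<partial>\<mu>) = Im (\<Sum>i\<in>set_pmf P. pmf P i *\<^sub>R (\<integral>x. \<phi> (r i * x + t i) \<partial>\<mu>))"
    using integral_self_similar_real[of "\<lambda>x. Re (\<phi> x)" B] integral_self_similar_real[of "\<lambda>x. Im (\<phi> x)" B]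
    by (simp_all add: int int1 flip: integral_Re integral_Im)
qed

section \<open>Extremal ratios and the Frostman condition\<close>

definition rho_min :: real where "rho_min = Min ((\<lambda>i. \<bar>r i\<bar>) ` set_pmf P)"
definition rho_max :: real where "rho_max = Max ((\<lambda>i. \<bar>r i\<bar>) ` set_pmf P)"

lemma rho_min: "0 < rho_min" "rho_min < 1" "i \<in> set_pmf P \<Longrightarrow> rho_min \<le> \<bar>r i\<bar>"
proof -
  have "rho_min \<in> (\<lambda>i. \<bar>r i\<bar>) ` set_pmf P"
    unfolding rho_min_def using finite_index by (intro Min_in) (auto simp: set_pmf_not_empty)
  then show "0 < rho_min" "rho_min < 1" using ratio_nonzero ratio_less_1 by auto
  show "i \<in> set_pmf P \<Longrightarrow> rho_min \<le> \<bar>r i\<bar>" unfolding rho_min_def using finite_index by auto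
qed

lemma rho_max: "0 < rho_max" "rho_max < 1" "i \<in> set_pmf P \<Longrightarrow> \<bar>r i\<bar> \<le> rho_max"
proof -
  have "rho_max \<in> (\<lambda>i. \<bar>r i\<bar>) ` set_pmf P"
    unfolding rho_max_def using finite_index by (intro Max_in) (auto simp: set_pmf_not_empty)
  then show "0 < rho_max" "rho_max < 1" using ratio_nonzero ratio_less_1 by auto
  show "i \<in> set_pmf P \<Longrightarrow> \<bar>r i\<bar> \<le> rho_max" unfolding rho_max_def using finite_index by auto
qed

lemma sum_pmf_1: "(\<Sum>i\<in>set_pmf P. pmf P i) = 1"
  using finite_index by (rule sum_pmf_eq_1) simp

text \<open>Here \<open>z + (r i)^N * (y - z)\<close> is the \<open>N\<close>-fold iterate of the \<open>i\<close>-th map, with fixed point \<open>z\<close>.\<close>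

lemma measure_interval_avoiding_iterate:
  assumes i: "i \<in> set_pmf P" and z: "r i * z + t i = z"
    and "0 \<le> h"
    and avoid: "\<And>y. y \<in> {a..b} \<Longrightarrow> z + r i ^ N * (y - z) \<notin> {x..x+h}"
    and M: "\<And>x h'. h' \<le> h / rho_min ^ N \<Longrightarrow> measure \<mu> {x..x+h'} \<le> M"
  shows "measure \<mu> {x..x+h} \<le> (1 - pmf P i ^ N) * M"
  using assms(3-5)
proof (induction N arbitrary: x h)
  case 0
  \<comment> \<open>With no iterate applied, avoidance says that the interval misses
    \<open>{a..b}\<close>, which carries all the mass.\<close>
  have "y \<notin> {x..x+h}" if "y \<in> {a..b}" for y using "0.prems"(2)[OF that] by simp
  then have "{a..b} \<inter> {x..x+h} = {}" by blast
  then have "measure \<mu> {a..b} + measure \<mu> {x..x+h} = measure \<mu> ({a..b} \<union> {x..x+h})"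
    by (intro finite_measure_Union[symmetric]) (auto simp: sets_eq)
  also have "\<dots> \<le> 1" by simp
  finally have "measure \<mu> {x..x+h} \<le> 0" by (simp add: full)
  then show ?case by simp
next
  case (Suc N)
  let ?m = "\<lambda>k. measure \<mu> {y. r k * y + t k \<in> {x..x+h}}"
  have m: "?m k \<le> M" if k: "k \<in> set_pmf P" for k
  proof -
    obtain y where y: "{z. r k * z + t k \<in> {x..x+h}} = {y..y + h / \<bar>r k\<bar>}"
      using interval_preimage ratio_nonzero k by blast
    have "h / \<bar>r k\<bar> \<le> h / rho_min" using rho_min k Suc.prems(1) ratio_nonzero[OF k] by (intro divide_left_mono) auto
    also have "\<dots> = h * 1 / rho_min" by simp
    also have "\<dots> \<le> h * (1 / rho_min ^ N) / rho_min"
      using rho_min Suc.prems(1) by (intro divide_right_mono mult_left_mono) (auto simp: power_le_one)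
    also have "\<dots> = h / rho_min ^ Suc N" by simp
    finally show ?thesis unfolding y by (rule Suc.prems(3))
  qed
  \<comment> \<open>Pulled back along the \<open>i\<close>-th map, the interval avoids the iterate
    with one step fewer; the other maps only get the bound \<open>M\<close>. The weights combine as
    \<open>pmf P i * (1 - pmf P i ^ N) + (1 - pmf P i) = 1 - pmf P i ^ Suc N\<close>.\<close>
  have mi: "?m i \<le> (1 - pmf P i ^ N) * M"
  proof -
    obtain w where w: "{y. r i * y + t i \<in> {x..x+h}} = {w..w + h / \<bar>r i\<bar>}"
      using interval_preimage ratio_nonzero i by blast
    show ?thesis unfolding w
    proof (rule Suc.IH)
      show "0 \<le> h / \<bar>r i\<bar>" using Suc.prems(1) by simp
      show "z + r i ^ N * (y - z) \<notin> {w..w + h / \<bar>r i\<bar>}" if "y \<in> {a..b}" for y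
      proof -
        have "r i * (z + r i ^ N * (y - z)) + t i = z + r i ^ Suc N * (y - z)"
          using z by (simp add: algebra_simps)
        then show ?thesis using Suc.prems(2)[OF that] unfolding w[symmetric] by simp
      qed
      show "measure \<mu> {x..x + h'} \<le> M" if "h' \<le> h / \<bar>r i\<bar> / rho_min ^ N" for x h'
      proof (rule Suc.prems(3))
        have "h / \<bar>r i\<bar> / rho_min ^ N \<le> h / rho_min / rho_min ^ N"
          using rho_min i Suc.prems(1) ratio_nonzero[OF i] by (intro divide_right_mono divide_left_mono) auto
        then show "h' \<le> h / rho_min ^ Suc N" using that by simp
      qed
    qed
  qed
  have "measure \<mu> {x..x+h} = (\<Sum>k\<in>set_pmf P. pmf P k * ?m k)" by (rule self_sim) simp
  also have "\<dots> = pmf P i * ?m i + (\<Sum>k\<in>set_pmf P - {i}. pmf P k * ?m k)"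
    using i finite_index by (simp add: sum.remove)
  also have "\<dots> \<le> pmf P i * ((1 - pmf P i ^ N) * M) + (\<Sum>k\<in>set_pmf P - {i}. pmf P k * M)"
    using m mi by (intro add_mono mult_left_mono sum_mono) auto
  also have "(\<Sum>k\<in>set_pmf P - {i}. pmf P k * M) = (1 - pmf P i) * M"
    using sum_pmf_1 i finite_index by (simp add: sum.remove flip: sum_distrib_right)
  finally show ?case by (simp add: algebra_simps)
qed

text \<open>High iterates of two maps with different fixed points send \<open>{a..b}\<close> into
  the \<open>d\<close>-neighbourhoods of these points, which are \<open>3 * d\<close> apart, so an
  interval shorter than \<open>d\<close> misses one of the two images. Shrinking lengths by the
  factor \<open>c\<close> thus costs a factor \<open>1 - \<beta>\<close> of mass, and the exponent
  \<open>s\<close> solves \<open>c powr s = 1 - \<beta>\<close>.\<close>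

lemma frostman: "\<exists>C>0. \<exists>s>0. \<forall>x h. 0 < h \<longrightarrow> measure \<mu> {x..x+h} \<le> C * h powr s"
proof -
  obtain i j where ij: "i \<in> set_pmf P" "j \<in> set_pmf P" "t i * (1 - r j) \<noteq> t j * (1 - r i)"
    using distinct by blast
  define z where "z k = t k / (1 - r k)" for k
  have r1: "r k < 1" if "k \<in> set_pmf P" for k using ratio_less_1[OF that] by linarith
  have z: "r k * z k + t k = z k" if "k \<in> set_pmf P" for k
    using r1[OF that] by (simp add: z_def field_simps)
  have zne: "z i \<noteq> z j" using ij r1[of i] r1[of j] by (simp add: z_def frac_eq_eq)
  define d where "d = \<bar>z i - z j\<bar> / 3"
  have d: "d > 0" using zne by (simp add: d_def)
  define R where "R = \<bar>a\<bar> + \<bar>b\<bar> + \<bar>z i\<bar> + \<bar>z j\<bar> + 1"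
  have R: "R > 0" by (auto simp: R_def)
  obtain N0 where N0: "rho_max ^ N0 < d / R"
    using real_arch_pow_inv[of "d / R" rho_max] d R rho_max by auto
  define N where "N = Suc N0"
  have "rho_max ^ N \<le> rho_max ^ N0" using rho_max by (simp add: N_def mult_left_le_one_le)
  then have "rho_max ^ N * R \<le> rho_max ^ N0 * R" using R by (intro mult_right_mono) auto
  also have "\<dots> < d" using N0 R by (simp add: field_simps)
  finally have N: "rho_max ^ N * R < d" .
  have near: "\<bar>r k ^ N * (y - z k)\<bar> < d" if "k \<in> {i, j}" "y \<in> {a..b}" for k y
  proof -
    have "\<bar>r k\<bar> ^ N * \<bar>y - z k\<bar> \<le> rho_max ^ N * R"
      using that ij rho_max by (intro mult_mono power_mono) (auto simp: R_def)
    then show ?thesis using N by (simp add: abs_mult power_abs)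
  qed
  define c where "c = rho_min ^ N"
  have c: "0 < c" "c < 1" using rho_min by (auto simp: c_def N_def simp del: power_Suc intro: power_Suc_less_one)
  define \<beta> where "\<beta> = min (pmf P i) (pmf P j) ^ N"
  have \<beta>pos: "0 < \<beta>" using ij by (auto simp: \<beta>_def pmf_positive)
  have "i \<noteq> j" using zne by auto
  have "pmf P i + pmf P j \<le> 1"
  proof -
    have "sum (pmf P) {i, j} \<le> sum (pmf P) (set_pmf P)"
      using ij finite_index by (intro sum_mono2) auto
    then show ?thesis using \<open>i \<noteq> j\<close> sum_pmf_1 by simp
  qed
  then have "min (pmf P i) (pmf P j) < 1" using ij pmf_positive[of i P] pmf_positive[of j P] by linarith
  then have \<beta>1: "\<beta> < 1" unfolding \<beta>_def N_def using pmf_nonneg by (intro power_Suc_less_one) (auto simp: pmf_positive ij)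
  have step: "measure \<mu> {x..x+h} \<le> (1 - \<beta>) * M"
    if h: "0 \<le> h" "h < d" and M: "\<And>x h'. h' \<le> h / c \<Longrightarrow> measure \<mu> {x..x+h'} \<le> M" for x h M
  proof -
    have "0 \<le> M" using M[of 0 0] h c by (force intro: order_trans[OF measure_nonneg])
    have "\<exists>k\<in>{i, j}. \<forall>y\<in>{a..b}. z k + r k ^ N * (y - z k) \<notin> {x..x+h}"
    proof (rule ccontr)
      assume "\<not> ?thesis"
      then obtain y y' where y: "y \<in> {a..b}" "y' \<in> {a..b}"
        "z i + r i ^ N * (y - z i) \<in> {x..x+h}" "z j + r j ^ N * (y' - z j) \<in> {x..x+h}" by auto
      have "\<bar>r i ^ N * (y - z i)\<bar> < d" "\<bar>r j ^ N * (y' - z j)\<bar> < d" using near y by auto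
      moreover have "\<bar>z i - z j\<bar> = 3 * d" by (simp add: d_def)
      ultimately show False using y(3,4) h by (auto simp: abs_if split: if_splits)
    qed
    then obtain k where k: "k \<in> {i, j}" "\<And>y. y \<in> {a..b} \<Longrightarrow> z k + r k ^ N * (y - z k) \<notin> {x..x+h}" by blast
    have kP: "k \<in> set_pmf P" using k ij by auto
    have "measure \<mu> {x..x+h} \<le> (1 - pmf P k ^ N) * M"
      using M by (intro measure_interval_avoiding_iterate[OF kP z[OF kP] h(1) k(2)]) (auto simp: c_def)
    also have "\<beta> \<le> pmf P k ^ N" using k unfolding \<beta>_def by (intro power_mono) auto
    then have "(1 - pmf P k ^ N) * M \<le> (1 - \<beta>) * M" using \<open>0 \<le> M\<close> by (intro mult_right_mono) auto
    finally show ?thesis .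
  qed
  have scale: "measure \<mu> {x..x+h} \<le> (1 - \<beta>) ^ k" if "h \<le> c ^ k * (d / 2)" for x h k
    using that
  proof (induction k arbitrary: x h)
    case 0 show ?case by simp
  next
    case (Suc k)
    show ?case
    proof (cases "0 \<le> h")
      case True
      have "c ^ Suc k * (d / 2) \<le> 1 * (d / 2)" using c d by (intro mult_right_mono power_le_one) auto
      then have "h < d" using Suc.prems d by linarith
      moreover have "measure \<mu> {x..x+h'} \<le> (1 - \<beta>) ^ k" if "h' \<le> h / c" for x h'
      proof (rule Suc.IH)
        have "h / c \<le> c ^ k * (d / 2)" using Suc.prems c by (simp add: field_simps)
        then show "h' \<le> c ^ k * (d / 2)" using that by linarith
      qed
      ultimately show ?thesis using step[OF True, of "(1 - \<beta>) ^ k"] by simp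
    qed (use \<beta>1 in simp)
  qed
  define s where "s = log c (1 - \<beta>)"
  have s: "0 < s" "c powr s = 1 - \<beta>"
  proof -
    show "0 < s" unfolding s_def log_def using c \<beta>1 \<beta>pos by (intro divide_neg_neg) auto
    show "c powr s = 1 - \<beta>" unfolding s_def using c \<beta>1 by simp
  qed
  define C where "C = (2 / (c * d)) powr s"
  have C: "C > 0" using c d by (simp add: C_def)
  have "measure \<mu> {x..x+h} \<le> C * h powr s" if h: "0 < h" for x h
  proof -
    have Ch: "C * h powr s = (2 * h / (c * d)) powr s"
      using h c d by (simp add: C_def flip: powr_mult)
    have "\<exists>k. c ^ k * (d / 2) < h"
    proof -
      obtain k where "c ^ k < 2 * h / d" using real_arch_pow_inv[of "2 * h / d" c] h d c by auto
      then show ?thesis using d by (auto simp: field_simps)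
    qed
    \<comment> \<open>For the least such \<open>k\<close>, minimality puts \<open>h\<close> below
      the scale of index \<open>k - 1\<close>, where \<open>scale\<close> applies, while
      \<open>k\<close> itself gives \<open>c ^ (k - 1) < 2 * h / (c * d)\<close>. For
      \<open>k = 0\<close> the claimed bound is at least 1.\<close>
    then have ex: "\<exists>k. c ^ k * (d / 2) < h \<and> (\<forall>l<k. \<not> c ^ l * (d / 2) < h)" by (rule exists_least_iff[THEN iffD1])
    then obtain k where k: "c ^ k * (d / 2) < h" "\<And>l. l < k \<Longrightarrow> \<not> c ^ l * (d / 2) < h" by blast
    show ?thesis
    proof (cases k)
      case 0
      have "d * c \<le> d * 1" using c d by (intro mult_left_mono) auto
      moreover have "d < 2 * h" using k(1) 0 by simp
      ultimately have "c * d \<le> 2 * h" by (simp add: mult.commute)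
      then have "1 \<le> 2 * h / (c * d)" using c d by (simp add: le_divide_eq)
      then have "1 \<le> C * h powr s" unfolding Ch using s by (intro ge_one_powr_ge_zero) auto
      then show ?thesis using order_trans[OF prob_le_1] by blast
    next
      case (Suc l)
      have "measure \<mu> {x..x+h} \<le> (1 - \<beta>) ^ l" using k(2)[of l] Suc by (intro scale) auto
      also have "\<dots> = (c ^ l) powr s"
        using c by (simp add: s(2)[symmetric] powr_powr mult.commute flip: powr_realpow)
      also have "\<dots> \<le> (2 * h / (c * d)) powr s"
        using k(1) Suc c d s by (intro powr_mono2) (auto simp: field_simps)
      finally show ?thesis by (simp add: Ch)
    qed
  qed
  then show ?thesis using C s by blast
qed

end

section \<open>Level sets and the Fourier transform\<close>

lemma power_add_ge:
  fixes u v :: real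
  assumes "0 \<le> u" "0 \<le> v"
  shows "u ^ Suc k + v ^ Suc k \<le> (u + v) ^ Suc k"
proof (induction k)
  case (Suc k)
  have "u ^ Suc (Suc k) + v ^ Suc (Suc k) \<le> (u + v) * (u ^ Suc k + v ^ Suc k)"
    using assms by (simp add: algebra_simps)
  also have "\<dots> \<le> (u + v) * (u + v) ^ Suc k"
    using assms Suc by (intro mult_left_mono) auto
  finally show ?case by simp
qed simp

text \<open>The difference of \<open>f\<close> and the primitive
  \<open>c / Suc k * (z - x0) ^ Suc k\<close> increases. Superadditivity of the power then removes
  \<open>x0\<close>, so that the bound depends on \<open>y - x\<close> alone and is uniform over all
  pairs to the right of \<open>x0\<close>.\<close>

lemma derivative_power_growth:
  fixes f f' :: "real \<Rightarrow> real"
  assumes der: "\<And>z. z \<in> {x..y} \<Longrightarrow> (f has_real_derivative f' z) (at z within {x..y})"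
    and "0 < c" "x0 \<le> x" "x \<le> y"
    and lower: "\<And>z. z \<in> {x..y} \<Longrightarrow> c * (z - x0) ^ k \<le> f' z"
  shows "c / Suc k * (y - x) ^ Suc k \<le> f y - f x"
proof -
  define \<phi> where "\<phi> z = f z - c / Suc k * (z - x0) ^ Suc k" for z
  have d: "(\<phi> has_real_derivative f' z - c * (z - x0) ^ k) (at z within {x..y})" if "z \<in> {x..y}" for z
    unfolding \<phi>_def using der[OF that]
    by (auto intro!: derivative_eq_intros simp del: of_nat_Suc power_Suc simp: field_simps)
  have "\<phi> x \<le> \<phi> y"
  proof (rule DERIV_nonneg_imp_increasing_open[OF \<open>x \<le> y\<close>])
    show "continuous_on {x..y} \<phi>" using d by (rule DERIV_continuous_on)
    show "\<exists>D. (\<phi> has_real_derivative D) (at z) \<and> 0 \<le> D" if "x < z" "z < y" for z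
      using d[of z] lower[of z] that at_within_Icc_at[of x z y]
      by (intro exI[of _ "f' z - c * (z - x0) ^ k"]) auto
  qed
  moreover have "(x - x0) ^ Suc k + (y - x) ^ Suc k \<le> (y - x0) ^ Suc k"
    using power_add_ge[of "x - x0" "y - x" k] assms by (simp del: power_Suc)
  then have "c / Suc k * ((x - x0) ^ Suc k + (y - x) ^ Suc k) \<le> c / Suc k * (y - x0) ^ Suc k"
    using \<open>0 < c\<close> by (intro mult_left_mono) auto
  ultimately show ?thesis unfolding \<phi>_def by (simp add: algebra_simps del: power_Suc of_nat_Suc)
qed

lemma derivative_power_growth_left:
  fixes f f' :: "real \<Rightarrow> real"
  assumes der: "\<And>z. z \<in> {x..y} \<Longrightarrow> (f has_real_derivative f' z) (at z within {x..y})"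
    and "0 < c" "y \<le> x0" "x \<le> y"
    and lower: "\<And>z. z \<in> {x..y} \<Longrightarrow> c * (x0 - z) ^ k \<le> - f' z"
  shows "c / Suc k * (y - x) ^ Suc k \<le> f x - f y"
proof -
  have "c / Suc k * (- x - - y) ^ Suc k \<le> f (- (- x)) - f (- (- y))"
  proof (rule derivative_power_growth[where f = "\<lambda>z. f (- z)" and f' = "\<lambda>z. - f' (- z)" and ?x0.0 = "- x0"])
    fix z assume z: "z \<in> {- y..- x}"
    have "((\<lambda>z. f (- z)) has_real_derivative f' (- z) * (- 1)) (at z within {- y..- x})"
    proof (rule DERIV_image_chain[where g = "\<lambda>z. - z", unfolded o_def])
      show "(f has_real_derivative f' (- z)) (at (- z) within uminus ` {- y..- x})"
        using der[of "- z"] z by simp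
    qed (auto intro!: derivative_eq_intros)
    then show "((\<lambda>z. f (- z)) has_real_derivative - f' (- z)) (at z within {- y..- x})" by simp
    show "c * (z - - x0) ^ k \<le> - f' (- z)" using lower[of "- z"] z by (simp add: add.commute)
  qed (use assms in auto)
  then show ?thesis by simp
qed

context self_similar
begin

text \<open>Two points of the level set have values within \<open>2 * h\<close>, so their distance
  is at most \<open>H = (2 * h / c) powr (1 / Suc k)\<close>. The level set fits into an interval of
  length \<open>2 * H\<close>, to which the Frostman condition applies.\<close>

lemma level_measure_of_growth:
  fixes f :: "real \<Rightarrow> real"
  assumes "0 < c" and growth: "\<And>x y. x \<in> X \<Longrightarrow> y \<in> X \<Longrightarrow> x \<le> y \<Longrightarrow> c * (y - x) ^ Suc k \<le> \<bar>f y - f x\<bar>"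
  shows "\<exists>C>0. \<exists>\<kappa>>0. \<forall>u h. 0 < h \<longrightarrow> measure \<mu> {x\<in>X. \<bar>f x - u\<bar> \<le> h} \<le> C * h powr \<kappa>"
proof -
  obtain C s where C: "C > 0" "s > 0" "\<And>x h. 0 < h \<Longrightarrow> measure \<mu> {x..x+h} \<le> C * h powr s"
    using frostman by blast
  define e where "e = 1 / real (Suc k)"
  have e: "e > 0" by (simp add: e_def)
  define C' where "C' = C * (2 * (2 / c) powr e) powr s"
  have "C' > 0" using C \<open>0 < c\<close> by (simp add: C'_def)
  have "measure \<mu> {x\<in>X. \<bar>f x - u\<bar> \<le> h} \<le> C' * h powr (e * s)" if h: "0 < h" for u h
  proof (cases "{x\<in>X. \<bar>f x - u\<bar> \<le> h} = {}")
    case False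
    then obtain z where z: "z \<in> X" "\<bar>f z - u\<bar> \<le> h" by blast
    define H where "H = (2 * h / c) powr e"
    have H: "H > 0" using h \<open>0 < c\<close> by (simp add: H_def)
    have close: "y - x \<le> H" if "x \<in> X" "y \<in> X" "x \<le> y" "\<bar>f x - u\<bar> \<le> h" "\<bar>f y - u\<bar> \<le> h" for x y
    proof (cases "x = y")
      case False
      have "c * (y - x) ^ Suc k \<le> 2 * h" using growth[OF that(1-3)] that(4,5) by linarith
      then have "(y - x) ^ Suc k \<le> 2 * h / c" using \<open>0 < c\<close> by (simp add: field_simps)
      then have "((y - x) ^ Suc k) powr e \<le> H"
        unfolding H_def using e that(3) by (intro powr_mono2) auto
      also have "((y - x) ^ Suc k) powr e = y - x"
        using that(3) False by (simp add: powr_powr e_def del: power_Suc of_nat_Suc flip: powr_realpow)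
      finally show ?thesis .
    qed (use H in simp)
    have "{x\<in>X. \<bar>f x - u\<bar> \<le> h} \<subseteq> {z - H..z - H + 2 * H}"
    proof
      fix x assume x: "x \<in> {x\<in>X. \<bar>f x - u\<bar> \<le> h}"
      show "x \<in> {z - H..z - H + 2 * H}"
        using close[of x z] close[of z x] x z H by (cases "x \<le> z") auto
    qed
    then have "measure \<mu> {x\<in>X. \<bar>f x - u\<bar> \<le> h} \<le> measure \<mu> {z - H..z - H + 2 * H}"
      by (intro finite_measure_mono) (auto simp: sets_eq)
    also have "\<dots> \<le> C * (2 * H) powr s" using C(3)[of "2 * H" "z - H"] H by simp
    also have "2 * H = (2 * (2 / c) powr e) * h powr e"
      using h \<open>0 < c\<close> by (simp add: H_def powr_mult powr_divide)
    also have "C * \<dots> powr s = C' * h powr (e * s)"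
      using h \<open>0 < c\<close> by (simp add: C'_def powr_mult powr_powr)
    finally show ?thesis .
  next
    case True
    show ?thesis unfolding True using \<open>C' > 0\<close> by simp
  qed
  then show ?thesis using \<open>C' > 0\<close> e C by (intro exI[of _ C'] conjI exI[of _ "e * s"]) auto
qed

text \<open>Near each point \<open>f'\<close> is comparable to a power of the distance, which gives
  the growth needed for \<open>level_measure_of_growth\<close> on either side. Bisection
  (\<open>Bolzano\<close>) assembles the local estimates, since the property \<open>Q\<close> passes
  to the union of adjacent intervals.\<close>

lemma analytic_level_measure:
  fixes f f' :: "real \<Rightarrow> real"
  assumes der: "\<And>x. x \<in> {a..b} \<Longrightarrow> (f has_real_derivative f' x) (at x within {a..b})"
    and an: "real_analytic_on f' {a..b}" and nonzero: "\<exists>x\<in>{a..b}. f' x \<noteq> 0"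
  shows "\<exists>C>0. \<exists>\<kappa>>0. \<forall>u h. 0 < h \<longrightarrow> measure \<mu> {x\<in>{a..b}. \<bar>f x - u\<bar> \<le> h} \<le> C * h powr \<kappa>"
proof -
  have cont: "continuous_on {a..b} f" using der by (rule DERIV_continuous_on)
  define L where "L x y u h = {z \<in> {x..y} \<inter> {a..b}. \<bar>f z - u\<bar> \<le> h}" for x y u h
  have "closed (L x y u h)" for x y u h
  proof -
    have "L x y u h = ({x..y} \<inter> {a..b}) \<inter> f -` cball u h"
      by (auto simp: L_def dist_real_def abs_minus_commute)
    then show ?thesis
      by (auto intro!: continuous_closed_preimage continuous_on_subset[OF cont])
  qed
  then have meas: "L x y u h \<in> sets \<mu>" for x y u h by (simp add: sets_eq borel_closed)
  \<comment> \<open>The restriction \<open>h \<le> 1\<close> allows passing to the smaller of two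
    exponents when intervals are joined; larger \<open>h\<close> are covered at the end by the
    constant \<open>max C 1\<close>.\<close>
  define Q where "Q x y \<longleftrightarrow> (\<exists>C>0. \<exists>\<kappa>>0. \<forall>u h. 0 < h \<longrightarrow> h \<le> 1 \<longrightarrow> measure \<mu> (L x y u h) \<le> C * h powr \<kappa>)" for x y
  have trans: "Q x z" if xy: "Q x y" and yz: "Q y z" and "x \<le> y" "y \<le> z" for x y z
  proof -
    obtain C1 k1 where 1: "C1 > 0" "k1 > 0"
      "\<And>u h. 0 < h \<Longrightarrow> h \<le> 1 \<Longrightarrow> measure \<mu> (L x y u h) \<le> C1 * h powr k1" using xy unfolding Q_def by blast
    obtain C2 k2 where 2: "C2 > 0" "k2 > 0"
      "\<And>u h. 0 < h \<Longrightarrow> h \<le> 1 \<Longrightarrow> measure \<mu> (L y z u h) \<le> C2 * h powr k2" using yz unfolding Q_def by blast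
    have "measure \<mu> (L x z u h) \<le> (C1 + C2) * h powr min k1 k2" if h: "0 < h" "h \<le> 1" for u h
    proof -
      have "measure \<mu> (L x z u h) \<le> measure \<mu> (L x y u h \<union> L y z u h)"
        using meas by (intro finite_measure_mono) (auto simp: L_def)
      also have "\<dots> \<le> measure \<mu> (L x y u h) + measure \<mu> (L y z u h)"
        by (intro measure_Un_le meas)
      also have "\<dots> \<le> C1 * h powr min k1 k2 + C2 * h powr min k1 k2"
        using 1 2 h by (intro add_mono order_trans[OF 1(3)] order_trans[OF 2(3)] mult_left_mono powr_mono') auto
      finally show ?thesis by (simp add: algebra_simps)
    qed
    then show ?thesis unfolding Q_def using 1(1,2) 2(1,2)
      by (intro exI[of _ "C1 + C2"] exI[of _ "min k1 k2"] conjI) auto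
  qed
  have local_growth: "Q x y" if "0 < c" "\<And>z1 z2. z1 \<in> {x..y} \<inter> {a..b} \<Longrightarrow> z2 \<in> {x..y} \<inter> {a..b} \<Longrightarrow> z1 \<le> z2
      \<Longrightarrow> c * (z2 - z1) ^ Suc k \<le> \<bar>f z2 - f z1\<bar>" for x y c k
    using level_measure_of_growth[of c "{x..y} \<inter> {a..b}" k f] that unfolding Q_def L_def by blast
  have "Q a b"
  proof (rule Bolzano)
    show "a \<le> b" using a_less_b by simp
    show "Q x z" if "Q x y" "Q y z" "x \<le> y" "y \<le> z" for x y z using trans that by blast
    fix x assume "a \<le> x" "x \<le> b"
    then have x: "x \<in> {a..b}" by simp
    obtain x' where "x' \<in> {a..b}" "x \<noteq> x'"
    proof (cases "x = a")
      case True then show ?thesis using that[of b] a_less_b by auto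
    next
      case False then show ?thesis using that[of a] a_less_b by auto
    qed
    from real_analytic_on_leading_term[OF an is_interval_cc x this]
    obtain \<eta> where \<eta>: "\<eta> > 0" "(\<forall>y\<in>{a..b}. \<bar>y - x\<bar> < \<eta> \<longrightarrow> f' y = 0) \<or>
      (\<exists>k u. u \<noteq> 0 \<and> (\<forall>y\<in>{a..b}. \<bar>y - x\<bar> < \<eta> \<longrightarrow> (\<exists>v. f' y = (y - x) ^ k * v \<and> \<bar>v - u\<bar> \<le> \<bar>u\<bar> / 2)))"
      by blast
    \<comment> \<open>Vanishing near one point would spread to all of \<open>{a..b}\<close> by the
      identity principle, against \<open>nonzero\<close>.\<close>
    have "\<not> (\<forall>y\<in>{a..b}. \<bar>y - x\<bar> < \<eta> \<longrightarrow> f' y = 0)"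
    proof
      assume z: "\<forall>y\<in>{a..b}. \<bar>y - x\<bar> < \<eta> \<longrightarrow> f' y = 0"
      define p where "p = max a (x - \<eta> / 2)"
      define q where "q = min b (x + \<eta> / 2)"
      have "p < q" "{p..q} \<subseteq> {a..b}" using x \<eta>(1) a_less_b by (auto simp: p_def q_def)
      moreover have "f' y = 0" if "y \<in> {p..q}" for y
      proof -
        have y: "a \<le> y" "x - \<eta> / 2 \<le> y" "y \<le> b" "y \<le> x + \<eta> / 2"
          using that by (auto simp: p_def q_def)
        then have "\<bar>y - x\<bar> \<le> \<eta> / 2" by linarith
        moreover have "y \<in> {a..b}" using y by simp
        ultimately show ?thesis using z \<eta>(1) by simp
      qed
      ultimately have "\<forall>y\<in>{a..b}. f' y = 0"
        using real_analytic_on_identity[OF an is_interval_cc, of p q] by blast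
      then show False using nonzero by blast
    qed
    then obtain k u where u: "u \<noteq> 0" and
      ku: "\<And>y. y \<in> {a..b} \<Longrightarrow> \<bar>y - x\<bar> < \<eta> \<Longrightarrow> \<exists>v. f' y = (y - x) ^ k * v \<and> \<bar>v - u\<bar> \<le> \<bar>u\<bar> / 2"
      using \<eta>(2) by blast
    define c where "c = \<bar>u\<bar> / 2"
    have c: "c > 0" using u by (simp add: c_def)
    then have c': "c / Suc k > 0" by (intro divide_pos_pos) simp_all
    have der': "(f has_real_derivative f' z) (at z within {z1..z2})" if "a \<le> z1" "z2 \<le> b" "z \<in> {z1..z2}" for z z1 z2
    proof (rule DERIV_subset)
      show "(f has_real_derivative f' z) (at z within {a..b})" using that by (intro der) auto
    qed (use that in auto)
    \<comment> \<open>The two sides of \<open>x\<close> are treated separately: for odd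
      \<open>k\<close> the derivative changes sign at \<open>x\<close>, and growth fails for pairs
      straddling it.\<close>
    have right: "Q x q" if "q < x + \<eta>" for q
    proof (rule local_growth[OF c'])
      fix z1 z2 assume z: "z1 \<in> {x..q} \<inter> {a..b}" "z2 \<in> {x..q} \<inter> {a..b}" "z1 \<le> z2"
      have "c / Suc k * (z2 - z1) ^ Suc k \<le> sgn u * f z2 - sgn u * f z1"
      proof (rule derivative_power_growth[where f' = "\<lambda>z. sgn u * f' z" and ?x0.0 = x])
        fix w assume w: "w \<in> {z1..z2}"
        show "((\<lambda>z. sgn u * f z) has_real_derivative sgn u * f' w) (at w within {z1..z2})"
          using z w by (intro DERIV_cmult der') auto
        have "w \<in> {a..b}" "\<bar>w - x\<bar> < \<eta>" "x \<le> w" using z w that by auto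
        then obtain v where v: "f' w = (w - x) ^ k * v" "\<bar>v - u\<bar> \<le> \<bar>u\<bar> / 2" using ku by blast
        have "(w - x) ^ k * c \<le> (w - x) ^ k * (sgn u * v)"
          unfolding c_def using leading_term_nonzero(1)[OF u v(2)] \<open>x \<le> w\<close> by (intro mult_left_mono) auto
        then show "c * (w - x) ^ k \<le> sgn u * f' w" by (simp add: v(1) mult_ac)
      qed (use z c in auto)
      also have "\<dots> = sgn u * (f z2 - f z1)" by (simp add: algebra_simps)
      also have "\<dots> \<le> \<bar>f z2 - f z1\<bar>" using u by (auto simp: sgn_if)
      finally show "c / Suc k * (z2 - z1) ^ Suc k \<le> \<bar>f z2 - f z1\<bar>" .
    qed
    have left: "Q p x" if "x - \<eta> < p" for p
    proof (rule local_growth[OF c'])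
      fix z1 z2 assume z: "z1 \<in> {p..x} \<inter> {a..b}" "z2 \<in> {p..x} \<inter> {a..b}" "z1 \<le> z2"
      \<comment> \<open>To the left of \<open>x\<close> the power \<open>(w - x) ^ k\<close> carries
        the sign \<open>(- 1) ^ k\<close>; the factor \<open>\<sigma>\<close> makes
        \<open>- (\<sigma> * f' w)\<close> nonnegative.\<close>
      define \<sigma> where "\<sigma> = - sgn u * (- 1) ^ k"
      have \<sigma>: "\<bar>\<sigma>\<bar> = 1" using u by (simp add: \<sigma>_def abs_mult power_abs)
      have "c / Suc k * (z2 - z1) ^ Suc k \<le> \<sigma> * f z1 - \<sigma> * f z2"
      proof (rule derivative_power_growth_left[where f' = "\<lambda>z. \<sigma> * f' z" and ?x0.0 = x])
        fix w assume w: "w \<in> {z1..z2}"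
        show "((\<lambda>z. \<sigma> * f z) has_real_derivative \<sigma> * f' w) (at w within {z1..z2})"
          using z w by (intro DERIV_cmult der') auto
        have "w \<in> {a..b}" "\<bar>w - x\<bar> < \<eta>" "w \<le> x" using z w that by auto
        then obtain v where v: "f' w = (w - x) ^ k * v" "\<bar>v - u\<bar> \<le> \<bar>u\<bar> / 2" using ku by blast
        have "(x - w) ^ k * c \<le> (x - w) ^ k * (sgn u * v)"
          unfolding c_def using leading_term_nonzero(1)[OF u v(2)] \<open>w \<le> x\<close> by (intro mult_left_mono) auto
        also have "(x - w) ^ k = (- 1) ^ k * (w - x) ^ k" by (simp flip: power_mult_distrib)
        finally show "c * (x - w) ^ k \<le> - (\<sigma> * f' w)"
          by (simp add: v(1) \<sigma>_def mult_ac flip: power_mult_distrib)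
      qed (use z c in auto)
      also have "\<dots> = \<sigma> * (f z1 - f z2)" by (simp add: algebra_simps)
      also have "\<dots> \<le> \<bar>\<sigma> * (f z1 - f z2)\<bar>" by simp
      also have "\<dots> = \<bar>f z2 - f z1\<bar>" by (simp add: abs_mult \<sigma> abs_minus_commute)
      finally show "c / Suc k * (z2 - z1) ^ Suc k \<le> \<bar>f z2 - f z1\<bar>" .
    qed
    show "\<exists>d>0. \<forall>p q. p \<le> x \<and> x \<le> q \<and> q - p < d \<longrightarrow> Q p q"
    proof (intro exI[of _ \<eta>] conjI allI impI)
      fix p q assume "p \<le> x \<and> x \<le> q \<and> q - p < \<eta>"
      then show "Q p q" using left[of p] right[of q] trans[of p x q] by auto
    qed (rule \<eta>(1))
  qed
  then obtain C \<kappa> where C: "C > 0" "\<kappa> > 0"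
    "\<And>u h. 0 < h \<Longrightarrow> h \<le> 1 \<Longrightarrow> measure \<mu> (L a b u h) \<le> C * h powr \<kappa>" unfolding Q_def by blast
  have "measure \<mu> (L a b u h) \<le> max C 1 * h powr \<kappa>" if "0 < h" for u h
  proof (cases "h \<le> 1")
    case True
    have "C * h powr \<kappa> \<le> max C 1 * h powr \<kappa>" by (intro mult_right_mono) auto
    then show ?thesis using C(3)[OF that True, of u] by linarith
  next
    case False
    have "1 * 1 \<le> max C 1 * h powr \<kappa>" using False C by (intro mult_mono ge_one_powr_ge_zero) auto
    then show ?thesis using prob_le_1[of "L a b u h"] by linarith
  qed
  then show ?thesis using C(2) by (intro exI[of _ "max C 1"] conjI exI[of _ \<kappa>]) (auto simp: L_def)
qed

section \<open>Recursion and cancellation for the characteristic function\<close>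

lemma cmod_char_le_1: "cmod (char \<mu> x) \<le> 1"
proof -
  have "cmod (char \<mu> x) \<le> (\<integral>y. cmod (iexp (x * y)) \<partial>\<mu>)" unfolding char_def by (rule integral_norm_bound)
  then show ?thesis using prob_space by simp
qed

lemma char_self_similar:
  "char \<mu> \<xi> = (\<Sum>i\<in>set_pmf P. pmf P i *\<^sub>R (iexp (\<xi> * t i) * char \<mu> (r i * \<xi>)))"
proof -
  have "(\<integral>x. iexp (\<xi> * (r i * x + t i)) \<partial>\<mu>) = iexp (\<xi> * t i) * char \<mu> (r i * \<xi>)" for i
  proof -
    have "(\<integral>x. iexp (\<xi> * (r i * x + t i)) \<partial>\<mu>) = (\<integral>x. iexp (\<xi> * t i) * iexp (r i * \<xi> * x) \<partial>\<mu>)"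
      by (simp add: algebra_simps flip: exp_add)
    then show ?thesis by (simp add: char_def)
  qed
  moreover have "char \<mu> \<xi> = (\<Sum>i\<in>set_pmf P. pmf P i *\<^sub>R (\<integral>x. iexp (\<xi> * (r i * x + t i)) \<partial>\<mu>))"
    unfolding char_def by (rule integral_self_similar[where B = 1]) auto
  ultimately show ?thesis by simp
qed

lemma char_self_similar2:
  "char \<mu> \<xi> = (\<Sum>(i,j)\<in>set_pmf P \<times> set_pmf P.
     (pmf P i * pmf P j) *\<^sub>R (iexp (\<xi> * (r i * t j + t i)) * char \<mu> (r i * r j * \<xi>)))"
proof -
  have "pmf P i *\<^sub>R (iexp (\<xi> * t i) * char \<mu> (r i * \<xi>)) = (\<Sum>j\<in>set_pmf P.
     (pmf P i * pmf P j) *\<^sub>R (iexp (\<xi> * (r i * t j + t i)) * char \<mu> (r i * r j * \<xi>)))" for i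
    unfolding char_self_similar[of "r i * \<xi>"] sum_distrib_left scaleR_sum_right
    by (intro sum.cong) (simp_all add: algebra_simps exp_add)
  then show ?thesis unfolding char_self_similar[of \<xi>] sum.cartesian_product[symmetric] by simp
qed

lemma cmod_iexp_add: "cmod (iexp x + iexp y) = 2 * \<bar>cos ((x - y) / 2)\<bar>"
proof -
  have "iexp x + iexp y = iexp ((x + y) / 2) * (iexp ((x - y) / 2) + iexp (- ((x - y) / 2)))"
    by (simp add: algebra_simps field_simps flip: exp_add)
  also have "iexp w + iexp (- w) = of_real (2 * cos w)" for w :: real
    by (simp add: complex_eq_iff Re_exp Im_exp)
  finally show ?thesis by (simp only: norm_mult norm_of_real) simp
qed

lemma abs_cos_pi_le:
  fixes x \<theta> :: real
  assumes "0 < \<theta>" "\<And>j::int. \<theta> \<le> \<bar>x - real_of_int j\<bar>"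
  shows "\<bar>cos (pi * x)\<bar> \<le> cos (pi * \<theta>)" "\<theta> \<le> 1/2"
proof -
  define y where "y = x - real_of_int (round x)"
  have y: "\<bar>y\<bar> \<le> 1/2" using of_int_round_abs_le[of x] by (simp add: y_def abs_minus_commute)
  have \<theta>: "\<theta> \<le> \<bar>y\<bar>" using assms(2) by (simp add: y_def)
  then show "\<theta> \<le> 1/2" using y by linarith
  have "pi * x = pi * y + pi * real_of_int (round x)" by (simp add: y_def algebra_simps)
  then have "\<bar>cos (pi * x)\<bar> = \<bar>cos (pi * y)\<bar>"
    by (simp add: cos_add cos_npi_int sin_npi_int abs_mult mult.commute)
  also have "\<bar>cos (pi * y)\<bar> = cos (pi * \<bar>y\<bar>)"
  proof -
    have "cos (pi * y) = cos (pi * \<bar>y\<bar>)" by (cases "y \<ge> 0") auto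
    moreover have "0 \<le> pi * \<bar>y\<bar>" "pi * \<bar>y\<bar> \<le> pi / 2"
      using mult_left_mono[OF y, of pi] by auto
    then have "0 \<le> cos (pi * \<bar>y\<bar>)" using pi_gt_zero by (intro cos_ge_zero) linarith+
    ultimately show ?thesis by simp
  qed
  also have "\<dots> \<le> cos (pi * \<theta>)"
    using assms(1) \<theta> y by (intro cos_monotone_0_pi_le) auto
  finally show "\<bar>cos (pi * x)\<bar> \<le> cos (pi * \<theta>)" .
qed

text \<open>The compositions of the \<open>i\<close>-th and \<open>j\<close>-th maps in either order have the same ratio and
  translations differing by some \<open>D \<noteq> 0\<close>, so the two terms they contribute to
  the characteristic function cancel partially unless \<open>D \<xi> / (2 \<pi>)\<close> is close to an integer.\<close>

lemma char_power_sum: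
  assumes "0 < \<epsilon>"
  shows "\<exists>c0. \<exists>m>0. \<exists>C>0. \<exists>V::int \<Rightarrow> real. c0 \<noteq> (0::real) \<and> (\<forall>j. 0 \<le> V j) \<and>
    (\<forall>\<xi>. cmod (char \<mu> \<xi>) ^ m \<le> V (round (c0 * \<xi>))) \<and>
    (\<forall>T\<ge>1. (\<Sum>j | \<bar>real_of_int j\<bar> \<le> T. V j) \<le> C * T powr \<epsilon>)"
proof -
  obtain i j where i: "i \<in> set_pmf P" and j: "j \<in> set_pmf P" and ij: "t i * (1 - r j) \<noteq> t j * (1 - r i)"
    using distinct by blast
  define D where "D = (r i * t j + t i) - (r j * t i + t j)"
  have D: "D \<noteq> 0" using ij by (simp add: D_def algebra_simps)
  then have "i \<noteq> j" by (auto simp: D_def)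
  define K where "K = set_pmf P \<times> set_pmf P"
  define q where "q = (\<lambda>(k,l). pmf P k * pmf P l)"
  define s where "s = (\<lambda>(k,l). r k * r l)"
  \<comment> \<open>In units of \<open>2 * pi / D\<close> the phases of the two compositions differ
    by \<open>2 * pi * x\<close>, so there is no cancellation exactly when \<open>x\<close> is an
    integer.\<close>
  define F where "F x = cmod (char \<mu> (2 * pi / D * x))" for x
  have finK: "finite K" using finite_index by (simp add: K_def)
  have q0: "0 \<le> q k" for k by (auto simp: q_def split: prod.split)
  have q1: "(\<Sum>k\<in>K. q k) = 1"
    unfolding K_def q_def sum.cartesian_product[symmetric]
    by (simp add: sum_pmf_1 flip: sum_distrib_left)
  have s0: "s k \<noteq> 0" "\<bar>s k\<bar> < 1" if "k \<in> K" for k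
  proof -
    obtain k1 k2 where k: "k = (k1, k2)" by force
    show "s k \<noteq> 0" using that ratio_nonzero by (auto simp: K_def s_def k)
    have "\<bar>r k1\<bar> * \<bar>r k2\<bar> < 1 * 1"
      using that ratio_less_1 by (intro mult_strict_mono') (auto simp: K_def k)
    then show "\<bar>s k\<bar> < 1" by (simp add: s_def k abs_mult)
  qed
  define p where "p = pmf P i * pmf P j"
  have p: "0 < p" using i j by (simp add: p_def pmf_positive)
  have ijK: "(i,j) \<in> K" "(j,i) \<in> K - {(i,j)}" using i j \<open>i \<noteq> j\<close> by (auto simp: K_def)
  have split_sum: "(\<Sum>k\<in>K. h k) = (h (i,j) + h (j,i)) + (\<Sum>k\<in>K - {(i,j)} - {(j,i)}. h k)"
    for h :: "_ \<Rightarrow> 'z::comm_monoid_add"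
    unfolding sum.remove[OF finK ijK(1)] sum.remove[OF finite_Diff[OF finK] ijK(2)]
    by (simp add: add.assoc)
  have two_p: "2 * p \<le> 1"
  proof -
    have "0 \<le> (\<Sum>k\<in>K - {(i,j)} - {(j,i)}. q k)" using q0 by (intro sum_nonneg)
    then show ?thesis using split_sum[of q] q1 by (simp add: q_def p_def mult.commute)
  qed
  define G where "G x = (\<lambda>(k,l). iexp (2 * pi / D * x * (r k * t l + t k)) * char \<mu> (2 * pi / D * (s (k,l) * x)))" for x
  have Feq: "F x = cmod (\<Sum>k\<in>K. q k *\<^sub>R G x k)" for x
    unfolding F_def K_def q_def G_def s_def char_self_similar2[of "2 * pi / D * x"]
    by (intro arg_cong[of _ _ cmod] sum.cong) (auto simp: mult_ac)
  have Gn: "cmod (G x k) = F (s k * x)" for x k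
    by (auto simp: G_def F_def norm_mult split: prod.split)
  have rec: "F x \<le> (\<Sum>k\<in>K. q k * F (s k * x))" for x
    unfolding Feq[of x] by (rule order_trans[OF norm_sum]) (simp add: Gn q0)
  \<comment> \<open>The pairs \<open>(i,j)\<close> and \<open>(j,i)\<close> have the same weight
    \<open>p\<close> and evaluate the transform at the same frequency; only their phases differ, and
    adding these gives the cosine.\<close>
  have pair: "F x \<le> 2 * p * \<bar>cos (pi * x)\<bar> * F (s (i,j) * x) + (\<Sum>k\<in>K - {(i,j)} - {(j,i)}. q k * F (s k * x))" for x
  proof -
    have "F x \<le> cmod (q (i,j) *\<^sub>R G x (i,j) + q (j,i) *\<^sub>R G x (j,i))
        + cmod (\<Sum>k\<in>K - {(i,j)} - {(j,i)}. q k *\<^sub>R G x k)"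
      unfolding Feq[of x] split_sum by (rule norm_triangle_ineq)
    also have "q (i,j) *\<^sub>R G x (i,j) + q (j,i) *\<^sub>R G x (j,i)
        = p *\<^sub>R ((iexp (2 * pi / D * x * (r i * t j + t i)) + iexp (2 * pi / D * x * (r j * t i + t j)))
            * char \<mu> (2 * pi / D * (s (i,j) * x)))"
      by (simp add: q_def p_def G_def s_def algebra_simps)
    also have "cmod \<dots> = p * (2 * \<bar>cos ((2 * pi / D * x * (r i * t j + t i) - 2 * pi / D * x * (r j * t i + t j)) / 2)\<bar> * F (s (i,j) * x))"
      using p by (simp only: norm_mult norm_scaleR cmod_iexp_add F_def abs_of_pos)
    also have "(2 * pi / D * x * (r i * t j + t i) - 2 * pi / D * x * (r j * t i + t j)) / 2 = pi * x"
    proof -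
      have "2 * pi / D * x * (r i * t j + t i) - 2 * pi / D * x * (r j * t i + t j) = 2 * pi / D * x * D"
        by (simp add: D_def right_diff_distrib)
      then show ?thesis using D by simp
    qed
    also have "cmod (\<Sum>k\<in>K - {(i,j)} - {(j,i)}. q k *\<^sub>R G x k) \<le> (\<Sum>k\<in>K - {(i,j)} - {(j,i)}. q k * F (s k * x))"
      by (rule order_trans[OF norm_sum]) (simp add: Gn q0)
    finally show ?thesis by (simp add: mult_ac)
  qed
  have gain: "\<exists>\<beta>\<ge>0. \<beta> < 1 \<and> (\<forall>x. (\<forall>j::int. \<theta> \<le> \<bar>x - real_of_int j\<bar>) \<longrightarrow> (\<exists>k\<in>K. F x \<le> \<beta> * F (s k * x)))"
    if "0 < \<theta>" for \<theta>
  proof (cases "\<theta> \<le> 1/2")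
    case True
    define \<kappa> where "\<kappa> = cos (pi * \<theta>)"
    have \<theta>: "0 < pi * \<theta>" "pi * \<theta> \<le> pi / 2"
      using that True mult_left_mono[OF True, of pi] by auto
    then have "\<kappa> < cos 0" unfolding \<kappa>_def using pi_gt_zero by (intro cos_monotone_0_pi) linarith+
    moreover have "0 \<le> \<kappa>" unfolding \<kappa>_def using \<theta> pi_gt_zero by (intro cos_ge_zero) linarith+
    ultimately have \<kappa>: "0 \<le> \<kappa>" "\<kappa> < 1" by auto
    \<comment> \<open>Of the total weight 1, the share \<open>2 * p\<close> of the cancelling pair
      is damped by \<kappa>. Bounding all terms by the largest value \<open>M\<close> leaves the
      factor \<open>1 - 2 * p + 2 * p * \<kappa>\<close>, and the index attaining \<open>M\<close>
      is the required one.\<close>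
    define \<beta> where "\<beta> = 1 - 2 * p * (1 - \<kappa>)"
    have "2 * p * (1 - \<kappa>) \<le> 1 * 1" using two_p \<kappa> p by (intro mult_mono) auto
    moreover have "0 < 2 * p * (1 - \<kappa>)" using p \<kappa> by simp
    ultimately have \<beta>: "0 \<le> \<beta>" "\<beta> < 1" by (auto simp: \<beta>_def)
    have "\<exists>k\<in>K. F x \<le> \<beta> * F (s k * x)" if x: "\<forall>j::int. \<theta> \<le> \<bar>x - real_of_int j\<bar>" for x
    proof -
      define M where "M = Max ((\<lambda>k. F (s k * x)) ` K)"
      have "M \<in> (\<lambda>k. F (s k * x)) ` K" unfolding M_def using finK ijK by (intro Max_in) auto
      then obtain k where k: "k \<in> K" "M = F (s k * x)" by auto
      have M: "F (s k * x) \<le> M" if "k \<in> K" for k unfolding M_def using that finK by auto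
      have F0: "0 \<le> F y" for y by (simp add: F_def)
      have "F x \<le> 2 * p * \<bar>cos (pi * x)\<bar> * F (s (i,j) * x) + (\<Sum>k\<in>K - {(i,j)} - {(j,i)}. q k * F (s k * x))"
        by (rule pair)
      also have "\<dots> \<le> 2 * p * \<kappa> * M + (\<Sum>k\<in>K - {(i,j)} - {(j,i)}. q k * M)"
        using abs_cos_pi_le(1)[OF \<open>0 < \<theta>\<close>, of x] x p M ijK F0 q0
        by (intro add_mono mult_mono sum_mono) (auto simp: \<kappa>_def)
      also have "(\<Sum>k\<in>K - {(i,j)} - {(j,i)}. q k * M) = (1 - 2 * p) * M"
      proof -
        have "(\<Sum>k\<in>K - {(i,j)} - {(j,i)}. q k) = 1 - (q (i,j) + q (j,i))"
          using split_sum[of q] q1 by simp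
        also have "q (i,j) + q (j,i) = 2 * p" by (simp add: q_def p_def)
        finally show ?thesis by (simp flip: sum_distrib_right)
      qed
      also have "2 * p * \<kappa> * M + (1 - 2 * p) * M = \<beta> * M" by (simp add: \<beta>_def algebra_simps)
      finally show ?thesis using k by blast
    qed
    then show ?thesis using \<beta> by blast
  next
    case False
    \<comment> \<open>No real number is further than 1/2 from all integers, so the claim is vacuous
      here.\<close>
    have "\<not> (\<forall>j::int. \<theta> \<le> \<bar>x - real_of_int j\<bar>)" for x
      using abs_cos_pi_le(2)[OF that, of x] False by auto
    then show ?thesis by (intro exI[of _ 0]) auto
  qed
  have "\<exists>(m::nat)>0. \<exists>C>0. \<exists>V::int \<Rightarrow> real. (\<forall>j. 0 \<le> V j) \<and> (\<forall>x. F x ^ m \<le> V (round x)) \<and>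
    (\<forall>T\<ge>1. (\<Sum>j | \<bar>real_of_int j\<bar> \<le> T. V j) \<le> C * T powr \<epsilon>)"
    by (rule multiplicative_recursion_power_sum[OF finK q0 q1 s0 _ _ rec gain \<open>0 < \<epsilon>\<close>])
       (auto simp: F_def cmod_char_le_1)
  then obtain m :: nat and C V where m: "m > 0" "C > 0" "\<And>j::int. 0 \<le> V j" "\<And>x. F x ^ m \<le> V (round x)"
    "\<And>T. T \<ge> 1 \<Longrightarrow> (\<Sum>j | \<bar>real_of_int j\<bar> \<le> T. V j) \<le> C * T powr \<epsilon>" by blast
  have "cmod (char \<mu> \<xi>) ^ m \<le> V (round (D / (2 * pi) * \<xi>))" for \<xi>
    using m(4)[of "D / (2 * pi) * \<xi>"] D by (simp add: F_def)
  then show ?thesis using m D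
    by (intro exI[of _ "D / (2 * pi)"] exI[of _ m] conjI exI[of _ C] exI[of _ V]) auto
qed

end

section \<open>Stopped compositions\<close>

text \<open>About \<open>2 * ln x / L\<close> steps suffice, and powers of a logarithm are below
  every power of \<open>x\<close>; \<open>d = e / (n + 1)\<close> leaves room for the
  \<open>n\<close>-th power. This provides a depth at which every ratio has passed the threshold
  although few ratios can occur.\<close>

lemma log_power_le_powr:
  assumes \<rho>: "0 < \<rho>" "\<rho> < 1" and "0 < e"
  shows "\<exists>C>0. \<forall>x\<ge>1. \<exists>m. \<rho> ^ m < x powr (- 2) \<and> real (Suc m) ^ n \<le> C * x powr e"
proof -
  define d where "d = e / (n + 1)"
  have d: "d > 0" using \<open>0 < e\<close> by (simp add: d_def)
  define L where "L = - ln \<rho>"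
  have L: "L > 0" using \<rho> by (simp add: L_def)
  define A where "A = 2 / (L * d) + 3"
  have A: "A \<ge> 1" using L d by (simp add: A_def)
  have "\<exists>m. \<rho> ^ m < x powr (- 2) \<and> real (Suc m) ^ n \<le> A ^ n * x powr e" if x: "x \<ge> 1" for x
  proof -
    define m where "m = nat \<lfloor>2 * ln x / L\<rfloor> + 1"
    have ln0: "0 \<le> ln x" using x by simp
    have f0: "0 \<le> \<lfloor>2 * ln x / L\<rfloor>" using ln0 L by simp
    have m1: "2 * ln x / L < real m" "real m \<le> 2 * ln x / L + 1"
      using f0 by (auto simp: m_def; linarith)+
    have "2 * ln x < real m * L" using m1(1) L by (simp add: field_simps)
    then have "exp (- (real m * L)) < exp (- 2 * ln x)" by simp
    also have "exp (- 2 * ln x) = x powr (- 2)" using x by (simp add: powr_def)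
    also have "exp (- (real m * L)) = \<rho> ^ m"
      using \<rho> by (simp add: L_def exp_of_nat_mult)
    finally have 1: "\<rho> ^ m < x powr (- 2)" .
    have xd: "1 \<le> x powr d" using x d by (simp add: ge_one_powr_ge_zero)
    have "real (Suc m) \<le> 2 * ln x / L + 2" using m1 by simp
    also have "\<dots> \<le> 2 * (x powr d / d) / L + 2 * x powr d"
      using L xd ln_powr_bound[OF x d] by (intro add_mono divide_right_mono mult_left_mono) auto
    also have "\<dots> \<le> A * x powr d" using xd by (simp add: A_def algebra_simps)
    finally have "real (Suc m) ^ n \<le> (A * x powr d) ^ n" by (intro power_mono) auto
    also have "\<dots> = A ^ n * x powr (d * n)"
      using x by (simp add: power_mult_distrib powr_powr flip: powr_realpow)
    also have "\<dots> \<le> A ^ n * x powr e"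
      using x A \<open>0 < e\<close> by (intro mult_left_mono powr_mono) (auto simp: d_def field_simps)
    finally show ?thesis using 1 by blast
  qed
  then show ?thesis using A by (intro exI[of _ "A ^ n"]) auto
qed

context self_similar
begin

text \<open>A pair \<open>(c, d)\<close> stands for the map \<open>x \<mapsto> c x + d\<close>: compose with randomly chosen maps of the
  IFS until the ratio drops below \<open>\<rho>\<close>, but at most \<open>m\<close> times.\<close>

primrec stopped :: "real \<Rightarrow> nat \<Rightarrow> real \<times> real \<Rightarrow> (real \<times> real) pmf" where
  "stopped \<rho> 0 w = return_pmf w"
| "stopped \<rho> (Suc m) w = (if \<bar>fst w\<bar> < \<rho> then return_pmf w
     else P \<bind> (\<lambda>i. stopped \<rho> m (fst w * r i, fst w * t i + snd w)))"

lemma finite_stopped: "finite (set_pmf (stopped \<rho> m w))"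
  by (induction m arbitrary: w) (auto simp: finite_index)

text \<open>Each step either leaves a map alone or expands it by self-similarity applied to
  \<open>\<phi>\<close> composed with that map, so the mean is the same at every depth and
  threshold.\<close>

lemma integral_stopped:
  fixes \<phi> :: "real \<Rightarrow> complex"
  assumes [measurable]: "\<phi> \<in> borel_measurable borel" and bd: "\<And>x. cmod (\<phi> x) \<le> B"
  shows "(\<integral>x. \<phi> (fst w * x + snd w) \<partial>\<mu>) =
    measure_pmf.expectation (stopped \<rho> m w) (\<lambda>v. \<integral>x. \<phi> (fst v * x + snd v) \<partial>\<mu>)"
proof (induction m arbitrary: w)
  case (Suc m)
  show ?case
  proof (cases "\<bar>fst w\<bar> < \<rho>")
    case False
    have "(\<integral>x. \<phi> (fst w * x + snd w) \<partial>\<mu>) =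
        (\<Sum>i\<in>set_pmf P. pmf P i *\<^sub>R (\<integral>x. \<phi> (fst w * (r i * x + t i) + snd w) \<partial>\<mu>))"
      using bd by (intro integral_self_similar[where \<phi> = "\<lambda>x. \<phi> (fst w * x + snd w)" and B = B]) auto
    also have "\<dots> = (\<Sum>i\<in>set_pmf P. pmf P i *\<^sub>R measure_pmf.expectation
        (stopped \<rho> m (fst w * r i, fst w * t i + snd w)) (\<lambda>v. \<integral>x. \<phi> (fst v * x + snd v) \<partial>\<mu>))"
    proof (intro sum.cong refl arg_cong2[where f = scaleR])
      fix i
      show "(\<integral>x. \<phi> (fst w * (r i * x + t i) + snd w) \<partial>\<mu>) = measure_pmf.expectation
        (stopped \<rho> m (fst w * r i, fst w * t i + snd w)) (\<lambda>v. \<integral>x. \<phi> (fst v * x + snd v) \<partial>\<mu>)"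
        using Suc[of "(fst w * r i, fst w * t i + snd w)"] by (simp add: algebra_simps)
    qed
    also have "\<dots> = measure_pmf.expectation (stopped \<rho> (Suc m) w) (\<lambda>v. \<integral>x. \<phi> (fst v * x + snd v) \<partial>\<mu>)"
      using False finite_index by (simp add: pmf_expectation_bind[of "set_pmf P"] finite_stopped)
    finally show ?thesis .
  qed simp
qed simp

text \<open>This makes the cap on the depth harmless: once even the slowest contraction gets below
  the threshold within \<open>m\<close> steps, every branch ends with a ratio below it.\<close>

lemma stopped_ratio_less:
  assumes "\<bar>fst w\<bar> * rho_max ^ m < \<rho>" "v \<in> set_pmf (stopped \<rho> m w)"
  shows "\<bar>fst v\<bar> < \<rho>"
  using assms
proof (induction m arbitrary: w)
  case (Suc m)
  show ?case
  proof (cases "\<bar>fst w\<bar> < \<rho>")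
    case False
    then obtain i where i: "i \<in> set_pmf P" "v \<in> set_pmf (stopped \<rho> m (fst w * r i, fst w * t i + snd w))"
      using Suc.prems(2) by auto
    have "\<bar>fst w * r i\<bar> * rho_max ^ m \<le> \<bar>fst w\<bar> * rho_max * rho_max ^ m"
      unfolding abs_mult using rho_max(1) rho_max(3)[OF i(1)] by (intro mult_right_mono mult_left_mono) auto
    also have "\<dots> < \<rho>" using Suc.prems(1) by (simp add: mult_ac)
    finally show ?thesis using Suc.IH[OF _ i(2)] by simp
  qed (use Suc.prems in auto)
qed simp

text \<open>The last map is applied while the ratio is still at least \<open>\<rho>\<close> and
  scales it by at least \<open>rho_min\<close>, so stopped ratios are of the order of the
  threshold.\<close>

lemma stopped_ratio_ge:
  assumes "\<rho> * rho_min \<le> \<bar>fst w\<bar>" "v \<in> set_pmf (stopped \<rho> m w)"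
  shows "\<rho> * rho_min \<le> \<bar>fst v\<bar>"
  using assms
proof (induction m arbitrary: w)
  case (Suc m)
  show ?case
  proof (cases "\<bar>fst w\<bar> < \<rho>")
    case False
    then obtain i where i: "i \<in> set_pmf P" "v \<in> set_pmf (stopped \<rho> m (fst w * r i, fst w * t i + snd w))"
      using Suc.prems(2) by auto
    have "\<rho> * rho_min \<le> \<bar>fst w * r i\<bar>"
      unfolding abs_mult using rho_min(1) rho_min(3)[OF i(1)] False by (intro mult_mono) auto
    then show ?thesis using Suc.IH[OF _ i(2)] by simp
  qed (use Suc.prems in auto)
qed simp

lemma stopped_invariant:
  assumes "\<And>x. x \<in> {a..b} \<Longrightarrow> fst w * x + snd w \<in> {a..b}" "v \<in> set_pmf (stopped \<rho> m w)" "x \<in> {a..b}"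
  shows "fst v * x + snd v \<in> {a..b}"
  using assms(1,2)
proof (induction m arbitrary: w)
  case 0 then show ?case using assms(3) by simp
next
  case (Suc m)
  show ?case
  proof (cases "\<bar>fst w\<bar> < \<rho>")
    case True
    then show ?thesis using Suc.prems assms(3) by simp
  next
    case False
    then obtain i where i: "i \<in> set_pmf P" "v \<in> set_pmf (stopped \<rho> m (fst w * r i, fst w * t i + snd w))"
      using Suc.prems(2) by auto
    have "fst w * (r i * y + t i) + snd w \<in> {a..b}" if "y \<in> {a..b}" for y
      using Suc.prems(1)[OF invariant[OF i(1) that]] .
    then show ?thesis using Suc.IH[OF _ i(2)] by (simp add: algebra_simps)
  qed
qed

text \<open>A ratio of a composition depends only on how often each map occurs in it.\<close>

definition ratios :: "nat \<Rightarrow> real set" where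
  "ratios m = (\<lambda>k. \<Prod>i\<in>set_pmf P. r i ^ k i) ` (\<Pi>\<^sub>E i\<in>set_pmf P. {..m})"

lemma finite_ratios: "finite (ratios m)"
  unfolding ratios_def by (intro finite_imageI finite_PiE finite_index) auto

lemma card_ratios: "card (ratios m) \<le> Suc m ^ card (set_pmf P)"
proof -
  have "card (ratios m) \<le> card (\<Pi>\<^sub>E i\<in>set_pmf P. {..m})"
    unfolding ratios_def by (intro card_image_le finite_PiE finite_index) auto
  also have "\<dots> = Suc m ^ card (set_pmf P)" by (simp add: card_PiE finite_index)
  finally show ?thesis .
qed

text \<open>The vector \<open>k\<close> counts the maps applied so far; a further step raises one
  entry by 1, so the bound \<open>l\<close> on the entries grows by at most the number of remaining
  steps.\<close>

lemma stopped_ratio_mem: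
  assumes "k \<in> (\<Pi>\<^sub>E i\<in>set_pmf P. {..l})" "fst w = (\<Prod>i\<in>set_pmf P. r i ^ k i)"
    and "v \<in> set_pmf (stopped \<rho> m w)"
  shows "fst v \<in> ratios (l + m)"
  using assms
proof (induction m arbitrary: w k l)
  case 0 then show ?case by (auto simp: ratios_def)
next
  case (Suc m)
  show ?case
  proof (cases "\<bar>fst w\<bar> < \<rho>")
    case True
    then have "v = w" using Suc.prems by simp
    moreover have "k \<in> (\<Pi>\<^sub>E i\<in>set_pmf P. {..l + Suc m})"
      using Suc.prems(1) by (auto simp: PiE_iff intro: le_trans trans_le_add1)
    ultimately show ?thesis using Suc.prems(2) unfolding ratios_def by (intro image_eqI) auto
  next
    case False
    then obtain i where i: "i \<in> set_pmf P" "v \<in> set_pmf (stopped \<rho> m (fst w * r i, fst w * t i + snd w))"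
      using Suc.prems(3) by auto
    have "fst v \<in> ratios (Suc l + m)"
    proof (rule Suc.IH[OF _ _ i(2)])
      show "k(i := Suc (k i)) \<in> (\<Pi>\<^sub>E i\<in>set_pmf P. {..Suc l})"
        using Suc.prems(1) i(1) by (auto simp: PiE_iff extensional_def)
      have "(\<Prod>j\<in>set_pmf P - {i}. r j ^ (k(i := Suc (k i))) j) = (\<Prod>j\<in>set_pmf P - {i}. r j ^ k j)"
        by (intro prod.cong) auto
      then show "fst (fst w * r i, fst w * t i + snd w) = (\<Prod>j\<in>set_pmf P. r j ^ (k(i := Suc (k i))) j)"
        using i(1) finite_index by (simp add: Suc.prems(2) prod.remove mult_ac)
    qed
    then show ?thesis by simp
  qed
qed

lemma stopped_id:
  assumes v: "v \<in> set_pmf (stopped \<rho> m (1, 0))"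
  shows "rho_max ^ m < \<rho> \<Longrightarrow> \<bar>fst v\<bar> < \<rho>" "\<rho> \<le> 1 \<Longrightarrow> 0 \<le> \<rho> \<Longrightarrow> \<rho> * rho_min \<le> \<bar>fst v\<bar>"
    "x \<in> {a..b} \<Longrightarrow> fst v * x + snd v \<in> {a..b}" "fst v \<in> ratios m"
proof -
  show "rho_max ^ m < \<rho> \<Longrightarrow> \<bar>fst v\<bar> < \<rho>" using stopped_ratio_less[OF _ v] by simp
  show "\<rho> \<le> 1 \<Longrightarrow> 0 \<le> \<rho> \<Longrightarrow> \<rho> * rho_min \<le> \<bar>fst v\<bar>"
    using stopped_ratio_ge[OF _ v] rho_min(1,2) mult_mono[of \<rho> 1 rho_min 1] by simp
  show "x \<in> {a..b} \<Longrightarrow> fst v * x + snd v \<in> {a..b}" using stopped_invariant[OF _ v] by simp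
  show "fst v \<in> ratios m"
    using stopped_ratio_mem[OF _ _ v, of "restrict (\<lambda>_. 0) (set_pmf P)" 0] by simp
qed

text \<open>The mass of \<open>A\<close> is the mean, over the stopped maps, of the mass that each
  sends into \<open>A\<close>. A map in \<open>E\<close> sends all of \<open>{a..b}\<close> there
  and contributes 1. Mass bounds for \<mu> are thereby transferred to the law of the stopped
  maps.\<close>

lemma stopped_prob_le:
  assumes A: "A \<in> sets borel"
    and sub: "\<And>v x. v \<in> set_pmf (stopped \<rho> m (1, 0)) \<Longrightarrow> v \<in> E \<Longrightarrow> x \<in> {a..b} \<Longrightarrow> fst v * x + snd v \<in> A"
  shows "measure_pmf.prob (stopped \<rho> m (1, 0)) E \<le> measure \<mu> A"
proof -
  let ?W = "stopped \<rho> m (1, 0)"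
  define \<phi> :: "real \<Rightarrow> complex" where "\<phi> = (\<lambda>x. indicator A x)"
  have [measurable]: "A \<in> sets borel" by (rule A)
  have eq: "(\<integral>x. \<phi> (fst v * x + snd v) \<partial>\<mu>) = complex_of_real (measure \<mu> {x. fst v * x + snd v \<in> A})" for v
  proof -
    have "{x. fst v * x + snd v \<in> A} \<in> sets \<mu>" using affine_preimage_borel[OF A] by (simp add: sets_eq)
    moreover have "\<phi> (fst v * x + snd v) = complex_of_real (indicator {x. fst v * x + snd v \<in> A} x)" for x
      by (simp add: \<phi>_def indicator_def)
    ultimately show ?thesis by simp
  qed
  have "complex_of_real (measure \<mu> A) = (\<integral>x. \<phi> (fst (1::real, 0::real) * x + snd (1::real, 0::real)) \<partial>\<mu>)"
    using eq[of "(1, 0)"] by simp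
  also have "\<dots> = measure_pmf.expectation ?W (\<lambda>v. \<integral>x. \<phi> (fst v * x + snd v) \<partial>\<mu>)"
    by (rule integral_stopped[where B = 1]) (auto simp: \<phi>_def indicator_def)
  also have "\<dots> = complex_of_real (measure_pmf.expectation ?W (\<lambda>v. measure \<mu> {x. fst v * x + snd v \<in> A}))"
    unfolding eq by simp
  finally have mu: "measure \<mu> A = measure_pmf.expectation ?W (\<lambda>v. measure \<mu> {x. fst v * x + snd v \<in> A})"
    by (simp only: of_real_eq_iff)
  have "measure_pmf.prob ?W E = measure_pmf.expectation ?W (indicator E)" by simp
  also have "\<dots> \<le> measure_pmf.expectation ?W (\<lambda>v. measure \<mu> {x. fst v * x + snd v \<in> A})"
  proof (rule integral_mono_AE)
    show "AE v in measure_pmf ?W. indicator E v \<le> measure \<mu> {x. fst v * x + snd v \<in> A}"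
    proof (rule AE_pmfI)
      fix v assume v: "v \<in> set_pmf ?W"
      show "indicator E v \<le> measure \<mu> {x. fst v * x + snd v \<in> A}"
      proof (cases "v \<in> E")
        case True
        have "measure \<mu> {a..b} \<le> measure \<mu> {x. fst v * x + snd v \<in> A}"
          using sub[OF v True] affine_preimage_borel[OF A]
          by (intro finite_measure_mono) (auto simp: sets_eq)
        then show ?thesis using True full by simp
      qed simp
    qed
  qed (intro integrable_measure_pmf_finite finite_stopped)+
  finally show ?thesis using mu by simp
qed

end

section \<open>Oscillatory integrals\<close>

lemma cmod_iexp_diff_le: "cmod (iexp x - iexp y) \<le> \<bar>x - y\<bar>"
proof -
  have "iexp x - iexp y = iexp y * (iexp (x - y) - 1)"
    by (simp add: algebra_simps flip: exp_add)
  then have "cmod (iexp x - iexp y) = cmod (iexp (x - y) - 1)" by (simp add: norm_mult)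
  also have "\<dots> \<le> \<bar>x - y\<bar>" using iexp_approx1[of "x - y" 0] by simp
  finally show ?thesis .
qed

lemma expectation_power_le:
  fixes f :: "'a \<Rightarrow> real"
  assumes fin: "finite (set_pmf W)" and f: "\<And>v. 0 \<le> f v"
  shows "measure_pmf.expectation W f ^ m \<le> measure_pmf.expectation W (\<lambda>v. f v ^ m)"
proof -
  have "measure_pmf.expectation W h = (\<Sum>v\<in>set_pmf W. pmf W v *\<^sub>R h v)" for h :: "'a \<Rightarrow> real"
    using fin by (intro integral_measure_pmf) auto
  moreover have "(\<Sum>v\<in>set_pmf W. pmf W v *\<^sub>R f v) ^ m \<le> (\<Sum>v\<in>set_pmf W. pmf W v * f v ^ m)"
    using fin f by (intro convex_on_sum[where C = "{0..}" and f = "\<lambda>x. x ^ m"] convex_on_power)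
      (auto simp: set_pmf_not_empty sum_pmf_eq_1)
  ultimately show ?thesis by simp
qed

context self_similar
begin

text \<open>The image of \<open>{a..b}\<close> has length \<open>\<bar>c\<bar> * (b - a)\<close>, so
  the tangent of \<open>g\<close> at the image of \<open>a\<close> has error at most
  \<open>M * c\<^sup>2 * (b - a)\<^sup>2\<close> on it. With the tangent in place of
  \<open>g\<close>, the integral is a value of \<open>char \<mu>\<close> times a unimodular
  constant.\<close>

lemma integral_linearized:
  fixes g g1 :: "real \<Rightarrow> real"
  assumes cont: "continuous_on {a..b} g"
    and taylor: "\<And>x y. x \<in> {a..b} \<Longrightarrow> y \<in> {a..b} \<Longrightarrow> \<bar>g y - g x - g1 x * (y - x)\<bar> \<le> M * (y - x)\<^sup>2"
    and inv: "\<And>x. x \<in> {a..b} \<Longrightarrow> c * x + d \<in> {a..b}" and "0 \<le> M"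
  shows "cmod (\<integral>x. indicator {a..b} (c * x + d) *\<^sub>R iexp (l * g (c * x + d)) \<partial>\<mu>)
    \<le> cmod (char \<mu> (l * c * g1 (c * a + d))) + \<bar>l\<bar> * M * c\<^sup>2 * (b - a)\<^sup>2"
proof -
  \<comment> \<open>\<open>g\<close> is controlled on \<open>{a..b}\<close> only. The cut-off makes
    the integrand Borel on the whole line and, as the affine map preserves \<open>{a..b}\<close>,
    changes it on a null set at most.\<close>
  define \<phi> where "\<phi> x = indicator {a..b} x *\<^sub>R iexp (l * g x)" for x
  define y where "y = c * a + d"
  define \<psi> where "\<psi> x = iexp (l * (g y + g1 y * (c * (x - a))))" for x
  have [measurable]: "\<phi> \<in> borel_measurable borel"
    unfolding \<phi>_def by (intro borel_measurable_continuous_on_indicator) (auto intro!: continuous_intros cont)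
  have [measurable]: "\<psi> \<in> borel_measurable borel" unfolding \<psi>_def by measurable
  have "cmod (\<phi> x) \<le> 1" for x by (simp add: \<phi>_def indicator_def)
  then have \<phi>: "integrable \<mu> (\<lambda>x. \<phi> (c * x + d))"
    by (intro integrable_bounded_borel[of \<phi> 1]) auto
  have "cmod (\<psi> x) \<le> 1" for x by (simp add: \<psi>_def)
  then have \<psi>: "integrable \<mu> \<psi>"
    using integrable_bounded_borel[of \<psi> 1 1 0] by simp
  have y: "y \<in> {a..b}" unfolding y_def using inv a_less_b by simp
  have "(\<integral>x. \<psi> x \<partial>\<mu>) = (\<integral>x. iexp (l * (g y - g1 y * c * a)) * iexp (l * c * g1 y * x) \<partial>\<mu>)"
    unfolding \<psi>_def by (simp add: algebra_simps flip: exp_add)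
  also have "\<dots> = iexp (l * (g y - g1 y * c * a)) * char \<mu> (l * c * g1 y)"
    unfolding char_def by simp
  finally have \<psi>_char: "cmod (\<integral>x. \<psi> x \<partial>\<mu>) = cmod (char \<mu> (l * c * g1 y))"
    by (simp add: norm_mult)
  have "cmod ((\<integral>x. \<phi> (c * x + d) \<partial>\<mu>) - (\<integral>x. \<psi> x \<partial>\<mu>)) = cmod (\<integral>x. \<phi> (c * x + d) - \<psi> x \<partial>\<mu>)"
    using \<phi> \<psi> by simp
  also have "\<dots> \<le> (\<integral>x. cmod (\<phi> (c * x + d) - \<psi> x) \<partial>\<mu>)" by (rule integral_norm_bound)
  also have "\<dots> \<le> \<bar>l\<bar> * M * c\<^sup>2 * (b - a)\<^sup>2"
  proof (rule integral_le_const)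
    show "integrable \<mu> (\<lambda>x. cmod (\<phi> (c * x + d) - \<psi> x))" using \<phi> \<psi> by simp
    show "AE x in \<mu>. cmod (\<phi> (c * x + d) - \<psi> x) \<le> \<bar>l\<bar> * M * c\<^sup>2 * (b - a)\<^sup>2"
      using AE_in_interval
    proof eventually_elim
      fix x assume x: "x \<in> {a..b}"
      have "cmod (\<phi> (c * x + d) - \<psi> x) = cmod (iexp (l * g (c * x + d)) - \<psi> x)"
        unfolding \<phi>_def using inv[OF x] by simp
      also have "\<dots> \<le> \<bar>l * g (c * x + d) - l * (g y + g1 y * (c * (x - a)))\<bar>"
        unfolding \<psi>_def by (rule cmod_iexp_diff_le)
      also have "l * g (c * x + d) - l * (g y + g1 y * (c * (x - a)))
          = l * (g (c * x + d) - g y - g1 y * ((c * x + d) - y))"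
        by (simp add: y_def algebra_simps)
      also have "\<bar>\<dots>\<bar> \<le> \<bar>l\<bar> * (M * ((c * x + d) - y)\<^sup>2)"
        unfolding abs_mult using taylor[OF y inv[OF x]] by (intro mult_left_mono) auto
      also have "(c * x + d) - y = c * (x - a)" by (simp add: y_def algebra_simps)
      also have "\<bar>l\<bar> * (M * (c * (x - a))\<^sup>2) = \<bar>l\<bar> * M * c\<^sup>2 * (x - a)\<^sup>2" by (simp add: power_mult_distrib)
      also have "\<dots> \<le> \<bar>l\<bar> * M * c\<^sup>2 * (b - a)\<^sup>2"
        using x \<open>0 \<le> M\<close> by (intro mult_left_mono power_mono) auto
      finally show "cmod (\<phi> (c * x + d) - \<psi> x) \<le> \<bar>l\<bar> * M * c\<^sup>2 * (b - a)\<^sup>2" .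
    qed
  qed
  finally have "cmod ((\<integral>x. \<phi> (c * x + d) \<partial>\<mu>) - (\<integral>x. \<psi> x \<partial>\<mu>)) \<le> \<bar>l\<bar> * M * c\<^sup>2 * (b - a)\<^sup>2" .
  then have "cmod (\<integral>x. \<phi> (c * x + d) \<partial>\<mu>) \<le> cmod (\<integral>x. \<psi> x \<partial>\<mu>) + \<bar>l\<bar> * M * c\<^sup>2 * (b - a)\<^sup>2"
    using norm_triangle_ineq2[of "\<integral>x. \<phi> (c * x + d) \<partial>\<mu>" "\<integral>x. \<psi> x \<partial>\<mu>"] by linarith
  then show ?thesis unfolding \<psi>_char by (simp add: \<phi>_def y_def)
qed

text \<open>For a fixed ratio \<open>q\<close>, the rounded frequency pins \<open>g1\<close> at the
  image of \<open>a\<close> near a fixed number \<open>u\<close>, and the Lipschitz bound extends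
  this to the whole image; these are the two summands of \<open>H\<close>. Hence the images lie in
  one level set. As \<open>u\<close> depends on \<open>q\<close>, the ratios are treated one by one,
  whence the factor counting them.\<close>

lemma stopped_frequency_prob:
  fixes g1 :: "real \<Rightarrow> real"
  assumes cont: "continuous_on {a..b} g1"
    and lip: "\<And>x y. x \<in> {a..b} \<Longrightarrow> y \<in> {a..b} \<Longrightarrow> \<bar>g1 x - g1 y\<bar> \<le> M * \<bar>x - y\<bar>"
    and level: "\<And>u h. 0 < h \<Longrightarrow> measure \<mu> {x\<in>{a..b}. \<bar>g1 x - u\<bar> \<le> h} \<le> C * h powr \<kappa>"
    and "0 < M" "c0 \<noteq> 0" "l \<noteq> 0" and \<rho>: "0 < \<rho>" "\<rho> \<le> 1" "rho_max ^ m < \<rho>"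
  defines "H \<equiv> 1 / (2 * \<bar>c0\<bar> * \<bar>l\<bar> * (\<rho> * rho_min)) + M * \<rho> * (b - a)"
  shows "measure_pmf.prob (stopped \<rho> m (1, 0)) {v. round (c0 * (l * fst v * g1 (fst v * a + snd v))) = j}
    \<le> Suc m ^ card (set_pmf P) * (C * H powr \<kappa>)"
proof -
  let ?W = "stopped \<rho> m (1, 0)"
  define E where "E q = {v. fst v = q \<and> round (c0 * (l * fst v * g1 (fst v * a + snd v))) = j}" for q
  have H: "0 < H" unfolding H_def using assms rho_min(1) a_less_b by (intro add_pos_pos) auto
  have CH: "0 \<le> C * H powr \<kappa>" using level[OF H] measure_nonneg order_trans by blast
  have "measure_pmf.prob ?W {v. round (c0 * (l * fst v * g1 (fst v * a + snd v))) = j}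
      \<le> measure_pmf.prob ?W (\<Union>q\<in>ratios m. E q)"
    using stopped_id(4) by (intro measure_pmf.finite_measure_mono_AE AE_pmfI) (auto simp: E_def)
  also have "\<dots> \<le> (\<Sum>q\<in>ratios m. measure_pmf.prob ?W (E q))"
    by (intro measure_pmf.finite_measure_subadditive_finite finite_ratios) auto
  also have "\<dots> \<le> (\<Sum>q\<in>ratios m. C * H powr \<kappa>)"
  proof (rule sum_mono)
    fix q
    \<comment> \<open>\<open>u\<close> solves \<open>c0 * l * q * u = j\<close>. For
      \<open>q = 0\<close> the default value of the division is harmless, since no stopped map has
      ratio 0.\<close>
    define u where "u = j / (c0 * l * q)"
    define A where "A = {x\<in>{a..b}. \<bar>g1 x - u\<bar> \<le> H}"
    have "A = {a..b} \<inter> g1 -` cball u H" by (auto simp: A_def dist_real_def abs_minus_commute)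
    then have "A \<in> sets borel"
      using continuous_closed_preimage[OF cont closed_atLeastAtMost closed_cball] by (simp add: borel_closed)
    then have "measure_pmf.prob ?W (E q) \<le> measure \<mu> A"
    proof (rule stopped_prob_le)
      fix v x assume v: "v \<in> set_pmf ?W" and vE: "v \<in> E q" and x: "x \<in> {a..b}"
      define y where "y = fst v * a + snd v"
      have q: "fst v = q" and rj: "round (c0 * (l * q * g1 y)) = j" using vE by (auto simp: E_def y_def)
      have q_bd: "\<bar>q\<bar> < \<rho>" "\<rho> * rho_min \<le> \<bar>q\<bar>" using stopped_id(1,2)[OF v] \<rho> q by auto
      have q0: "q \<noteq> 0" using q_bd(2) \<rho> rho_min(1) by (auto simp: mult_le_0_iff)
      have y: "y \<in> {a..b}" unfolding y_def using stopped_id(3)[OF v, of a] a_less_b by simp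
      have fx: "fst v * x + snd v \<in> {a..b}" using stopped_id(3)[OF v x] .
      have "\<bar>c0 * l * q\<bar> * \<bar>g1 y - u\<bar> = \<bar>c0 * (l * q * g1 y) - j\<bar>"
      proof -
        have "c0 * l * q * (g1 y - u) = c0 * (l * q * g1 y) - j"
          using q0 \<open>c0 \<noteq> 0\<close> \<open>l \<noteq> 0\<close> by (simp add: u_def right_diff_distrib)
        then show ?thesis by (simp only: abs_mult[symmetric])
      qed
      also have "\<dots> \<le> 1/2" unfolding rj[symmetric] using of_int_round_abs_le[of "c0 * (l * q * g1 y)"]
        by (simp add: abs_minus_commute)
      finally have "\<bar>g1 y - u\<bar> \<le> 1 / (2 * \<bar>c0\<bar> * \<bar>l\<bar> * \<bar>q\<bar>)"
        using q0 assms by (simp add: field_simps abs_mult)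
      also have "\<dots> \<le> 1 / (2 * \<bar>c0\<bar> * \<bar>l\<bar> * (\<rho> * rho_min))"
        using assms q0 rho_min(1) q_bd by (intro divide_left_mono mult_left_mono) auto
      finally have 1: "\<bar>g1 y - u\<bar> \<le> 1 / (2 * \<bar>c0\<bar> * \<bar>l\<bar> * (\<rho> * rho_min))" .
      have "\<bar>g1 (fst v * x + snd v) - g1 y\<bar> \<le> M * \<bar>(fst v * x + snd v) - y\<bar>" by (rule lip[OF fx y])
      also have "(fst v * x + snd v) - y = q * (x - a)" by (simp add: y_def q algebra_simps)
      also have "M * \<bar>q * (x - a)\<bar> \<le> M * (\<rho> * (b - a))"
        unfolding abs_mult using x q_bd \<rho> \<open>0 < M\<close> by (intro mult_left_mono mult_mono) auto
      finally have 2: "\<bar>g1 (fst v * x + snd v) - g1 y\<bar> \<le> M * \<rho> * (b - a)" by simp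
      have "\<bar>g1 (fst v * x + snd v) - u\<bar> \<le> H"
        using 1 2 unfolding H_def by linarith
      then show "fst v * x + snd v \<in> A" using fx by (simp add: A_def)
    qed
    also have "\<dots> \<le> C * H powr \<kappa>" unfolding A_def by (rule level[OF H])
    finally show "measure_pmf.prob ?W (E q) \<le> C * H powr \<kappa>" .
  qed
  also have "\<dots> \<le> Suc m ^ card (set_pmf P) * (C * H powr \<kappa>)"
  proof -
    have "real (card (ratios m)) \<le> real (Suc m ^ card (set_pmf P))"
      using card_ratios by (rule of_nat_mono)
    then show ?thesis using CH by (simp add: mult_right_mono del: of_nat_power of_nat_Suc)
  qed
  finally show ?thesis by simp
qed

lemma oscillatory_decay:
  fixes g g1 :: "real \<Rightarrow> real"
  assumes cont: "continuous_on {a..b} g" "continuous_on {a..b} g1"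
    and taylor: "\<And>x y. x \<in> {a..b} \<Longrightarrow> y \<in> {a..b} \<Longrightarrow> \<bar>g y - g x - g1 x * (y - x)\<bar> \<le> M * (y - x)\<^sup>2"
    and lip: "\<And>x y. x \<in> {a..b} \<Longrightarrow> y \<in> {a..b} \<Longrightarrow> \<bar>g1 x - g1 y\<bar> \<le> M * \<bar>x - y\<bar>"
    and bound: "\<And>x. x \<in> {a..b} \<Longrightarrow> \<bar>g1 x\<bar> \<le> M" and "0 < M"
    and level: "\<And>u h. 0 < h \<Longrightarrow> measure \<mu> {x\<in>{a..b}. \<bar>g1 x - u\<bar> \<le> h} \<le> C1 * h powr \<kappa>"
    and "0 < C1" "0 < \<kappa>"
  shows "\<exists>\<tau>>0. \<exists>C>0. \<forall>l. 1 \<le> \<bar>l\<bar> \<longrightarrow>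
    cmod (\<integral>x. indicator {a..b} x *\<^sub>R iexp (l * g x) \<partial>\<mu>) \<le> C * \<bar>l\<bar> powr (- \<tau>)"
proof -
  \<comment> \<open>The sum of \<open>V\<close> and the number of ratios cost
    \<open>X powr e\<close> each, the level set estimate gains \<open>X powr \<kappa>\<close>; with
    \<open>\<kappa> = 4 * e\<close> a gain of \<open>X powr (2 * e)\<close> remains.\<close>
  define e where "e = \<kappa> / 4"
  have e: "e > 0" "\<kappa> = 4 * e" using \<open>0 < \<kappa>\<close> by (auto simp: e_def)
  obtain c0 m C2 and V :: "int \<Rightarrow> real" where c0: "c0 \<noteq> (0::real)" and m: "m > (0::nat)" and C2: "C2 > 0"
    and V0: "\<And>j. 0 \<le> V j" and V: "\<And>\<xi>. cmod (char \<mu> \<xi>) ^ m \<le> V (round (c0 * \<xi>))"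
    and Vsum: "\<And>T. T \<ge> 1 \<Longrightarrow> (\<Sum>j | \<bar>real_of_int j\<bar> \<le> T. V j) \<le> C2 * T powr e"
    using char_power_sum[OF e(1)] by blast
  obtain C3 where C3: "C3 > 0" and N: "\<And>x. x \<ge> 1 \<Longrightarrow>
    \<exists>N. rho_max ^ N < x powr (- 2) \<and> real (Suc N) ^ card (set_pmf P) \<le> C3 * x powr e"
    using log_power_le_powr[OF rho_max(1,2) e(1), of "card (set_pmf P)"] by blast
  \<comment> \<open>Chosen so that \<open>H \<le> C5 / X\<close>: the first summand of
    \<open>H\<close> scales as \<open>1 / (\<bar>l\<bar> * \<rho>) = 1 / X\<close>, and in the
    second \<open>\<rho> \<le> 1 / X\<close>.\<close>
  define C5 where "C5 = 1 / (2 * \<bar>c0\<bar> * rho_min) + M * (b - a)"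
  have C5: "C5 > 0" unfolding C5_def using c0 rho_min(1) \<open>0 < M\<close> a_less_b by (intro add_pos_pos) auto
  \<comment> \<open>The scaled frequencies are bounded by \<open>\<bar>c0\<bar> * M * X\<close>; the
    \<open>+ 1\<close> absorbs the rounding, as \<open>X \<ge> 1\<close>.\<close>
  define C6 where "C6 = \<bar>c0\<bar> * M + 1"
  have C6: "C6 \<ge> 1" using \<open>0 < M\<close> by (simp add: C6_def)
  define C7 where "C7 = C2 * C6 powr e * (C3 * (C1 * C5 powr \<kappa>))"
  have C7: "C7 > 0" using C2 C3 C5 C6 \<open>0 < C1\<close> by (simp add: C7_def)
  define E0 where "E0 = M * (b - a)\<^sup>2"
  have E0: "E0 > 0" using \<open>0 < M\<close> a_less_b by (simp add: E0_def)
  \<comment> \<open>The mean of the transform decays like the \<open>m\<close>-th root of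
    \<open>X powr (- (2 * e))\<close>, the linearization error like \<open>1 / X\<close>; the slower
    rate decides.\<close>
  define \<sigma> where "\<sigma> = min (2 * e / m) 1"
  have \<sigma>: "\<sigma> > 0" using e m by (simp add: \<sigma>_def)
  define C where "C = C7 powr (1 / m) + E0"
  have "cmod (\<integral>x. indicator {a..b} x *\<^sub>R iexp (l * g x) \<partial>\<mu>) \<le> C * \<bar>l\<bar> powr (- (\<sigma> / 3))"
    if l: "1 \<le> \<bar>l\<bar>" for l
  proof -
    define X where "X = \<bar>l\<bar> powr (1 / 3)"
    have X: "X \<ge> 1" using l by (simp add: X_def ge_one_powr_ge_zero)
    have X3: "\<bar>l\<bar> = X powr 3" using l by (simp add: X_def powr_powr)
    define \<rho> where "\<rho> = X powr (- 2)"
    have "X powr (- 2) \<le> X powr 0" using X by (intro powr_mono) auto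
    then have \<rho>: "0 < \<rho>" "\<rho> \<le> 1" using X by (auto simp: \<rho>_def)
    obtain N where N1: "rho_max ^ N < \<rho>" and N2: "real (Suc N) ^ card (set_pmf P) \<le> C3 * X powr e"
      using N[OF X] by (auto simp: \<rho>_def)
    define W where "W = stopped \<rho> N (1, 0)"
    define \<xi> where "\<xi> v = l * fst v * g1 (fst v * a + snd v)" for v
    define \<phi> where "\<phi> x = indicator {a..b} x *\<^sub>R iexp (l * g x)" for x
    have int: "integrable (measure_pmf W) f" for f :: "real \<times> real \<Rightarrow> real"
      unfolding W_def by (intro integrable_measure_pmf_finite finite_stopped)
    have [measurable]: "\<phi> \<in> borel_measurable borel"
      unfolding \<phi>_def by (intro borel_measurable_continuous_on_indicator) (auto intro!: continuous_intros cont)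
    have lin: "cmod (\<integral>x. \<phi> (fst v * x + snd v) \<partial>\<mu>) \<le> cmod (char \<mu> (\<xi> v)) + E0 / X" if v: "v \<in> set_pmf W" for v
    proof -
      note v' = v[unfolded W_def]
      have "cmod (\<integral>x. \<phi> (fst v * x + snd v) \<partial>\<mu>)
          \<le> cmod (char \<mu> (\<xi> v)) + \<bar>l\<bar> * M * (fst v)\<^sup>2 * (b - a)\<^sup>2"
        unfolding \<phi>_def \<xi>_def using stopped_id(3)[OF v'] \<open>0 < M\<close>
        by (intro integral_linearized cont taylor) auto
      also have "\<bar>l\<bar> * M * (fst v)\<^sup>2 * (b - a)\<^sup>2 \<le> \<bar>l\<bar> * M * \<rho>\<^sup>2 * (b - a)\<^sup>2"
      proof -
        have "\<bar>fst v\<bar>\<^sup>2 \<le> \<rho>\<^sup>2" using stopped_id(1)[OF v' N1] by (intro power_mono) auto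
        then show ?thesis using \<open>0 < M\<close> by (intro mult_left_mono mult_right_mono) auto
      qed
      also have "\<bar>l\<bar> * M * \<rho>\<^sup>2 * (b - a)\<^sup>2 = E0 * (\<bar>l\<bar> * \<rho>\<^sup>2)" by (simp add: E0_def)
      also have "\<bar>l\<bar> * \<rho>\<^sup>2 = X powr (- 1)"
        unfolding X3 \<rho>_def power2_eq_square powr_add[symmetric] by simp
      also have "E0 * X powr (- 1) = E0 / X" using X by (simp add: powr_minus_divide)
      finally show ?thesis by simp
    qed
    define S where "S = measure_pmf.expectation W (\<lambda>v. cmod (char \<mu> (\<xi> v)))"
    have S0: "0 \<le> S" unfolding S_def by (intro Bochner_Integration.integral_nonneg) auto
    have "(\<integral>x. \<phi> x \<partial>\<mu>) = measure_pmf.expectation W (\<lambda>v. \<integral>x. \<phi> (fst v * x + snd v) \<partial>\<mu>)"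
      unfolding W_def using integral_stopped[of \<phi> 1 "(1, 0)" \<rho> N] by (simp add: \<phi>_def indicator_def)
    then have "cmod (\<integral>x. \<phi> x \<partial>\<mu>) \<le> measure_pmf.expectation W (\<lambda>v. cmod (\<integral>x. \<phi> (fst v * x + snd v) \<partial>\<mu>))"
      by (simp add: integral_norm_bound)
    also have "\<dots> \<le> measure_pmf.expectation W (\<lambda>v. cmod (char \<mu> (\<xi> v)) + E0 / X)"
      using lin by (intro integral_mono_AE int AE_pmfI)
    also have "\<dots> = S + E0 / X"
      unfolding S_def by (subst Bochner_Integration.integral_add) (auto intro: int)
    finally have main: "cmod (\<integral>x. \<phi> x \<partial>\<mu>) \<le> S + E0 / X" .
    define T where "T = C6 * X"
    have T: "1 \<le> T" unfolding T_def using C6 X mult_mono[of 1 C6 1 X] by simp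
    define J where "J = {j. \<bar>real_of_int j\<bar> \<le> T}"
    have finJ: "finite J" using finite_int_dist_le[of 1 0 T] by (simp add: J_def)
    have round_J: "round (c0 * \<xi> v) \<in> J" if v: "v \<in> set_pmf W" for v
    proof -
      note v' = v[unfolded W_def]
      have "\<bar>l * fst v * g1 (fst v * a + snd v)\<bar> \<le> X powr 3 * \<rho> * M"
        unfolding abs_mult X3 using stopped_id(1)[OF v' N1] stopped_id(3)[OF v', of a] a_less_b \<rho>
        by (intro mult_mono bound) auto
      also have "X powr 3 * \<rho> = X" unfolding \<rho>_def using X by (subst powr_add[symmetric]) simp
      finally have "\<bar>c0 * \<xi> v\<bar> \<le> \<bar>c0\<bar> * (X * M)" unfolding abs_mult[of c0] \<xi>_def by (intro mult_left_mono) auto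
      then have "\<bar>real_of_int (round (c0 * \<xi> v))\<bar> \<le> \<bar>c0\<bar> * (X * M) + 1"
        using of_int_round_abs_le[of "c0 * \<xi> v"] by linarith
      also have "\<dots> \<le> T" using X by (simp add: T_def C6_def algebra_simps)
      finally show ?thesis by (simp add: J_def)
    qed
    have prob: "measure_pmf.prob W {v. round (c0 * \<xi> v) = j} \<le> C3 * X powr e * (C1 * (C5 / X) powr \<kappa>)" for j
    proof -
      define H where "H = 1 / (2 * \<bar>c0\<bar> * \<bar>l\<bar> * (\<rho> * rho_min)) + M * \<rho> * (b - a)"
      have "measure_pmf.prob W {v. round (c0 * \<xi> v) = j} \<le> Suc N ^ card (set_pmf P) * (C1 * H powr \<kappa>)"
        unfolding W_def \<xi>_def H_def using l c0 \<open>0 < M\<close>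
        by (intro stopped_frequency_prob cont lip level \<rho> N1) auto
      also have "\<dots> \<le> C3 * X powr e * (C1 * (C5 / X) powr \<kappa>)"
      proof (intro mult_mono mult_left_mono powr_mono2)
        show "real (Suc N ^ card (set_pmf P)) \<le> C3 * X powr e" using N2 by simp
        have lX: "\<bar>l\<bar> * \<rho> = X" unfolding X3 \<rho>_def using X by (subst powr_add[symmetric]) simp
        have "2 * \<bar>c0\<bar> * \<bar>l\<bar> * (\<rho> * rho_min) = 2 * \<bar>c0\<bar> * rho_min * (\<bar>l\<bar> * \<rho>)" by simp
        then have eq: "1 / (2 * \<bar>c0\<bar> * \<bar>l\<bar> * (\<rho> * rho_min)) = 1 / (2 * \<bar>c0\<bar> * rho_min) / X"
          unfolding lX by simp
        have le: "M * \<rho> * (b - a) \<le> M * (b - a) / X"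
        proof -
          have "\<rho> \<le> X powr (- 1)" unfolding \<rho>_def using X by (intro powr_mono) auto
          then have "\<rho> \<le> 1 / X" using X by (simp add: powr_minus_divide)
          then have "M * \<rho> * (b - a) \<le> M * (1 / X) * (b - a)"
            using \<open>0 < M\<close> a_less_b by (intro mult_right_mono mult_left_mono) auto
          then show ?thesis by simp
        qed
        show "H \<le> C5 / X" unfolding H_def C5_def add_divide_distrib eq by (rule add_left_mono[OF le])
        show "0 \<le> H" unfolding H_def using \<rho> rho_min(1) \<open>0 < M\<close> a_less_b by (intro add_nonneg_nonneg) auto
      qed (use \<open>0 < C1\<close> \<open>0 < \<kappa>\<close> C3 in auto)
      finally show ?thesis .
    qed
    have "S ^ m \<le> measure_pmf.expectation W (\<lambda>v. cmod (char \<mu> (\<xi> v)) ^ m)"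
      unfolding S_def by (rule expectation_power_le) (simp_all add: W_def finite_stopped)
    \<comment> \<open>The stopped maps are grouped by their rounded scaled frequency, on which alone
      the bound by \<open>V\<close> depends; \<open>round_J\<close> makes \<open>J\<close> exhaust
      the values that occur.\<close>
    also have "\<dots> \<le> measure_pmf.expectation W (\<lambda>v. \<Sum>j\<in>J. V j * indicator {v. round (c0 * \<xi> v) = j} v)"
    proof (intro integral_mono_AE int AE_pmfI)
      fix v assume v: "v \<in> set_pmf W"
      have "cmod (char \<mu> (\<xi> v)) ^ m \<le> V (round (c0 * \<xi> v))" by (rule V)
      also have "\<dots> = (\<Sum>j\<in>J. V j * indicator {v. round (c0 * \<xi> v) = j} v)"
        using finJ round_J[OF v] by (simp add: indicator_def if_distrib sum.If_cases sum.delta cong: if_cong)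
      finally show "cmod (char \<mu> (\<xi> v)) ^ m \<le> (\<Sum>j\<in>J. V j * indicator {v. round (c0 * \<xi> v) = j} v)" .
    qed
    also have "\<dots> = (\<Sum>j\<in>J. V j * measure_pmf.prob W {v. round (c0 * \<xi> v) = j})"
      by (subst Bochner_Integration.integral_sum) (auto intro: int)
    also have "\<dots> \<le> (\<Sum>j\<in>J. V j * (C3 * X powr e * (C1 * (C5 / X) powr \<kappa>)))"
      using prob V0 by (intro sum_mono mult_left_mono)
    also have "\<dots> = (\<Sum>j\<in>J. V j) * (C3 * X powr e * (C1 * (C5 / X) powr \<kappa>))"
      by (simp add: sum_distrib_right)
    also have "\<dots> \<le> (C2 * T powr e) * (C3 * X powr e * (C1 * (C5 / X) powr \<kappa>))"
      unfolding J_def using Vsum[OF T] C3 \<open>0 < C1\<close> by (intro mult_right_mono) auto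
    also have "\<dots> = C7 * (X powr e * X powr e * X powr (- \<kappa>))"
      using C5 C6 X by (simp add: C7_def T_def powr_mult powr_divide powr_minus_divide)
    also have "X powr e * X powr e * X powr (- \<kappa>) = X powr (- (2 * e))"
      by (simp add: e(2) flip: powr_add)
    finally have Sm: "S ^ m \<le> C7 * X powr (- (2 * e))" .
    have "S \<le> C7 powr (1 / m) * X powr (- \<sigma>)"
    proof (cases "S = 0")
      case False
      then have "S = (S ^ m) powr (1 / m)" using S0 m by (simp add: powr_powr flip: powr_realpow)
      also have "\<dots> \<le> (C7 * X powr (- (2 * e))) powr (1 / m)" using Sm S0 by (intro powr_mono2) auto
      also have "\<dots> = C7 powr (1 / m) * X powr (- (2 * e / m))"
        using C7 X by (simp add: powr_mult powr_powr)
      also have "\<dots> \<le> C7 powr (1 / m) * X powr (- \<sigma>)"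
        using X by (intro mult_left_mono powr_mono) (auto simp: \<sigma>_def)
      finally show ?thesis .
    qed (use C7 in simp)
    moreover have "E0 / X \<le> E0 * X powr (- \<sigma>)"
    proof -
      have "X powr (- 1) \<le> X powr (- \<sigma>)" using X by (intro powr_mono) (auto simp: \<sigma>_def)
      then have "E0 * X powr (- 1) \<le> E0 * X powr (- \<sigma>)" using E0 by (intro mult_left_mono) auto
      also have "E0 * X powr (- 1) = E0 / X" using X by (simp add: powr_minus_divide)
      finally show ?thesis .
    qed
    ultimately have "cmod (\<integral>x. \<phi> x \<partial>\<mu>) \<le> C * X powr (- \<sigma>)"
      using main by (simp add: C_def algebra_simps)
    also have "X powr (- \<sigma>) = \<bar>l\<bar> powr (- (\<sigma> / 3))" by (simp add: X_def powr_powr)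
    finally show ?thesis by (simp add: \<phi>_def)
  qed
  moreover have "C > 0" using C7 E0 by (simp add: C_def add_pos_pos)
  ultimately show ?thesis using \<sigma> by (intro exI[of _ "\<sigma> / 3"] conjI exI[of _ C]) auto
qed

end

section \<open>The support and the main result\<close>

text \<open>The distance to an invariant interval is contracted by every map of the IFS.\<close>

lemma self_similar_full_invariant_interval:
  fixes \<mu> :: "real measure"
  assumes "prob_space \<mu>" and sets: "sets \<mu> = sets borel"
    and I: "finite I" and r: "\<And>i. i \<in> I \<Longrightarrow> \<bar>r i\<bar> < 1"
    and p: "\<And>i. i \<in> I \<Longrightarrow> 0 \<le> p i" "(\<Sum>i\<in>I. p i) = 1"
    and self: "\<And>A. A \<in> sets borel \<Longrightarrow> measure \<mu> A = (\<Sum>i\<in>I. p i * measure \<mu> {x. r i * x + t i \<in> A})"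
    and inv: "\<And>i x. i \<in> I \<Longrightarrow> x \<in> {a..b} \<Longrightarrow> r i * x + t i \<in> {a..b}" and "a \<le> b"
  shows "measure \<mu> {a..b} = 1"
proof -
  interpret prob_space \<mu> by fact
  have space: "space \<mu> = UNIV" using sets_eq_imp_space_eq[OF sets] by simp
  have "I \<noteq> {}" using p(2) by auto
  \<comment> \<open>Inserting 1/2 keeps \<open>\<rho>\<close> positive, so that it can be divided by
    even if all \<open>r i\<close> are 0.\<close>
  define \<rho> where "\<rho> = Max (insert (1/2) ((\<lambda>i. \<bar>r i\<bar>) ` I))"
  have "\<rho> \<in> insert (1/2) ((\<lambda>i. \<bar>r i\<bar>) ` I)" unfolding \<rho>_def using I by (intro Max_in) auto
  then have "\<rho> < 1" using r by auto
  have "1/2 \<le> \<rho>" unfolding \<rho>_def using I by (intro Max_ge) auto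
  then have "0 < \<rho>" by linarith
  have r\<rho>: "\<bar>r i\<bar> \<le> \<rho>" if "i \<in> I" for i unfolding \<rho>_def using that I by (intro Max_ge) auto
  define d where "d x = max 0 (max (a - x) (x - b))" for x
  have [measurable]: "d \<in> borel_measurable borel" unfolding d_def by measurable
  have contract: "d (r i * x + t i) \<le> \<rho> * d x" if i: "i \<in> I" for i x
  proof -
    \<comment> \<open>\<open>y\<close> is the point of \<open>{a..b}\<close> nearest to
      \<open>x\<close>. Its image stays in the interval and so bounds the distance of the image of
      \<open>x\<close> from it.\<close>
    define y where "y = max a (min b x)"
    have y: "y \<in> {a..b}" "\<bar>x - y\<bar> = d x" using \<open>a \<le> b\<close> by (auto simp: y_def d_def)
    have "d (r i * x + t i) \<le> \<bar>(r i * x + t i) - (r i * y + t i)\<bar>"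
      using inv[OF i y(1)] unfolding d_def by auto
    also have "\<dots> = \<bar>r i\<bar> * \<bar>x - y\<bar>" by (simp add: abs_mult flip: right_diff_distrib)
    also have "\<dots> \<le> \<rho> * d x" unfolding y(2) using r\<rho>[OF i] by (intro mult_right_mono) (auto simp: d_def)
    finally show ?thesis .
  qed
  have meas: "{x. c < d x} \<in> sets \<mu>" for c
  proof -
    have "{x \<in> space borel. c < d x} \<in> sets borel" by measurable
    then show ?thesis by (simp add: sets)
  qed
  have step: "measure \<mu> {x. c < d x} \<le> measure \<mu> {x. c / \<rho> < d x}" for c
  proof -
    have "measure \<mu> {x. c < d x} = (\<Sum>i\<in>I. p i * measure \<mu> {x. r i * x + t i \<in> {x. c < d x}})"
      using meas by (intro self) (simp add: sets)
    also have "\<dots> \<le> (\<Sum>i\<in>I. p i * measure \<mu> {x. c / \<rho> < d x})"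
    proof (intro sum_mono mult_left_mono finite_measure_mono meas p)
      fix i assume "i \<in> I"
      then show "{x. r i * x + t i \<in> {x. c < d x}} \<subseteq> {x. c / \<rho> < d x}"
        using contract \<open>0 < \<rho>\<close> by (auto simp: divide_less_eq mult.commute intro: less_le_trans)
    qed
    also have "\<dots> = measure \<mu> {x. c / \<rho> < d x}" by (simp add: p flip: sum_distrib_right)
    finally show ?thesis .
  qed
  \<comment> \<open>The mass beyond distance \<open>c\<close> is at most that beyond
    \<open>c / \<rho> ^ k\<close>, and for \<open>c > 0\<close> these sets decrease to the empty
    set.\<close>
  have iter: "measure \<mu> {x. c < d x} \<le> measure \<mu> {x. c * (1 / \<rho>) ^ k < d x}" for c k
  proof (induction k)
    case (Suc k)
    note Suc
    also have "measure \<mu> {x. c * (1 / \<rho>) ^ k < d x} \<le> measure \<mu> {x. c * (1 / \<rho>) ^ k / \<rho> < d x}" by (rule step)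
    also have "c * (1 / \<rho>) ^ k / \<rho> = c * (1 / \<rho>) ^ Suc k" by simp
    finally show ?case .
  qed simp
  have zero: "measure \<mu> {x. c < d x} = 0" if "0 < c" for c
  proof -
    have "(\<lambda>k. measure \<mu> {x. c * (1 / \<rho>) ^ k < d x}) \<longlonglongrightarrow> measure \<mu> (\<Inter>k. {x. c * (1 / \<rho>) ^ k < d x})"
    proof (intro finite_Lim_measure_decseq decseq_SucI)
      show "{x. c * (1 / \<rho>) ^ Suc k < d x} \<subseteq> {x. c * (1 / \<rho>) ^ k < d x}" for k
      proof
        fix x assume "x \<in> {x. c * (1 / \<rho>) ^ Suc k < d x}"
        moreover have "c * (1 / \<rho>) ^ k \<le> c * (1 / \<rho>) ^ Suc k"
          using that \<open>0 < \<rho>\<close> \<open>\<rho> < 1\<close> by (intro mult_left_mono power_increasing) auto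
        ultimately show "x \<in> {x. c * (1 / \<rho>) ^ k < d x}" by auto
      qed
    qed (use meas in auto)
    moreover have "(\<Inter>k. {x. c * (1 / \<rho>) ^ k < d x}) = {}"
    proof -
      have "\<exists>k. \<not> c * (1 / \<rho>) ^ k < d x" for x
      proof -
        obtain k where "d x / c < (1 / \<rho>) ^ k"
          using real_arch_pow[of "1 / \<rho>" "d x / c"] \<open>0 < \<rho>\<close> \<open>\<rho> < 1\<close> by auto
        then have "d x < c * (1 / \<rho>) ^ k" using that by (simp add: divide_less_eq mult.commute)
        then show ?thesis by (intro exI[of _ k]) simp
      qed
      then show ?thesis by blast
    qed
    ultimately have "(\<lambda>k. measure \<mu> {x. c * (1 / \<rho>) ^ k < d x}) \<longlonglongrightarrow> 0" by simp
    then have "measure \<mu> {x. c < d x} \<le> 0" using iter by (intro LIMSEQ_le_const) auto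
    then show ?thesis by (simp add: measure_le_0_iff)
  qed
  have "measure \<mu> (\<Union>k. {x. 1 / real (Suc k) < d x}) = 0"
  proof -
    have "(\<Union>k. {x. 1 / real (Suc k) < d x}) \<in> null_sets \<mu>"
      using zero meas by (intro null_sets_UN) (auto simp: null_sets_def emeasure_eq_measure)
    then show ?thesis by (simp add: null_sets_def measure_def)
  qed
  moreover have "(\<Union>k. {x. 1 / real (Suc k) < d x}) = - {a..b}"
  proof
    show "(\<Union>k. {x. 1 / real (Suc k) < d x}) \<subseteq> - {a..b}"
    proof
      fix x assume "x \<in> (\<Union>k. {x. 1 / real (Suc k) < d x})"
      then obtain k where "1 / real (Suc k) < d x" by blast
      moreover have "0 < 1 / real (Suc k)" by simp
      ultimately have "0 < d x" by linarith
      then show "x \<in> - {a..b}" by (auto simp: d_def)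
    qed
    show "- {a..b} \<subseteq> (\<Union>k. {x. 1 / real (Suc k) < d x})"
    proof
      fix x assume "x \<in> - {a..b}"
      then have "0 < d x" by (auto simp: d_def)
      then obtain k where "1 / real (Suc k) < d x"
        using reals_Archimedean[of "d x"] by (auto simp: inverse_eq_divide)
      then show "x \<in> (\<Union>k. {x. 1 / real (Suc k) < d x})" by blast
    qed
  qed
  ultimately have "measure \<mu> (space \<mu> - {a..b}) = 0" by (simp add: space Compl_eq_Diff_UNIV)
  then show ?thesis using prob_compl[of "{a..b}"] by (simp add: sets)
qed

section \<open>The support of a measure, and estimates for functions on an interval\<close>

lemma closed_measure_support: "closed (measure_support \<mu>)"
proof -
  have "- measure_support \<mu> = \<Union>{U. open U \<and> emeasure \<mu> U = 0}"
    by (auto simp: measure_support_def)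
  then have "open (- measure_support \<mu>)" by (simp only:) (rule open_Union, simp)
  then show ?thesis by (simp add: closed_def)
qed

text \<open>The complement is a union of possibly uncountably many open null sets; by the Lindelof
  property countably many of them already cover it.\<close>

lemma null_compl_measure_support:
  assumes "sets \<mu> = sets borel"
  shows "- measure_support \<mu> \<in> null_sets \<mu>"
proof -
  define \<U> where "\<U> = {U::real set. open U \<and> emeasure \<mu> U = 0}"
  have eq: "- measure_support \<mu> = \<Union>\<U>" by (auto simp: measure_support_def \<U>_def)
  obtain \<U>' where \<U>': "\<U>' \<subseteq> \<U>" "countable \<U>'" "\<Union>\<U>' = \<Union>\<U>"
    using Lindelof[of \<U>] by (auto simp: \<U>_def)
  have "U \<in> null_sets \<mu>" if "U \<in> \<U>'" for U
    using that \<U>'(1) assms by (auto simp: \<U>_def null_sets_def)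
  then show ?thesis unfolding eq \<U>'(3)[symmetric]
    using null_sets_UN'[OF \<U>'(2), of "\<lambda>U. U" \<mu>] by simp
qed

text \<open>At each centre only the coefficients of order 0 and 1 change. This lets the identity
  principle compare \<open>g\<close> with an affine function on all of \<open>J\<close>.\<close>

lemma real_analytic_on_diff_affine:
  assumes "real_analytic_on g J"
  shows "real_analytic_on (\<lambda>x. g x - (c * x + e)) J"
  unfolding real_analytic_on_def
proof
  fix x assume "x \<in> J"
  then obtain k \<epsilon> where k: "\<epsilon> > 0" "\<And>y. y \<in> J \<Longrightarrow> \<bar>y - x\<bar> < \<epsilon> \<Longrightarrow> (\<lambda>i. k i * (y - x) ^ i) sums g y"
    using assms unfolding real_analytic_on_def by blast
  define q :: "nat \<Rightarrow> real" where "q i = (if i = 0 then c * x + e else if i = 1 then c else 0)" for i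
  have q: "(\<lambda>i. q i * (y - x) ^ i) sums (c * y + e)" for y
  proof -
    have "(\<lambda>i. q i * (y - x) ^ i) sums (\<Sum>i\<in>{0,1}. q i * (y - x) ^ i)"
      by (rule sums_finite) (auto simp: q_def)
    then show ?thesis by (simp add: q_def algebra_simps)
  qed
  have "(\<lambda>i. (k i - q i) * (y - x) ^ i) sums (g y - (c * y + e))" if "y \<in> J" "\<bar>y - x\<bar> < \<epsilon>" for y
    using sums_diff[OF k(2)[OF that] q[of y]] by (simp add: left_diff_distrib)
  then show "\<exists>a. \<exists>\<epsilon>>0. \<forall>y\<in>J. \<bar>y - x\<bar> < \<epsilon> \<longrightarrow> (\<lambda>k. a k * (y - x) ^ k) sums (g y - (c * y + e))"
    using k(1) by (intro exI[of _ "\<lambda>i. k i - q i"] exI[of _ \<epsilon>]) simp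
qed

text \<open>The mean value inequality for \<open>g z - g1 x * z\<close> as a function of
  \<open>z\<close>, whose derivative is at most \<open>M * \<bar>y - x\<bar>\<close> in modulus
  between \<open>x\<close> and \<open>y\<close>.\<close>

lemma taylor_first_order:
  fixes g g1 :: "real \<Rightarrow> real"
  assumes g1: "\<And>x. x \<in> {a..b} \<Longrightarrow> (g has_real_derivative g1 x) (at x within {a..b})"
    and lip: "\<And>x y. x \<in> {a..b} \<Longrightarrow> y \<in> {a..b} \<Longrightarrow> \<bar>g1 x - g1 y\<bar> \<le> M * \<bar>x - y\<bar>" and "0 \<le> M"
    and xy: "x \<in> {a..b}" "y \<in> {a..b}"
  shows "\<bar>g y - g x - g1 x * (y - x)\<bar> \<le> M * (y - x)\<^sup>2"
proof -
  let ?S = "{min x y..max x y}"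
  have sub: "?S \<subseteq> {a..b}" using xy by auto
  have "norm ((g y - g1 x * y) - (g x - g1 x * x)) \<le> (M * \<bar>y - x\<bar>) * norm (y - x)"
  proof (rule field_differentiable_bound[where S = ?S and f' = "\<lambda>z. g1 z - g1 x"])
    fix z assume z: "z \<in> ?S"
    have "(g has_real_derivative g1 z) (at z within ?S)"
      using z sub by (intro DERIV_subset[OF g1 sub]) auto
    then show "((\<lambda>z. g z - g1 x * z) has_real_derivative g1 z - g1 x) (at z within ?S)"
      by (auto intro!: derivative_eq_intros)
    have "\<bar>g1 z - g1 x\<bar> \<le> M * \<bar>z - x\<bar>" using z sub xy by (intro lip) auto
    also have "\<dots> \<le> M * \<bar>y - x\<bar>" using z \<open>0 \<le> M\<close> by (intro mult_left_mono) auto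
    finally show "norm (g1 z - g1 x) \<le> M * \<bar>y - x\<bar>" by simp
  qed auto
  also have "(M * \<bar>y - x\<bar>) * norm (y - x) = M * (y - x)\<^sup>2"
    unfolding power2_eq_square real_norm_def mult.assoc abs_mult_self_eq ..
  also have "(g y - g1 x * y) - (g x - g1 x * x) = g y - g x - g1 x * (y - x)"
    by (simp add: algebra_simps)
  finally show ?thesis by simp
qed

theorem corollary1p3:
  fixes n :: nat and r t p :: "nat \<Rightarrow> real" and \<mu> :: "real measure"
    and J :: "real set" and g :: "real \<Rightarrow> real"
  assumes "self_similar_ifs n r t"
    and "distinct_fixed_points n r t"
    and "positive_prob_vector n p"
    and "self_similar_measure n r t p \<mu>"
    and "non_atomic \<mu>"
    and "is_interval J"
    and "measure_support \<mu> \<subseteq> J"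
    and "real_analytic_on g J"
    and "\<not> affine_on g J"
  shows "\<exists>\<tau>>0. \<exists>C>0. \<forall>\<^sub>F l :: real in at_infinity.
    cmod (LINT x:J|\<mu>. exp (2 * complex_of_real pi * \<i> * complex_of_real (g x) * complex_of_real l))
      \<le> C * \<bar>l\<bar> powr (- \<tau>)"
proof -
  define I where "I = {1..n}"
  have finI: "finite I" by (simp add: I_def)
  have r: "r i \<noteq> 0" "\<bar>r i\<bar> < 1" if "i \<in> I" for i
    using assms(1) that by (auto simp: self_similar_ifs_def I_def abs_less_iff)
  have p: "0 < p i" if "i \<in> I" for i using assms(3) that by (auto simp: positive_prob_vector_def I_def)
  have p1: "(\<Sum>i\<in>I. p i) = 1" using assms(3) by (simp add: positive_prob_vector_def I_def)
  have prob: "prob_space \<mu>" and sets: "sets \<mu> = sets borel"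
    using assms(4) by (auto simp: self_similar_measure_def)
  interpret mu: prob_space \<mu> by (rule prob)
  have space: "space \<mu> = UNIV" using sets_eq_imp_space_eq[OF sets] by simp
  have self: "measure \<mu> A = (\<Sum>i\<in>I. p i * measure \<mu> {x. r i * x + t i \<in> A})" if A: "A \<in> sets borel" for A
  proof -
    have "emeasure (distr \<mu> borel (sim_map r t i)) A = ennreal (measure \<mu> {x. r i * x + t i \<in> A})" for i
    proof -
      have "sim_map r t i \<in> measurable \<mu> borel"
        unfolding sim_map_def by (simp add: measurable_cong_sets[OF sets refl])
      then show ?thesis
        using A by (simp add: emeasure_distr space vimage_def mu.emeasure_eq_measure sim_map_def)
    qed
    then have "ennreal (measure \<mu> A) = (\<Sum>i\<in>I. ennreal (p i) * ennreal (measure \<mu> {x. r i * x + t i \<in> A}))"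
      using assms(4) A by (simp add: self_similar_measure_def I_def mu.emeasure_eq_measure)
    also have "\<dots> = (\<Sum>i\<in>I. ennreal (p i * measure \<mu> {x. r i * x + t i \<in> A}))"
      using p by (intro sum.cong refl) (simp add: ennreal_mult less_imp_le)
    also have "\<dots> = ennreal (\<Sum>i\<in>I. p i * measure \<mu> {x. r i * x + t i \<in> A})"
      using p by (intro sum_ennreal) (simp add: less_imp_le)
    finally show ?thesis
      using p by (subst (asm) ennreal_inj) (auto intro!: sum_nonneg simp: less_imp_le)
  qed
  obtain a0 b0 where ab0: "a0 \<le> b0" "\<And>i x. i \<in> I \<Longrightarrow> x \<in> {a0..b0} \<Longrightarrow> r i * x + t i \<in> {a0..b0}"
    using assms(1) unfolding self_similar_ifs_def sim_map_def I_def image_subset_iff by blast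
  have full0: "measure \<mu> {a0..b0} = 1"
    using self_similar_full_invariant_interval[OF prob sets finI r(2) _ p1 self ab0(2,1)] p
    by (simp add: less_imp_le)

  \<comment> \<open>The interval \<open>{a0..b0}\<close> may extend beyond \<open>J\<close>, where
    nothing is known of \<open>g\<close>. The argument therefore moves to the convex hull
    \<open>{a..b}\<close> of the support, which lies in \<open>J\<close> and inherits invariance
    from the support.\<close>
  define K where "K = measure_support \<mu>"
  have nullK: "- K \<in> null_sets \<mu>" unfolding K_def by (rule null_compl_measure_support[OF sets])
  have closedK: "closed K" unfolding K_def by (rule closed_measure_support)
  have measK: "measure \<mu> K = 1"
  proof -
    have "measure \<mu> (space \<mu> - (- K)) = 1"
      using nullK by (subst mu.prob_compl) (auto simp: null_sets_def measure_def)
    then show ?thesis by (simp add: space)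
  qed
  then have "K \<noteq> {}" by auto
  have K0: "K \<subseteq> {a0..b0}"
  proof
    fix x assume x: "x \<in> K"
    show "x \<in> {a0..b0}"
    proof (rule ccontr)
      assume "x \<notin> {a0..b0}"
      then have "0 < emeasure \<mu> (- {a0..b0})"
        using x unfolding K_def measure_support_def by (auto simp: open_Compl)
      moreover have "measure \<mu> (space \<mu> - {a0..b0}) = 0"
        using full0 by (subst mu.prob_compl) (auto simp: sets)
      ultimately show False by (simp add: mu.emeasure_eq_measure space Compl_eq_Diff_UNIV)
    qed
  qed
  then have bdd: "bdd_below K" "bdd_above K" by (auto intro: bdd_below_mono bdd_above_mono)
  define a where "a = Inf K"
  define b where "b = Sup K"
  have aK: "a \<in> K" unfolding a_def by (rule closed_contains_Inf[OF \<open>K \<noteq> {}\<close> bdd(1) closedK])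
  have bK: "b \<in> K" unfolding b_def by (rule closed_contains_Sup[OF \<open>K \<noteq> {}\<close> bdd(2) closedK])
  have Kab: "K \<subseteq> {a..b}" unfolding a_def b_def using bdd by (auto intro: cInf_lower cSup_upper)
  have full: "measure \<mu> {a..b} = 1"
  proof -
    have "1 \<le> measure \<mu> {a..b}" unfolding measK[symmetric]
      using Kab by (intro mu.finite_measure_mono) (auto simp: sets)
    then show ?thesis using mu.prob_le_1 antisym by blast
  qed
  have "a < b"
  proof (rule ccontr)
    assume "\<not> a < b"
    then have "{a..b} \<subseteq> {a}" by auto
    then have "measure \<mu> {a..b} \<le> measure \<mu> {a}" by (intro mu.finite_measure_mono) (auto simp: sets)
    moreover have "measure \<mu> {a} = 0" using assms(5) by (simp add: non_atomic_def measure_def)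
    ultimately show False using full by simp
  qed
  \<comment> \<open>A neighbourhood of the image pulls back to a neighbourhood of \<open>x\<close>,
    whose mass enters that of \<open>U\<close> with the positive weight \<open>p i\<close>.\<close>
  have fK: "r i * x + t i \<in> K" if i: "i \<in> I" and x: "x \<in> K" for i x
    unfolding K_def measure_support_def
  proof safe
    fix U :: "real set" assume U: "open U" "r i * x + t i \<in> U"
    have "open ((\<lambda>x. r i * x + t i) -` U)"
      using U by (intro continuous_open_vimage) (auto intro!: continuous_intros)
    then have "0 < emeasure \<mu> ((\<lambda>x. r i * x + t i) -` U)"
      using x U unfolding K_def measure_support_def by auto
    then have "0 < measure \<mu> {x. r i * x + t i \<in> U}"
      by (simp add: mu.emeasure_eq_measure vimage_def)
    then have "0 < p i * measure \<mu> {x. r i * x + t i \<in> U}" using p[OF i] by simp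
    also have "\<dots> \<le> (\<Sum>i\<in>I. p i * measure \<mu> {x. r i * x + t i \<in> U})"
      using finI i p by (intro member_le_sum[where f = "\<lambda>i. p i * measure \<mu> {x. r i * x + t i \<in> U}"])
        (auto simp: less_imp_le)
    also have "\<dots> = measure \<mu> U" using U by (intro self[symmetric]) auto
    finally show "0 < emeasure \<mu> U" by (simp add: mu.emeasure_eq_measure)
  qed
  have inv: "r i * x + t i \<in> {a..b}" if i: "i \<in> I" and x: "x \<in> {a..b}" for i x
  proof -
    have ends: "r i * a + t i \<in> {a..b}" "r i * b + t i \<in> {a..b}" using fK[OF i] aK bK Kab by (meson subsetD)+
    show ?thesis
    proof (cases "0 \<le> r i")
      case True
      then have "r i * a \<le> r i * x" "r i * x \<le> r i * b" using x by (auto intro: mult_left_mono)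
      then show ?thesis using ends by auto
    next
      case False
      then have "r i * b \<le> r i * x" "r i * x \<le> r i * a" using x by (auto intro: mult_left_mono_neg)
      then show ?thesis using ends by auto
    qed
  qed
  have abJ: "{a..b} \<subseteq> J"
  proof
    fix x assume x: "x \<in> {a..b}"
    have "a \<in> J" "b \<in> J" using assms(7) aK bK unfolding K_def by blast+
    then show "x \<in> J" by (rule mem_is_interval_1_I[OF assms(6)]) (use x in simp_all)
  qed

  define pm where "pm i = (if i \<in> I then p i else 0)" for i
  define P where "P = embed_pmf pm"
  have pm0: "0 \<le> pm i" for i using p by (auto simp: pm_def less_imp_le)
  have pm1: "(\<integral>\<^sup>+i. ennreal (pm i) \<partial>count_space UNIV) = 1"
  proof -
    have "(\<integral>\<^sup>+i. ennreal (pm i) \<partial>count_space UNIV) = (\<Sum>i\<in>I. ennreal (pm i))"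
      by (rule nn_integral_count_space'[OF finI]) (auto simp: pm_def)
    also have "\<dots> = ennreal (\<Sum>i\<in>I. pm i)" using pm0 by (intro sum_ennreal) auto
    also have "(\<Sum>i\<in>I. pm i) = 1" using p1 by (simp add: pm_def)
    finally show ?thesis by simp
  qed
  have setP: "set_pmf P = I" unfolding P_def set_embed_pmf[OF pm0 pm1] using p by (force simp: pm_def)
  have pmfP: "pmf P i = p i" if "i \<in> I" for i
    unfolding P_def pmf_embed_pmf[OF pm0 pm1] using that by (simp add: pm_def)
  interpret self_similar P r t \<mu> a b
  proof
    show "\<exists>i\<in>set_pmf P. \<exists>j\<in>set_pmf P. t i * (1 - r j) \<noteq> t j * (1 - r i)"
    proof -
      obtain i j x y where ij: "i \<in> I" "j \<in> I" "r i * x + t i = x" "r j * y + t j = y" "x \<noteq> y"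
        using assms(2) unfolding distinct_fixed_points_def I_def sim_map_def by blast
      have tx: "t i = x * (1 - r i)" "t j = y * (1 - r j)" using ij(3,4) by (simp_all add: algebra_simps)
      have "t i * (1 - r j) - t j * (1 - r i) = (x - y) * ((1 - r i) * (1 - r j))"
        unfolding tx by (simp add: algebra_simps)
      moreover have "r i \<noteq> 1" "r j \<noteq> 1" using r(2)[OF ij(1)] r(2)[OF ij(2)] by auto
      ultimately have "t i * (1 - r j) - t j * (1 - r i) \<noteq> 0" using ij(5) by simp
      then show ?thesis using ij(1,2) unfolding setP by force
    qed
    show "measure \<mu> A = (\<Sum>i\<in>set_pmf P. pmf P i * measure \<mu> {x. r i * x + t i \<in> A})"
      if "A \<in> sets borel" for A
      unfolding setP by (subst self[OF that]) (intro sum.cong refl, simp add: pmfP)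
    show "r i * x + t i \<in> {a..b}" if "i \<in> set_pmf P" "x \<in> {a..b}" for i x
      using inv that unfolding setP by blast
  qed (use finI r prob sets full \<open>a < b\<close> in \<open>simp_all add: setP\<close>)

  \<comment> \<open>Regularity and curvature of \<open>g\<close> on the hull of the support\<close>
  have an: "real_analytic_on g {a..b}" using assms(8) abJ by (rule real_analytic_on_subset)
  obtain g1 where g1: "real_analytic_on g1 {a..b}"
    "\<And>x. x \<in> {a..b} \<Longrightarrow> (g has_real_derivative g1 x) (at x within {a..b})"
    using real_analytic_on_derivative[OF an \<open>a < b\<close>] by blast
  obtain g2 where g2: "real_analytic_on g2 {a..b}"
    "\<And>x. x \<in> {a..b} \<Longrightarrow> (g1 has_real_derivative g2 x) (at x within {a..b})"
    using real_analytic_on_derivative[OF g1(1) \<open>a < b\<close>] by blast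
  \<comment> \<open>A third derivative is taken only to have \<open>g2\<close> continuous, hence
    bounded on \<open>{a..b}\<close>.\<close>
  obtain g3 where g3: "\<And>x. x \<in> {a..b} \<Longrightarrow> (g2 has_real_derivative g3 x) (at x within {a..b})"
    using real_analytic_on_derivative[OF g2(1) \<open>a < b\<close>] by blast
  have "continuous_on {a..b} g" using g1(2) by (rule DERIV_continuous_on)
  moreover have "continuous_on {a..b} g1" using g2(2) by (rule DERIV_continuous_on)
  moreover have "continuous_on {a..b} g2" using g3 by (rule DERIV_continuous_on)
  ultimately have cont: "continuous_on {a..b} g" "continuous_on {a..b} g1" "continuous_on {a..b} g2" .
  \<comment> \<open>\<open>g\<close> is assumed non-affine on \<open>J\<close>, which may be larger
    than \<open>{a..b}\<close>: if \<open>g2\<close> vanished on \<open>{a..b}\<close>, then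
    \<open>g\<close> would be affine there and, by the identity principle, on all of
    \<open>J\<close>.\<close>
  have nonzero: "\<exists>x\<in>{a..b}. g2 x \<noteq> 0"
  proof (rule ccontr)
    assume "\<not> ?thesis"
    then have "\<And>x. x \<in> {a..b} \<Longrightarrow> (g1 has_real_derivative 0) (at x within {a..b})" using g2(2) by force
    then obtain c where c: "\<And>x. x \<in> {a..b} \<Longrightarrow> g1 x = c"
      using has_field_derivative_zero_constant[of "{a..b}" g1] by auto
    have "((\<lambda>x. g x - c * x) has_real_derivative 0) (at x within {a..b})" if "x \<in> {a..b}" for x
      using g1(2)[OF that] c[OF that] by (auto intro!: derivative_eq_intros)
    then obtain e where e: "\<And>x. x \<in> {a..b} \<Longrightarrow> g x - c * x = e"
      using has_field_derivative_zero_constant[of "{a..b}" "\<lambda>x. g x - c * x"] by auto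
    have "g x - (c * x + e) = 0" if "x \<in> {a..b}" for x using e[OF that] by simp
    then have "\<forall>x\<in>J. g x - (c * x + e) = 0"
      using real_analytic_on_identity[OF real_analytic_on_diff_affine[OF assms(8)] assms(6) \<open>a < b\<close> abJ] by blast
    then have "affine_on g J" unfolding affine_on_def by (intro exI[of _ c] exI[of _ e]) auto
    then show False using assms(9) by blast
  qed
  have "bounded (g1 ` {a..b} \<union> g2 ` {a..b})"
    using cont by (auto intro!: compact_imp_bounded compact_continuous_image)
  then obtain M where M: "0 < M" "\<And>y. y \<in> g1 ` {a..b} \<union> g2 ` {a..b} \<Longrightarrow> norm y \<le> M"
    unfolding bounded_pos by blast
  have lip: "\<bar>g1 x - g1 y\<bar> \<le> M * \<bar>x - y\<bar>" if "x \<in> {a..b}" "y \<in> {a..b}" for x y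
    using field_differentiable_bound[of "{a..b}" g1 g2 M x y] g2(2) M(2) that by auto
  have taylor: "\<bar>g y - g x - g1 x * (y - x)\<bar> \<le> M * (y - x)\<^sup>2" if "x \<in> {a..b}" "y \<in> {a..b}" for x y
    using taylor_first_order[OF g1(2) lip _ that] M(1) by auto
  obtain C1 \<kappa> where level: "C1 > 0" "\<kappa> > 0"
    "\<And>u h. 0 < h \<Longrightarrow> measure \<mu> {x\<in>{a..b}. \<bar>g1 x - u\<bar> \<le> h} \<le> C1 * h powr \<kappa>"
    using analytic_level_measure[OF g2(2) g2(1) nonzero] by blast
  have "\<exists>\<tau>>0. \<exists>C>0. \<forall>l. 1 \<le> \<bar>l\<bar> \<longrightarrow>
      cmod (\<integral>x. indicator {a..b} x *\<^sub>R iexp (l * g x) \<partial>\<mu>) \<le> C * \<bar>l\<bar> powr (- \<tau>)"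
    by (rule oscillatory_decay[OF cont(1,2) taylor lip _ M(1) level(3,1,2)]) (use M(2) in auto)
  then obtain \<tau> C where \<tau>: "\<tau> > 0" "C > 0" "\<And>l. 1 \<le> \<bar>l\<bar> \<Longrightarrow>
      cmod (\<integral>x. indicator {a..b} x *\<^sub>R iexp (l * g x) \<partial>\<mu>) \<le> C * \<bar>l\<bar> powr (- \<tau>)" by blast
  have decay: "cmod (LINT x:J|\<mu>. exp (2 * complex_of_real pi * \<i> * complex_of_real (g x) * complex_of_real l))
      \<le> C * \<bar>l\<bar> powr (- \<tau>)" (is "cmod ?L \<le> _") if l: "1 \<le> \<bar>l\<bar>" for l
  proof -
    define f where "f x = indicator J x *\<^sub>R exp (2 * complex_of_real pi * \<i> * complex_of_real (g x) * complex_of_real l)" for x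
    define \<phi> where "\<phi> x = indicator {a..b} x *\<^sub>R iexp (2 * pi * l * g x)" for x
    have L: "?L = (\<integral>x. f x \<partial>\<mu>)" by (simp add: set_lebesgue_integral_def f_def)
    show ?thesis
    \<comment> \<open>Integrability supplies the measurability of \<open>f\<close> needed to replace
      it by \<open>\<phi>\<close> almost everywhere. In the other case the integral has the default
      value 0 and the bound is trivial.\<close>
    proof (cases "integrable \<mu> f")
      case True
      have "\<phi> \<in> borel_measurable borel"
        unfolding \<phi>_def using cont(1)
        by (intro borel_measurable_continuous_on_indicator) (auto intro!: continuous_intros)
      then have "(\<integral>x. f x \<partial>\<mu>) = (\<integral>x. \<phi> x \<partial>\<mu>)"
      proof (intro integral_cong_AE)
        show "AE x in \<mu>. f x = \<phi> x"
          using AE_in_interval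
        proof eventually_elim
          fix x assume "x \<in> {a..b}"
          then show "f x = \<phi> x" using abJ by (auto simp: f_def \<phi>_def mult_ac)
        qed
      qed (use True in \<open>auto intro: borel_measurable_mu\<close>)
      then have "cmod ?L = cmod (\<integral>x. indicator {a..b} x *\<^sub>R iexp (2 * pi * l * g x) \<partial>\<mu>)"
        by (simp add: L \<phi>_def)
      also have "\<dots> \<le> C * \<bar>2 * pi * l\<bar> powr (- \<tau>)"
      proof (rule \<tau>(3))
        have "1 * 1 \<le> (2 * pi) * \<bar>l\<bar>" using l pi_ge_two by (intro mult_mono) auto
        then show "1 \<le> \<bar>2 * pi * l\<bar>" by (simp add: abs_mult)
      qed
      also have "\<dots> \<le> C * \<bar>l\<bar> powr (- \<tau>)"
      proof (intro mult_left_mono powr_mono2')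
        have "1 * \<bar>l\<bar> \<le> (2 * pi) * \<bar>l\<bar>" using pi_ge_two by (intro mult_right_mono) auto
        then show "\<bar>l\<bar> \<le> \<bar>2 * pi * l\<bar>" by (simp add: abs_mult)
      qed (use \<tau> l in auto)
      finally show ?thesis .
    next
      case False
      then show ?thesis using \<tau>(2) by (simp add: L not_integrable_integral_eq)
    qed
  qed
  have "\<forall>\<^sub>F l :: real in at_infinity.
      cmod (LINT x:J|\<mu>. exp (2 * complex_of_real pi * \<i> * complex_of_real (g x) * complex_of_real l))
      \<le> C * \<bar>l\<bar> powr (- \<tau>)"
    unfolding eventually_at_infinity using decay by (intro exI[of _ 1]) auto
  then show ?thesis using \<tau>(1,2) by blast
qed

end
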